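(* Let $1\le k\le d$, let $1<p<\infty$, and let $q$ denote its conjugate Hölder exponent, $\tfrac1p+\tfrac1q=1$. If $f,g\in L^2(\mathbb{R}^d)$ satisfy $$\int_{\mathbb{R}^d}\int_{\mathbb{R}^d}|V^k_gf(x,\omega)|\,e^{\frac{\pi}{p}\alpha^p\|x\|_p^p}\,dx\,d\omega<\infty,\qquad \int_{\mathbb{R}^d}\int_{\mathbb{R}^d}|V^k_gf(x,\omega)|\,e^{\frac{\pi}{q}\beta^q\|\omega\|_q^q}\,dx\,d\omega<\infty$$ for $\alpha,\beta>0$ satisfying $\alpha\beta\ge1$, then $f\equiv0$ or $g\equiv0$.
   Context: $\|x\|_p=(\sum_j|x_j|^p)^{1/p}$; $f\equiv0$ means zero a.e. Partial short-time Fourier transform: for $1\le k\le d$ and $f,g\in L^2(\mathbb{R}^d)$, $$V^k_gf(x_1,x_2,\omega_1,\omega_2)=\int_{\mathbb{R}^k}f(t,x_2)\overline{g(t-x_1,-\omega_2)}e^{-2\pi i t\cdot\omega_1}\,dt,$$ for $x=(x_1,x_2)\in\mathbb{R}^k\times\mathbb{R}^{d-k}$, $\omega=(\omega_1,\omega_2)\in\mathbb{R}^k\times\mathbb{R}^{d-k}$ (defined for almost all $(x_2,\omega_2)$); for $k=d$ this is the usual short-time Fourier transform. *)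

theory Defs
  imports "HOL-Analysis.Analysis"
begin

text \<open>
  For a finite set \<open>I\<close> of natural numbers, \<open>\<real>\<^sup>I\<close> consists of the functions \<open>nat \<Rightarrow> real\<close> that are
  \<open>undefined\<close> outside \<open>I\<close> (the space of \<^const>\<open>PiM\<close>). Then \<open>\<real>\<^sup>d\<close> is \<open>\<real>\<^sup>I\<close> for \<open>I = {..<d}\<close>, and
  its splitting into \<open>\<real>\<^sup>k\<close> and \<open>\<real>\<^sup>d\<^sup>-\<^sup>k\<close> is the splitting of \<open>{..<d}\<close> into \<open>{..<k}\<close> and \<open>{k..<d}\<close>;
  for \<open>k = d\<close> the second factor is a single point of measure 1.
\<close>

definition lebesgue_coords :: "nat set \<Rightarrow> (nat \<Rightarrow> real) measure" where
  "lebesgue_coords I = completion (PiM I (\<lambda>_. lborel))"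

abbreviation lebesgue_dim :: "nat \<Rightarrow> (nat \<Rightarrow> real) measure" where
  "lebesgue_dim d \<equiv> lebesgue_coords {..<d}"

text \<open>Representatives of the elements of \<open>L\<^sup>2(\<real>\<^sup>d)\<close>, not equivalence classes.\<close>

definition square_integrable :: "nat \<Rightarrow> ((nat \<Rightarrow> real) \<Rightarrow> complex) \<Rightarrow> bool" where
  "square_integrable d f \<longleftrightarrow>
     f \<in> borel_measurable (lebesgue_dim d) \<and>
     integrable (lebesgue_dim d) (\<lambda>x. (norm (f x))\<^sup>2)"

definition lp_norm :: "nat \<Rightarrow> real \<Rightarrow> (nat \<Rightarrow> real) \<Rightarrow> real" where
  "lp_norm d p x = (\<Sum>j<d. \<bar>x j\<bar> powr p) powr (1 / p)"

text \<open>
  For square integrable \<open>f\<close> and \<open>g\<close>, the integrand is integrable in \<open>t\<close> for almost all \<open>(x\<^sub>2, \<omega>\<^sub>2)\<close>; on the exceptional null set the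
  Bochner integral takes the default value 0. In \<open>merge {..<k} {k..<d} (u, v)\<close> the first \<open>k\<close>
  coordinates come from \<open>u\<close> and the remaining ones from \<open>v\<close>.
\<close>

definition partial_stft ::
  "nat \<Rightarrow> nat \<Rightarrow> ((nat \<Rightarrow> real) \<Rightarrow> complex) \<Rightarrow> ((nat \<Rightarrow> real) \<Rightarrow> complex) \<Rightarrow>
   (nat \<Rightarrow> real) \<Rightarrow> (nat \<Rightarrow> real) \<Rightarrow> complex" where
  "partial_stft d k g f x \<omega> =
     (LINT t|lebesgue_dim k.
        f (merge {..<k} {k..<d} (t, x)) *
        cnj (g (merge {..<k} {k..<d} (\<lambda>i. t i - x i, \<lambda>i. - \<omega> i))) *
        exp (- (2 * of_real pi * \<i> * of_real (\<Sum>i<k. t i * \<omega> i))))"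

end

theory Submission
  imports
    Defs
    "HOL-Complex_Analysis.Complex_Analysis"
    "HOL-Probability.Probability"
    "HOL-Real_Asymp.Real_Asymp"
begin

text \<open>
  Write \<open>h\<^sub>x(t) = f(t) cnj(g(t - x))\<close> and let \<open>V(x, \<omega>)\<close> be the Fourier transform of \<open>h\<^sub>x\<close>
  at \<open>\<omega>\<close>, the short-time Fourier transform. For \<open>(v, w)\<close> fixed, the product
  \<open>K(x, \<omega>) = V(x, \<omega>) V(v - x, w - \<omega>)\<close> is, up to unimodular factors and a rotation of the time-frequency plane,
  its own Fourier transform:

    \<open>|\<integral>\<integral> K(x, \<omega>) exp(2\<pi>i (\<omega>\<cdot>(x - \<eta>) - x\<cdot>(w - \<omega>'))) dx d\<omega>| = |K(\<eta>, \<omega>')|\<close>.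

  So decay of \<open>K\<close> in the frequency variable is decay of a Fourier transform of \<open>K\<close> in the time variable, and
  the two hypotheses become the two hypotheses of an uncertainty principle for one function and its Fourier
  transform.

  The weights \<open>exp(\<pi> a(x))\<close> and \<open>exp(\<pi> b(\<omega>))\<close> of the statement, with \<open>a(r) = \<alpha>\<^sup>p|r|\<^sup>p/p\<close> and \<open>b(r) = \<beta>\<^sup>q|r|\<^sup>q/q\<close>, are
  only half as strong in the exponent as such a principle requires. The product makes up for this: as \<open>a\<close> is
  even and convex, \<open>2 a(x - v/2) \<le> a(x) + a(v - x)\<close>, so integrating over \<open>(v, w)\<close> as well bounds
  \<open>\<integral>\<integral> |K| exp(2\<pi> a(x - v/2))\<close> by the square of the integral in the statement. Hence for almost every \<open>(v, w)\<close> both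
  doubled weights are integrable against \<open>|K|\<close>. One coordinate of \<open>x\<close> and the same coordinate of \<open>\<omega>\<close> suffice.

  Integrating \<open>K\<close> against exponentials, with one coordinate of the exponent complex, gives an entire
  function \<open>F\<close>. Young's inequality \<open>|rs| \<le> a(r) + b(s)\<close>, which is where \<open>\<alpha>\<beta> \<ge> 1\<close> enters, yields
  \<open>|F(x + iy)| \<le> C exp(2\<pi> b(y))\<close>, while the self-duality gives \<open>\<integral> |F(x)| exp(2\<pi> b(x)) dx < \<infinity>\<close>. Hoermander's
  argument for Beurling's theorem then shows \<open>F = 0\<close>: the function \<open>\<Phi>(z) = \<integral>\<^sub>0\<^sup>z F(u) F(iu) du\<close> is bounded on the
  axes, by Phragmen-Lindeloef it is bounded in the plane, so it is constant and \<open>F(z) F(iz) = 0\<close>. Because it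
  uses integrability instead of pointwise bounds, the argument covers the critical case \<open>\<alpha>\<beta> = 1\<close>. It needs \<open>F\<close> to have
  order at most 2. One of \<open>p\<close> and \<open>q\<close> is at most 2, and the coordinate made complex is taken from the
  time or from the frequency side accordingly.

  Thus \<open>K = 0\<close> for almost every \<open>(v, w)\<close>, hence \<open>V = 0\<close> almost everywhere, hence \<open>f(t) cnj(g(t - x)) = 0\<close> for almost all
  \<open>(t, x)\<close> by Fourier inversion, and one of \<open>f\<close>, \<open>g\<close> vanishes. Self-duality also rests on inversion, for
  integrable functions on \<open>\<real>\<^sup>n\<close> with integrable transform; it is obtained here by Gaussian regularisation, tested against
  boxes. For \<open>k < d\<close> all this applies, for almost every \<open>(x\<^sub>2, \<omega>\<^sub>2)\<close>, to the slices \<open>f(\<cdot>, x\<^sub>2)\<close> and \<open>g(\<cdot>, -\<omega>\<^sub>2)\<close>: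
  their \<open>L\<^sup>1\<close> norms have product zero, and integration over \<open>(x\<^sub>2, \<omega>\<^sub>2)\<close> gives the product of the \<open>L\<^sup>1\<close> norms of \<open>f\<close>
  and \<open>g\<close>.
\<close>

section \<open>Phragmen-Lindeloef in a strip and in a sector\<close>

text \<open>
  Multiplication by \<open>exp(-\<epsilon> exp(\<sigma>(w - i\<theta>/2)))\<close>, with \<open>\<sigma>\<close> between 2 and \<open>\<pi>/\<theta>\<close>, beats the growth
  \<open>exp(c exp(2 Re w))\<close> and costs nothing on the boundary; then the maximum principle applies to long rectangles and
  \<open>\<epsilon>\<close> tends to 0. Such a \<open>\<sigma>\<close> exists exactly because \<open>\<theta> < \<pi>/2\<close>.
\<close>

lemma phragmen_lindelof_strip:
  fixes g :: "complex \<Rightarrow> complex"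
  assumes hol: "g holomorphic_on UNIV" and \<theta>: "0 < \<theta>" "\<theta> < pi / 2" and "0 < M"
    and growth: "\<And>w. norm (g w) \<le> C * exp (c * exp (2 * Re w))"
    and lower: "\<And>w. Im w = 0 \<Longrightarrow> norm (g w) \<le> M"
    and upper: "\<And>w. Im w = \<theta> \<Longrightarrow> norm (g w) \<le> M"
    and left: "\<And>w. Re w \<le> - L \<Longrightarrow> norm (g w) \<le> M"
    and w: "0 \<le> Im w" "Im w \<le> \<theta>"
  shows "norm (g w) \<le> M"
proof -
  have "2 < pi / \<theta>" using \<theta> by (simp add: field_simps)
  then obtain \<sigma> where \<sigma>: "2 < \<sigma>" "\<sigma> < pi / \<theta>" using dense by blast
  have \<sigma>\<theta>: "\<sigma> * \<theta> < pi" "0 < \<sigma> * \<theta>" using \<sigma> \<theta> by (auto simp: field_simps)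
  define \<kappa> where "\<kappa> = cos (\<sigma> * \<theta> / 2)"
  have \<kappa>: "0 < \<kappa>" unfolding \<kappa>_def using \<sigma>\<theta> by (intro cos_gt_zero_pi) auto
  have cos_ge: "\<kappa> \<le> cos (\<sigma> * (y - \<theta> / 2))" if "0 \<le> y" "y \<le> \<theta>" for y
  proof -
    have "\<bar>\<sigma> * (y - \<theta> / 2)\<bar> = \<sigma> * \<bar>y - \<theta> / 2\<bar>" using \<sigma> by (simp add: abs_mult)
    also have "\<dots> \<le> \<sigma> * (\<theta> / 2)" using \<sigma> that by (intro mult_left_mono) (auto simp: abs_if)
    finally have le: "\<bar>\<sigma> * (y - \<theta> / 2)\<bar> \<le> \<sigma> * \<theta> / 2" by simp
    have "cos (\<sigma> * \<theta> / 2) \<le> cos \<bar>\<sigma> * (y - \<theta> / 2)\<bar>"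
      using le \<sigma>\<theta> by (intro cos_monotone_0_pi_le) auto
    then show ?thesis by (simp add: \<kappa>_def)
  qed
  have eps: "norm (g w) * exp (- \<epsilon> * (exp (\<sigma> * Re w) * cos (\<sigma> * (Im w - \<theta> / 2)))) \<le> M"
    if "0 < \<epsilon>" for \<epsilon>
  proof -
    have "((\<lambda>r. C * exp (c * exp (2 * r) - \<epsilon> * \<kappa> * exp (\<sigma> * r))) \<longlongrightarrow> 0) at_top"
    proof -
      have "0 < \<epsilon> * \<kappa>" using that \<kappa> by simp
      moreover obtain s where s: "\<sigma> = 2 + s" "0 < s" using \<sigma> by (metis add.commute diff_add_cancel diff_gt_0_iff_gt)
      ultimately have "filterlim (\<lambda>r. \<epsilon> * \<kappa> * exp (s * r) - c) at_top at_top" 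
        by real_asymp
      moreover have "filterlim (\<lambda>r::real. exp (2 * r)) at_top at_top" by real_asymp
      ultimately have "filterlim (\<lambda>r. exp (2 * r) * (\<epsilon> * \<kappa> * exp (s * r) - c)) at_top at_top"
        by (intro filterlim_at_top_mult_at_top)
      then have "filterlim (\<lambda>r. - (exp (2 * r) * (\<epsilon> * \<kappa> * exp (s * r) - c))) at_bot at_top"
        by (simp add: filterlim_uminus_at_top)
      then have "filterlim (\<lambda>r. c * exp (2 * r) - \<epsilon> * \<kappa> * exp (\<sigma> * r)) at_bot at_top"
        by (simp add: s algebra_simps exp_add)
      then have "((\<lambda>r. exp (c * exp (2 * r) - \<epsilon> * \<kappa> * exp (\<sigma> * r))) \<longlongrightarrow> 0) at_top"
        by (rule filterlim_compose[OF exp_at_bot])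
      then show ?thesis by (rule tendsto_mult_right_zero)
    qed
    then have "eventually (\<lambda>r. C * exp (c * exp (2 * r) - \<epsilon> * \<kappa> * exp (\<sigma> * r)) < M) at_top"
      using \<open>0 < M\<close> by (rule order_tendstoD)
    then obtain R where R: "C * exp (c * exp (2 * R) - \<epsilon> * \<kappa> * exp (\<sigma> * R)) < M"
       "R > \<bar>Re w\<bar>" "R > L"
      using eventually_gt_at_top[of "\<bar>Re w\<bar>"] eventually_gt_at_top[of L]
      by (smt (verit) eventually_at_top_linorder nle_le)
    define S where "S = cbox (Complex (-R) 0) (Complex R \<theta>)"
    define h where "h z = g z * exp (- of_real \<epsilon> * exp (of_real \<sigma> * (z - \<i> * of_real (\<theta> / 2))))" for z
    have norm_h: "norm (h z) = norm (g z) * exp (- \<epsilon> * (exp (\<sigma> * Re z) * cos (\<sigma> * (Im z - \<theta> / 2))))" for z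
      by (simp add: h_def norm_mult Re_exp)
    have holh: "h holomorphic_on A" for A
      unfolding h_def using holomorphic_on_subset[OF hol] by (intro holomorphic_intros) auto
    have "norm (h w) \<le> M"
    proof (rule maximum_modulus_frontier[of h S])
      show "continuous_on (closure S) h" using holh by (rule holomorphic_on_imp_continuous_on)
      show "bounded S" by (simp add: S_def)
      show "w \<in> S" using w R abs_le_D1[of "Re w" R] abs_le_D2[of "Re w" R] by (simp add: S_def in_cbox_complex_iff)
      fix z assume "z \<in> frontier S"
      then have zb: "- R \<le> Re z" "Re z \<le> R" "0 \<le> Im z" "Im z \<le> \<theta>"
        and "Re z = -R \<or> Re z = R \<or> Im z = 0 \<or> Im z = \<theta>"
        by (auto simp: S_def frontier_cbox in_cbox_complex_iff in_box_complex_iff)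
      have *: "norm (h z) \<le> norm (g z) * exp (- \<epsilon> * (exp (\<sigma> * Re z) * \<kappa>))"
        unfolding norm_h using cos_ge[OF zb(3,4)] that
        by (intro mult_left_mono) (auto intro!: mult_left_mono)
      also have "\<dots> \<le> norm (g z)"
        using \<kappa> that by (intro mult_left_le) auto
      finally have **: "norm (h z) \<le> norm (g z)" .
      consider "Re z = R" | "norm (g z) \<le> M"
        using \<open>Re z = -R \<or> _\<close> left[of z] lower[of z] upper[of z] R by fastforce
      then show "norm (h z) \<le> M"
      proof cases
        case 1
        have "norm (h z) \<le> (C * exp (c * exp (2 * R))) * exp (- \<epsilon> * (exp (\<sigma> * R) * \<kappa>))"
          using * growth[of z] 1 by (smt (verit) exp_ge_zero mult_right_mono)
        also have "\<dots> = C * exp (c * exp (2 * R) - \<epsilon> * \<kappa> * exp (\<sigma> * R))"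
          by (simp add: exp_diff exp_minus field_simps)
        finally show ?thesis using R by simp
      qed (use ** in auto)
    qed (use holh in auto)
    then show ?thesis by (simp add: norm_h)
  qed
  define K where "K = exp (\<sigma> * Re w) * cos (\<sigma> * (Im w - \<theta> / 2))"
  have "((\<lambda>\<epsilon>. norm (g w) * exp (- \<epsilon> * K)) \<longlongrightarrow> norm (g w) * exp (- 0 * K)) (at_right 0)"
    by (intro tendsto_intros)
  then have "norm (g w) * exp (- 0 * K) \<le> M"
    by (rule tendsto_upperbound)
       (use eps in \<open>auto simp: K_def intro!: eventually_at_rightI[of 0 1]\<close>)
  then show ?thesis by simp
qed

text \<open>
  The exponential map carries the strip to the sector and growth \<open>exp(c exp(2 Re w))\<close> to order 2. The value 0 at the
  vertex replaces the bound that is needed at the left end of the strip.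
\<close>

lemma phragmen_lindelof_sector:
  fixes \<Phi> :: "complex \<Rightarrow> complex"
  assumes hol: "\<Phi> holomorphic_on UNIV" and "\<Phi> 0 = 0" and \<theta>: "0 < \<theta>" "\<theta> < pi / 2" and "0 \<le> M"
    and growth: "\<And>z. norm (\<Phi> z) \<le> C * exp (c * (norm z)\<^sup>2)"
    and lower: "\<And>r. 0 \<le> r \<Longrightarrow> norm (\<Phi> (of_real r)) \<le> M"
    and upper: "\<And>r. 0 \<le> r \<Longrightarrow> norm (\<Phi> (of_real r * cis \<theta>)) \<le> M"
    and "0 \<le> r" "0 \<le> t" "t \<le> \<theta>"
  shows "norm (\<Phi> (of_real r * cis t)) \<le> M"
proof (cases "r = 0")
  case False
  have "norm (\<Phi> (of_real r * cis t)) \<le> M + \<delta>" if "0 < \<delta>" for \<delta>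
  proof -
    have "isCont \<Phi> 0" 
      using holomorphic_on_imp_continuous_on[OF hol] by (simp add: continuous_on_eq_continuous_at)
    then obtain d where d: "0 < d" "\<And>z. norm z < d \<Longrightarrow> norm (\<Phi> z) < \<delta>"
      using \<open>0 < \<delta>\<close> \<open>\<Phi> 0 = 0\<close> unfolding continuous_at_eps_delta by (force simp: dist_norm)
    have polar: "exp w = of_real (exp (Re w)) * cis (Im w)" for w
      by (rule exp_eq_polar)
    have "norm ((\<lambda>w. \<Phi> (exp w)) (Complex (ln r) t)) \<le> M + \<delta>"
    proof (rule phragmen_lindelof_strip[where g = "\<lambda>w. \<Phi> (exp w)" and w = "Complex (ln r) t" and
          \<theta> = \<theta> and C = C and c = c and L = "- (ln d - 1)"])
      show "(\<lambda>w. \<Phi> (exp w)) holomorphic_on UNIV"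
        using holomorphic_on_compose_gen[OF holomorphic_on_exp hol] by (simp add: o_def)
      show "norm (\<Phi> (exp w)) \<le> C * exp (c * exp (2 * Re w))" for w
        using growth[of "exp w"] by (simp add: exp_double)
      show "norm (\<Phi> (exp w)) \<le> M + \<delta>" if "Im w = 0" for w
      proof -
        have "norm (\<Phi> (exp w)) \<le> M"
          unfolding polar[of w] that using lower[of "exp (Re w)"] by simp
        then show ?thesis using \<open>0 < \<delta>\<close> by linarith
      qed
      show "norm (\<Phi> (exp w)) \<le> M + \<delta>" if "Im w = \<theta>" for w
      proof -
        have "norm (\<Phi> (exp w)) \<le> M"
          unfolding polar[of w] that using upper[of "exp (Re w)"] by simp
        then show ?thesis using \<open>0 < \<delta>\<close> by linarith
      qed
      show "norm (\<Phi> (exp w)) \<le> M + \<delta>" if "Re w \<le> - (- (ln d - 1))" for w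
      proof -
        have "exp (Re w) < exp (ln d)" using that by (subst exp_less_cancel_iff) linarith
        then have "norm (exp w) < d" using \<open>0 < d\<close> by simp
        from d(2)[OF this] show ?thesis using \<open>0 \<le> M\<close> by linarith
      qed
      show "0 < M + \<delta>" using \<open>0 \<le> M\<close> \<open>0 < \<delta>\<close> by linarith
    qed (use assms in simp_all)
    moreover have "exp (Complex (ln r) t) = of_real r * cis t"
      using False \<open>0 \<le> r\<close> by (simp add: polar)
    ultimately show ?thesis by simp
  qed
  then show ?thesis by (rule field_le_epsilon)
next
  case True
  then show ?thesis using \<open>\<Phi> 0 = 0\<close> \<open>0 \<le> M\<close> by simp
qed

section \<open>Hoermander's auxiliary function\<close>

text \<open>
  The primitive of \<open>F(u) G(\<omega> u)\<close> that vanishes at 0, as an integral over the segment from 0 to \<open>z\<close>. In this form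
  it is visibly continuous in \<open>\<omega>\<close>, so that a bound for directions \<open>\<omega>\<close> close to \<open>\<i>\<close> passes to \<open>\<omega> = \<i>\<close>.
\<close>

definition ray_product_primitive :: "complex \<Rightarrow> (complex \<Rightarrow> complex) \<Rightarrow> (complex \<Rightarrow> complex) \<Rightarrow> complex \<Rightarrow> complex" where
  "ray_product_primitive \<omega> F G z = z * integral {0..1} (\<lambda>s. F (of_real s * z) * G (\<omega> * (of_real s * z)))"

lemma ray_product_primitive_deriv:
  assumes "F holomorphic_on UNIV" "G holomorphic_on UNIV"
  shows "(ray_product_primitive \<omega> F G has_field_derivative F z * G (\<omega> * z)) (at z)"
proof -
  define P where "P u = F u * G (\<omega> * u)" for u
  have "(\<lambda>u. G (\<omega> * u)) holomorphic_on UNIV"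
    using holomorphic_on_compose_gen[of "\<lambda>u. \<omega> * u" UNIV G UNIV] assms by (auto simp: o_def intro!: holomorphic_intros)
  then have "P holomorphic_on UNIV" unfolding P_def using assms by (intro holomorphic_intros)
  then obtain g where g: "\<And>x. (g has_field_derivative P x) (at x)"
    using holomorphic_convex_primitive'[of UNIV P] by auto
  have "ray_product_primitive \<omega> F G z = g z - g 0" for z
  proof -
    have "(P has_contour_integral (g (pathfinish (linepath 0 z)) - g (pathstart (linepath 0 z)))) (linepath 0 z)"
      by (rule contour_integral_primitive[where S = UNIV, OF _ valid_path_linepath]) (use g in auto)
    then have "((\<lambda>s. P (linepath 0 z s) * z) has_integral (g z - g 0)) {0..1}"
      by (simp add: has_contour_integral_linepath)
    then have "((\<lambda>s. P (of_real s * z) * z) has_integral (g z - g 0)) {0..1}"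
      by (simp add: linepath_def scaleR_conv_of_real)
    then have "integral {0..1} (\<lambda>s. P (of_real s * z) * z) = g z - g 0"
      by (rule integral_unique)
    then show ?thesis by (simp add: ray_product_primitive_def P_def mult.commute)
  qed
  then have "ray_product_primitive \<omega> F G = (\<lambda>z. g z - g 0)" by auto
  then show ?thesis using g[of z] by (auto intro!: derivative_eq_intros simp: P_def)
qed

text \<open>
  On the ray through \<open>e\<close> the primitive is \<open>e\<close> times an integral over \<open>[0, r]\<close>, so an integrable majorant of the
  integrand on the whole ray bounds it independently of \<open>r\<close>.
\<close>

lemma ray_product_primitive_bound_ray:
  assumes F: "F holomorphic_on UNIV" and G: "G holomorphic_on UNIV" and "norm e = 1" "0 \<le> r"
    and H: "\<And>s. 0 \<le> s \<Longrightarrow> norm (F (of_real s * e) * G (\<omega> * (of_real s * e))) \<le> H s"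
    and int: "(\<integral>\<^sup>+ s. ennreal (H s) * indicator {0..} s \<partial>lborel) \<le> ennreal A" and "0 \<le> A"
  shows "norm (ray_product_primitive \<omega> F G (of_real r * e)) \<le> A"
proof (cases "r = 0")
  case False
  define P where "P s = F (of_real s * e) * G (\<omega> * (of_real s * e))" for s :: real
  have cF: "continuous_on UNIV F" "continuous_on UNIV G"
    using F G by (auto intro: holomorphic_on_imp_continuous_on)
  have cP: "continuous_on A P" for A
    unfolding P_def
    by (intro continuous_intros continuous_on_compose2[OF cF(1)] continuous_on_compose2[OF cF(2)]) auto
  have "((\<lambda>s. P (r * s + 0)) has_integral (1 / \<bar>r\<bar>) *\<^sub>R integral {0..r} P) ((\<lambda>s. (1 / r) *\<^sub>R s + - ((1 / r) *\<^sub>R 0)) ` {0..r})"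
    using has_integral_affinity[of P "integral {0..r} P" 0 r r 0] False integrable_integral[OF integrable_continuous_real[OF cP]] 
    by simp
  moreover have "(\<lambda>s. (1 / r) *\<^sub>R s + - ((1 / r) *\<^sub>R 0)) ` {0..r} = {0..1}"
    using False \<open>0 \<le> r\<close> by (auto simp: image_iff field_simps intro!: bexI[of _ "r * _"])
  ultimately have "integral {0..1} (\<lambda>s. P (r * s)) = (1 / r) *\<^sub>R integral {0..r} P"
    using \<open>0 \<le> r\<close> by (auto intro: integral_unique)
  then have eq: "norm (ray_product_primitive \<omega> F G (of_real r * e)) = norm (integral {0..r} P)"
    using False \<open>0 \<le> r\<close> \<open>norm e = 1\<close>
    by (simp add: ray_product_primitive_def P_def norm_mult mult_ac)
  have set: "set_integrable lborel {0..r} P"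
    using borel_integrable_compact[of "{0..r}" P] cP by (auto simp: set_integrable_def)
  have "norm (integral {0..r} P) = norm (LINT s:{0..r}|lborel. P s)"
    using set_borel_integral_eq_integral[OF set] by simp
  also have "ennreal \<dots> \<le> (\<integral>\<^sup>+ s. ennreal (norm (indicator {0..r} s *\<^sub>R P s)) \<partial>lborel)"
    using integral_norm_bound_ennreal[of lborel "\<lambda>s. indicator {0..r} s *\<^sub>R P s"] set
    by (simp add: set_integrable_def set_lebesgue_integral_def)
  also have "\<dots> \<le> (\<integral>\<^sup>+ s. ennreal (H s) * indicator {0..} s \<partial>lborel)"
    using H by (intro nn_integral_mono) (auto simp: P_def indicator_def intro: ennreal_leI)
  also have "\<dots> \<le> ennreal A" by (rule int)
  finally show ?thesis using \<open>0 \<le> A\<close> by (simp add: eq)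
qed (use assms in \<open>simp add: ray_product_primitive_def\<close>)

lemma ray_product_primitive_growth:
  assumes F: "F holomorphic_on UNIV" and G: "G holomorphic_on UNIV" and "norm \<omega> = 1" 
    and bF: "\<And>z. norm (F z) \<le> C * exp (c * (norm z)\<^sup>2)"
    and bG: "\<And>z. norm (G z) \<le> C * exp (c * (norm z)\<^sup>2)" and "0 \<le> c" "0 \<le> C"
  shows "norm (ray_product_primitive \<omega> F G z) \<le> C\<^sup>2 * exp ((2 * c + 1) * (norm z)\<^sup>2)"
proof -
  have cF: "continuous_on UNIV F" "continuous_on UNIV G"
    using F G by (auto intro: holomorphic_on_imp_continuous_on)
  define P where "P s = F (of_real s * z) * G (\<omega> * (of_real s * z))" for s :: real
  have "norm (integral {0..1} P) \<le> integral {0..1} (\<lambda>s::real. C\<^sup>2 * exp (2 * c * (norm z)\<^sup>2))"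
  proof (rule integral_norm_bound_integral)
    show "P integrable_on {0..1}" unfolding P_def
      by (intro integrable_continuous_real continuous_intros continuous_on_compose2[OF cF(1)] continuous_on_compose2[OF cF(2)]) auto
    fix s :: real assume "s \<in> {0..1}"
    then have "s\<^sup>2 \<le> 1" by (auto simp: abs_square_le_1)
    then have le: "(s * norm z)\<^sup>2 \<le> (norm z)\<^sup>2"
      by (simp add: power_mult_distrib mult_left_le_one_le)
    have "norm (P s) \<le> (C * exp (c * (s * norm z)\<^sup>2)) * (C * exp (c * (s * norm z)\<^sup>2))"
      unfolding P_def norm_mult
      using bF[of "of_real s * z"] bG[of "\<omega> * (of_real s * z)"] \<open>norm \<omega> = 1\<close> \<open>0 \<le> C\<close>
      by (intro mult_mono) (auto simp: norm_mult power_mult_distrib)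
    also have "\<dots> = C\<^sup>2 * exp (2 * c * (s * norm z)\<^sup>2)" 
      by (simp add: power2_eq_square mult_exp_exp algebra_simps)
    also have "\<dots> \<le> C\<^sup>2 * exp (2 * c * (norm z)\<^sup>2)"
      using le \<open>0 \<le> c\<close> by (intro mult_left_mono) (auto intro!: mult_left_mono)
    finally show "norm (P s) \<le> C\<^sup>2 * exp (2 * c * (norm z)\<^sup>2)" .
  qed auto
  then have "norm (integral {0..1} P) \<le> C\<^sup>2 * exp (2 * c * (norm z)\<^sup>2)" by simp
  moreover have "norm z \<le> exp ((norm z)\<^sup>2)"
  proof -
    have "2 * norm z \<le> 1 + (norm z)\<^sup>2" using sum_squares_bound[of 1 "norm z"] by simp
    then have "norm z \<le> 1 + (norm z)\<^sup>2" by (smt (verit) norm_ge_zero)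
    then show ?thesis using exp_ge_add_one_self[of "(norm z)\<^sup>2"] by linarith
  qed
  ultimately have "norm z * norm (integral {0..1} P) \<le> exp ((norm z)\<^sup>2) * (C\<^sup>2 * exp (2 * c * (norm z)\<^sup>2))"
    by (intro mult_mono) auto
  also have "\<dots> = C\<^sup>2 * exp ((2 * c + 1) * (norm z)\<^sup>2)"
    by (simp add: mult_exp_exp algebra_simps)
  finally show ?thesis by (simp add: ray_product_primitive_def P_def[abs_def] norm_mult)
qed

lemma ray_product_primitive_continuous_direction:
  assumes F: "F holomorphic_on UNIV" and G: "G holomorphic_on UNIV"
  shows "isCont (\<lambda>\<omega>. ray_product_primitive \<omega> F G z) \<omega>"
proof -
  have cF: "continuous_on UNIV F" "continuous_on UNIV G"
    using F G by (auto intro: holomorphic_on_imp_continuous_on)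
  have "continuous_on UNIV (\<lambda>\<omega>. integral (cbox 0 1) (\<lambda>s. F (of_real s * z) * G (\<omega> * (of_real s * z))))"
    by (rule integral_continuous_on_param)
       (auto simp: case_prod_unfold intro!: continuous_intros continuous_on_compose2[OF cF(1)] continuous_on_compose2[OF cF(2)])
  then show ?thesis unfolding ray_product_primitive_def 
    by (simp add: continuous_on_eq_continuous_at)
qed

section \<open>Entire functions with conjugate growth and decay\<close>

text \<open>
  Growth at most \<open>w\<close> away from the real axis, compensated by integrability against \<open>w\<close> on the real axis. The constant
  \<open>A\<close> is part of the predicate because the estimates in rotated sectors have to be uniform.
\<close>

definition beurling_decay :: "(real \<Rightarrow> real) \<Rightarrow> real \<Rightarrow> (complex \<Rightarrow> complex) \<Rightarrow> bool" where
  "beurling_decay w A F \<longleftrightarrow> F holomorphic_on UNIV \<and> (\<forall>z. norm (F z) \<le> w \<bar>Im z\<bar>) \<and>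
     (\<integral>\<^sup>+ x. ennreal (norm (F (of_real x)) * w \<bar>x\<bar>) \<partial>lborel) \<le> ennreal A"

lemma nn_integral_lborel_minus:
  fixes f :: "real \<Rightarrow> ennreal"
  assumes "f \<in> borel_measurable borel"
  shows "(\<integral>\<^sup>+ x. f (- x) \<partial>lborel) = (\<integral>\<^sup>+ x. f x \<partial>lborel)"
  using nn_integral_real_affine[OF assms, of "-1" 0] by simp

lemma beurling_decay_minus:
  assumes "beurling_decay w A F" and [measurable]: "w \<in> borel_measurable borel"
  shows "beurling_decay w A (\<lambda>z. F (- z))"
proof -
  have F: "F holomorphic_on UNIV" "continuous_on UNIV F" using assms
    by (auto simp: beurling_decay_def intro: holomorphic_on_imp_continuous_on)
  have [measurable]: "F \<in> borel_measurable borel" using F(2) by (rule borel_measurable_continuous_onI)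
  have "(\<lambda>z. F (- z)) holomorphic_on UNIV"
    using holomorphic_on_compose_gen[OF holomorphic_on_minus[OF holomorphic_on_id] F(1)] by (simp add: o_def id_def)
  moreover have "(\<integral>\<^sup>+ x. ennreal (norm (F (- of_real x)) * w \<bar>x\<bar>) \<partial>lborel) 
      = (\<integral>\<^sup>+ x. ennreal (norm (F (of_real x)) * w \<bar>x\<bar>) \<partial>lborel)"
    using nn_integral_lborel_minus[of "\<lambda>x. ennreal (norm (F (of_real x)) * w \<bar>x\<bar>)"] by simp
  ultimately show ?thesis using assms unfolding beurling_decay_def by (metis abs_minus_cancel uminus_complex.simps(2))
qed

context
  fixes w :: "real \<Rightarrow> real" and A C c :: real
  assumes w_mono: "\<And>r s. 0 \<le> r \<Longrightarrow> r \<le> s \<Longrightarrow> w r \<le> w s"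
    and w_growth: "\<And>r. 0 \<le> r \<Longrightarrow> w r \<le> C * exp (c * r\<^sup>2)"
    and [measurable]: "w \<in> borel_measurable borel"
    and w_nonneg: "\<And>r. 0 \<le> r \<Longrightarrow> 0 \<le> w r" and nonneg: "0 \<le> A" "0 \<le> C" "0 \<le> c"
begin

lemma beurling_decay_growth:
  assumes "beurling_decay w A F"
  shows "norm (F z) \<le> C * exp (c * (norm z)\<^sup>2)"
proof -
  have "norm (F z) \<le> w \<bar>Im z\<bar>" using assms by (simp add: beurling_decay_def)
  also have "\<dots> \<le> C * exp (c * \<bar>Im z\<bar>\<^sup>2)" by (rule w_growth) simp
  also have "\<dots> \<le> C * exp (c * (norm z)\<^sup>2)"
    using nonneg power_mono[OF abs_Im_le_cmod[of z], of 2] by (intro mult_left_mono) (auto intro!: mult_left_mono)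
  finally show ?thesis .
qed

text \<open>
  On the positive real axis the factor \<open>F(s)\<close> is integrable against \<open>w\<close>, and \<open>w\<close> bounds the other factor.
\<close>

lemma ray_product_primitive_lower_ray:
  assumes F: "beurling_decay w A F" and G: "beurling_decay w A G" and "0 \<le> r" "norm \<omega> = 1"
  shows "norm (ray_product_primitive \<omega> F G (of_real r)) \<le> A"
proof -
  have "norm (ray_product_primitive \<omega> F G (of_real r * 1)) \<le> A"
  proof (rule ray_product_primitive_bound_ray[where H = "\<lambda>s. norm (F (of_real s)) * w \<bar>s\<bar>"])
    fix s :: real assume "0 \<le> s"
    have "norm (G (\<omega> * of_real s)) \<le> w \<bar>Im (\<omega> * of_real s)\<bar>" using G unfolding beurling_decay_def by blast
    also have "\<dots> \<le> w \<bar>s\<bar>" 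
      using \<open>norm \<omega> = 1\<close> \<open>0 \<le> s\<close> abs_Im_le_cmod[of \<omega>] by (intro w_mono) (auto simp: abs_mult mult_left_le_one_le)
    finally show "norm (F (of_real s * 1) * G (\<omega> * (of_real s * 1))) \<le> norm (F (of_real s)) * w \<bar>s\<bar>"
      by (simp add: norm_mult mult_left_mono)
  next
    have "(\<integral>\<^sup>+ s. ennreal (norm (F (of_real s)) * w \<bar>s\<bar>) * indicator {0..} s \<partial>lborel)
        \<le> (\<integral>\<^sup>+ s. ennreal (norm (F (of_real s)) * w \<bar>s\<bar>) \<partial>lborel)"
      by (intro nn_integral_mono) (auto simp: indicator_def)
    also have "\<dots> \<le> ennreal A" using F by (simp add: beurling_decay_def)
    finally show "(\<integral>\<^sup>+ s. ennreal (norm (F (of_real s)) * w \<bar>s\<bar>) * indicator {0..} s \<partial>lborel) \<le> ennreal A" .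
  qed (use F G nonneg assms in \<open>auto simp: beurling_decay_def\<close>)
  then show ?thesis by simp
qed

text \<open>
  The direction is chosen so that on the ray of angle \<open>\<theta>\<close> the second factor is evaluated at \<open>-s\<close>: the two factors
  exchange roles.
\<close>

lemma ray_product_primitive_upper_ray:
  assumes F: "beurling_decay w A F" and G: "beurling_decay w A G" and "0 \<le> r"
  shows "norm (ray_product_primitive (cis (pi - \<theta>)) F G (of_real r * cis \<theta>)) \<le> A"
proof (rule ray_product_primitive_bound_ray[where H = "\<lambda>s. norm (G (of_real (- s))) * w \<bar>s\<bar>"])
  fix s :: real assume "0 \<le> s"
  have "norm (F (of_real s * cis \<theta>)) \<le> w \<bar>Im (of_real s * cis \<theta>)\<bar>" using F unfolding beurling_decay_def by blast
  also have "\<dots> \<le> w \<bar>s\<bar>" 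
    using \<open>0 \<le> s\<close> by (intro w_mono) (auto simp: abs_mult mult_left_le)
  finally have "norm (F (of_real s * cis \<theta>)) \<le> w \<bar>s\<bar>" .
  moreover have "cis (pi - \<theta>) * (of_real s * cis \<theta>) = - of_real s"
  proof -
    have "cis (pi - \<theta>) * cis \<theta> = -1" by (simp add: cis_mult)
    then show ?thesis by (metis mult.left_commute mult_minus1_right)
  qed
  ultimately show "norm (F (of_real s * cis \<theta>) * G (cis (pi - \<theta>) * (of_real s * cis \<theta>))) \<le> norm (G (of_real (- s))) * w \<bar>s\<bar>"
    by (subst norm_mult, subst mult.commute) (simp add: mult_left_mono)
next
  have G': "beurling_decay w A (\<lambda>z. G (- z))" using G by (rule beurling_decay_minus) simp
  have "(\<integral>\<^sup>+ s. ennreal (norm (G (of_real (- s))) * w \<bar>s\<bar>) * indicator {0..} s \<partial>lborel)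
      \<le> (\<integral>\<^sup>+ s. ennreal (norm (G (of_real (- s))) * w \<bar>s\<bar>) \<partial>lborel)"
    by (intro nn_integral_mono) (auto simp: indicator_def)
  also have "\<dots> \<le> ennreal A" using G' by (simp add: beurling_decay_def)
  finally show "(\<integral>\<^sup>+ s. ennreal (norm (G (of_real (- s))) * w \<bar>s\<bar>) * indicator {0..} s \<partial>lborel) \<le> ennreal A" .
qed (use F G nonneg assms in \<open>auto simp: beurling_decay_def\<close>)

text \<open>
  In the quadrant itself order 2 is the critical order and Phragmen-Lindeloef fails. Turning the direction \<open>\<i>\<close> by a small angle
  \<open>a\<close> makes the product integrable on the two sides of the smaller sector of angle \<open>\<pi>/2 - a\<close>, where it applies with a
  bound that does not depend on \<open>a\<close>. Then \<open>a\<close> tends to 0.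
\<close>

lemma ray_product_primitive_bound_quadrant:
  assumes F: "beurling_decay w A F" and G: "beurling_decay w A G" and "0 \<le> Re z" "0 \<le> Im z"
  shows "norm (ray_product_primitive \<i> F G z) \<le> A"
proof -
  have hol: "F holomorphic_on UNIV" "G holomorphic_on UNIV" using F G by (auto simp: beurling_decay_def)
  have "norm (ray_product_primitive \<i> F G (of_real r * cis t)) \<le> A" if "0 \<le> t" "t \<le> pi / 2" "0 \<le> r" for r t
  proof (cases "t = pi / 2")
    case True
    show ?thesis using ray_product_primitive_upper_ray[OF F G \<open>0 \<le> r\<close>, of "pi / 2"] unfolding True by simp
  next
    case False
    then have t: "t < pi / 2" using that by simp
    \<comment> \<open>growth of order 2 is below the critical order \<open>\<pi> / (\<pi> / 2 - a)\<close> of the smaller sector\<close>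
    have a: "norm (ray_product_primitive (cis (pi / 2 + a)) F G (of_real r * cis t)) \<le> A" 
      if a: "0 < a" "a < pi / 2 - t" for a
    proof (rule phragmen_lindelof_sector)
      show "ray_product_primitive (cis (pi / 2 + a)) F G holomorphic_on UNIV"
        using ray_product_primitive_deriv[OF hol] by (auto simp: holomorphic_on_def field_differentiable_def)
      show "norm (ray_product_primitive (cis (pi / 2 + a)) F G z) \<le> C\<^sup>2 * exp ((2 * c + 1) * (norm z)\<^sup>2)" for z
        using nonneg F G by (intro ray_product_primitive_growth hol beurling_decay_growth) auto
      show "norm (ray_product_primitive (cis (pi / 2 + a)) F G (of_real r)) \<le> A" if "0 \<le> r" for r
        using ray_product_primitive_lower_ray[OF F G that] by simp
      show "norm (ray_product_primitive (cis (pi / 2 + a)) F G (of_real r * cis (pi / 2 - a))) \<le> A" if "0 \<le> r" for r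
        using ray_product_primitive_upper_ray[OF F G that, of "pi / 2 - a"] by (simp add: algebra_simps)
    qed (use that a nonneg \<open>0 \<le> t\<close> \<open>0 \<le> r\<close> in \<open>auto simp: ray_product_primitive_def\<close>)
    have "isCont (\<lambda>a. ray_product_primitive (cis (pi / 2 + a)) F G (of_real r * cis t)) 0"
      by (rule isCont_o2[OF _ ray_product_primitive_continuous_direction[OF hol]])
         (unfold cis_conv_exp, intro continuous_intros)
    then have "((\<lambda>a. ray_product_primitive (cis (pi / 2 + a)) F G (of_real r * cis t)) \<longlongrightarrow> 
       ray_product_primitive \<i> F G (of_real r * cis t)) (at_right 0)"
      by (auto simp: isCont_def intro: filterlim_mono[OF _ order_refl at_le])
    then have "((\<lambda>a. norm (ray_product_primitive (cis (pi / 2 + a)) F G (of_real r * cis t))) \<longlongrightarrow> 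
       norm (ray_product_primitive \<i> F G (of_real r * cis t))) (at_right 0)"
      by (rule tendsto_norm)
    then show ?thesis
      by (rule tendsto_upperbound)
         (use a t in \<open>auto intro!: eventually_at_rightI[of 0 "pi / 2 - t"]\<close>)
  qed
  note polar = this
  show ?thesis
  proof (cases "z = 0")
    case False
    have "0 \<le> Arg z" using \<open>0 \<le> Im z\<close> Arg_less_0 by blast
    moreover have "Arg z \<le> pi / 2"
      using Re_Ln_pos_le[OF False] Arg_eq_Im_Ln[OF False] \<open>0 \<le> Re z\<close> by simp
    ultimately have "norm (ray_product_primitive \<i> F G (rcis (norm z) (Arg z))) \<le> A"
      unfolding rcis_def by (rule polar) simp
    then show ?thesis by (simp only: rcis_cmod_Arg)
  qed (use nonneg in \<open>simp add: ray_product_primitive_def\<close>)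
qed

text \<open>
  A quarter turn exchanges the two functions and reflects one of them, which reduces all quadrants to the first.
\<close>

lemma ray_product_primitive_rotate:
  "ray_product_primitive \<i> F G (\<i> * z) = \<i> * ray_product_primitive \<i> (\<lambda>z. G (- z)) F z"
proof -
  have *: "\<i> * (of_real s * (\<i> * z)) = - (of_real s * z)" for s
    by (simp add: algebra_simps)
  show ?thesis by (simp add: ray_product_primitive_def * mult_ac)
qed

lemma ray_product_primitive_bounded:
  assumes F: "beurling_decay w A F" and G: "beurling_decay w A G"
  shows "norm (ray_product_primitive \<i> F G z) \<le> A"
proof -
  have rot: "norm (ray_product_primitive \<i> F G z) = norm (ray_product_primitive \<i> (\<lambda>z. G (- z)) F (- \<i> * z))" for F G z
    using ray_product_primitive_rotate[of F G "- \<i> * z"] by (simp add: norm_mult)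
  have minus: "beurling_decay w A (\<lambda>z. F (- z))" if "beurling_decay w A F" for F
    using that by (rule beurling_decay_minus) simp
  have 2: "norm (ray_product_primitive \<i> F G z) \<le> A" 
    if "beurling_decay w A F" "beurling_decay w A G" "Re z \<le> 0" "0 \<le> Im z" for F G z
    unfolding rot[of F G] by (rule ray_product_primitive_bound_quadrant) (use that in \<open>auto intro: minus\<close>)
  have 3: "norm (ray_product_primitive \<i> F G z) \<le> A" 
    if "beurling_decay w A F" "beurling_decay w A G" "Re z \<le> 0" "Im z \<le> 0" for F G z
    unfolding rot[of F G] by (rule 2) (use that in \<open>auto intro: minus\<close>)
  have 4: "norm (ray_product_primitive \<i> F G z) \<le> A" 
    if "beurling_decay w A F" "beurling_decay w A G" "0 \<le> Re z" "Im z \<le> 0" for F G z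
    unfolding rot[of F G] by (rule 3) (use that in \<open>auto intro: minus\<close>)
  show ?thesis
    using ray_product_primitive_bound_quadrant[OF F G, of z] 2[OF F G, of z] 3[OF F G, of z] 4[OF F G, of z] by linarith
qed

text \<open>
  The primitive is bounded and entire, hence constant, and its derivative \<open>F(u) F(iu)\<close> vanishes identically. If \<open>F\<close>
  is nonzero near \<open>z\<close>, it vanishes near \<open>iz\<close>, hence everywhere.
\<close>

lemma beurling_hoermander_entire:
  assumes F: "beurling_decay w A F"
  shows "F z = 0"
proof (rule ccontr)
  assume "F z \<noteq> 0"
  have hol: "F holomorphic_on UNIV" using F by (auto simp: beurling_decay_def)
  define \<Phi> where "\<Phi> = ray_product_primitive \<i> F F"
  have deriv: "(\<Phi> has_field_derivative F u * F (\<i> * u)) (at u)" for u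
    unfolding \<Phi>_def by (rule ray_product_primitive_deriv[OF hol hol])
  have "\<Phi> holomorphic_on UNIV" using deriv by (auto simp: holomorphic_on_def field_differentiable_def)
  moreover have "bounded (range \<Phi>)"
    using ray_product_primitive_bounded[OF F F] by (auto simp: \<Phi>_def bounded_iff)
  ultimately obtain k where "\<And>u. \<Phi> u = k" using Liouville_theorem by (metis UNIV_I constant_on_def)
  then have "\<Phi> = (\<lambda>u. k)" by auto
  then have prod0: "F u * F (\<i> * u) = 0" for u using deriv[of u] DERIV_unique[OF _ DERIV_const] by metis
  have "isCont F z" 
    by (metis hol holomorphic_on_imp_continuous_on UNIV_I continuous_on_eq_continuous_at open_UNIV)
  then obtain e where e: "e > 0" "\<And>y. dist z y < e \<Longrightarrow> F y \<noteq> 0"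
    using continuous_at_avoid[of z F 0] \<open>F z \<noteq> 0\<close> by auto
  have "F z = 0"
  proof (rule analytic_continuation[OF hol, of "ball (\<i> * z) e" "\<i> * z"])
    \<comment> \<open>\<open>F\<close> vanishes on the ball around \<open>\<i> * z\<close> because \<open>F\<close> has no zero on the ball around \<open>z\<close>\<close>
    show "\<i> * z islimpt ball (\<i> * z) e" using e by (simp add: islimpt_ball)
    fix y assume "y \<in> ball (\<i> * z) e"
    then have "dist z (- \<i> * y) < e" 
    proof -
      have "norm (z + \<i> * y) = norm (\<i> * (z + \<i> * y))" by (simp add: norm_mult)
      then have "norm (z + \<i> * y) = norm (\<i> * z - y)" by (simp add: algebra_simps)
      then show ?thesis using \<open>y \<in> _\<close> by (simp add: dist_norm)
    qed
    then have "F (- \<i> * y) \<noteq> 0" by (rule e)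
    then show "F y = 0" using prod0[of "- \<i> * y"] by simp
  qed auto
  with \<open>F z \<noteq> 0\<close> show False by simp
qed
end

section \<open>Fourier-Laplace integrals\<close>

text \<open>
  The phase \<open>\<phi>\<close> is an arbitrary measurable function: it will be a single coordinate on a time-frequency space,
  while all other exponentials are absorbed into \<open>K\<close>.
\<close>

definition fourier_laplace :: "'a measure \<Rightarrow> ('a \<Rightarrow> complex) \<Rightarrow> ('a \<Rightarrow> real) \<Rightarrow> complex \<Rightarrow> complex" where
  "fourier_laplace M K \<phi> z = (LINT x|M. K x * exp (2 * of_real pi * \<i> * of_real (\<phi> x) * z))"

text \<open>
  Integrating the exponential series term by term shows that the integral is an everywhere convergent power series.
\<close>

lemma fourier_laplace_holomorphic:
  fixes K :: "'a \<Rightarrow> complex"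
  assumes [measurable]: "K \<in> borel_measurable M" "\<phi> \<in> borel_measurable M"
    and int: "\<And>y. integrable M (\<lambda>x. norm (K x) * exp (2 * pi * \<bar>\<phi> x\<bar> * y))"
  shows "fourier_laplace M K \<phi> holomorphic_on UNIV"
proof -
  define a where "a n = (LINT x|M. K x * (2 * of_real pi * \<i> * of_real (\<phi> x)) ^ n / fact n)" for n
  have sums: "(\<lambda>n. a n * z ^ n) sums fourier_laplace M K \<phi> z" for z
  proof -
    define T where "T n x = K x * (2 * of_real pi * \<i> * of_real (\<phi> x) * z) ^ n / fact n" for n x
    have meas[measurable]: "T n \<in> borel_measurable M" for n unfolding T_def by measurable
    have norm_T: "norm (T n x) = norm (K x) * (inverse (fact n) * (2 * pi * \<bar>\<phi> x\<bar> * norm z) ^ n)" for n x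
      by (simp add: T_def norm_mult norm_power norm_divide abs_mult field_simps)
    have sums_norm: "(\<lambda>n. norm (T n x)) sums (norm (K x) * exp (2 * pi * \<bar>\<phi> x\<bar> * norm z))" for x
      unfolding norm_T using exp_converges[of "2 * pi * \<bar>\<phi> x\<bar> * norm z"] 
      by (intro sums_mult) (simp add: scaleR_conv_of_real)
    have sums_T: "(\<lambda>n. T n x) sums (K x * exp (2 * of_real pi * \<i> * of_real (\<phi> x) * z))" for x
      using sums_mult[OF exp_converges[of "2 * of_real pi * \<i> * of_real (\<phi> x) * z"], of "K x"]
      by (simp add: T_def scaleR_conv_of_real field_simps)
    have int_T: "integrable M (T n)" for n
    proof (rule Bochner_Integration.integrable_bound[OF int[of "norm z"]])
      have "norm (T n x) \<le> norm (K x) * exp (2 * pi * \<bar>\<phi> x\<bar> * norm z)" for x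
        using sum_le_suminf[OF sums_summable[OF sums_norm], of "{n}"] sums_unique[OF sums_norm] by simp
      then show "AE x in M. norm (T n x) \<le> norm (norm (K x) * exp (2 * pi * \<bar>\<phi> x\<bar> * norm z))"
        by simp
    qed simp
    have "(\<lambda>n. LINT x|M. T n x) sums (LINT x|M. (\<Sum>n. T n x))"
    proof (rule sums_integral[OF int_T])
      show "AE x in M. summable (\<lambda>n. norm (T n x))" using sums_norm by (auto simp: summable_def)
      show "summable (\<lambda>n. LINT x|M. norm (T n x))"
      proof (rule bounded_imp_summable)
        show "(\<Sum>n\<le>N. LINT x|M. norm (T n x)) \<le> (LINT x|M. norm (K x) * exp (2 * pi * \<bar>\<phi> x\<bar> * norm z))" for N
        proof -
          have "(\<Sum>n\<le>N. LINT x|M. norm (T n x)) = (LINT x|M. (\<Sum>n\<le>N. norm (T n x)))"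
            using int_T by (subst Bochner_Integration.integral_sum) auto
          also have "\<dots> \<le> (LINT x|M. norm (K x) * exp (2 * pi * \<bar>\<phi> x\<bar> * norm z))"
            using int_T sum_le_suminf[OF sums_summable[OF sums_norm], of "{..N}"] sums_unique[OF sums_norm]
            by (intro integral_mono int Bochner_Integration.integrable_sum integrable_norm) auto
          finally show ?thesis .
        qed
      qed auto
    qed
    moreover have "(\<lambda>x. \<Sum>n. T n x) = (\<lambda>x. K x * exp (2 * of_real pi * \<i> * of_real (\<phi> x) * z))"
      using sums_unique[OF sums_T] by simp
    moreover have "(LINT x|M. T n x) = a n * z ^ n" for n
      unfolding T_def a_def by (simp add: power_mult_distrib mult.assoc flip: integral_mult_left_zero)
    ultimately show ?thesis by (simp add: fourier_laplace_def)
  qed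
  have "fourier_laplace M K \<phi> holomorphic_on ball 0 r" for r
    by (rule power_series_holomorphic[where a = a]) (use sums in simp)
  then have "fourier_laplace M K \<phi> holomorphic_on (\<Union>r. ball 0 r)"
    by (intro holomorphic_on_UN_open) auto
  moreover have "(\<Union>r. ball (0::complex) r) = UNIV"
    using gt_ex by (auto simp: set_eq_iff)
  ultimately show ?thesis by simp
qed

text \<open>
  Young's inequality turns integrability of \<open>K\<close> against \<open>exp(2\<pi> a(\<phi>))\<close> into the growth bound \<open>exp(2\<pi> b)\<close> off the
  real axis, which the second integrability hypothesis compensates on it.
\<close>

lemma fourier_laplace_eq_0:
  fixes K :: "'a \<Rightarrow> complex" and a b :: "real \<Rightarrow> real"
  assumes [measurable]: "K \<in> borel_measurable M" "\<phi> \<in> borel_measurable M" 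
      "a \<in> borel_measurable borel" "b \<in> borel_measurable borel"
    and young: "\<And>r s. \<bar>r * s\<bar> \<le> a r + b s"
    and b_mono: "\<And>r s. 0 \<le> r \<Longrightarrow> r \<le> s \<Longrightarrow> b r \<le> b s" and b_abs: "\<And>r. b \<bar>r\<bar> = b r" 
    and b_growth: "\<And>r. b r \<le> c * (1 + r\<^sup>2)" and "0 \<le> c"
    and intK: "(\<integral>\<^sup>+ x. ennreal (norm (K x) * exp (2 * pi * a (\<phi> x))) \<partial>M) < \<infinity>"
    and intE: "(\<integral>\<^sup>+ \<xi>. ennreal (norm (fourier_laplace M K \<phi> (of_real \<xi>)) * exp (2 * pi * b \<xi>)) \<partial>lborel) < \<infinity>"
  shows "fourier_laplace M K \<phi> z = 0"
proof -
  have I: "integrable M (\<lambda>x. norm (K x) * exp (2 * pi * a (\<phi> x)))"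
    using intK by (intro integrableI_nonneg) auto
  have exp_le: "norm (K x) * exp (2 * pi * \<bar>\<phi> x\<bar> * \<bar>y\<bar>) \<le> exp (2 * pi * b y) * (norm (K x) * exp (2 * pi * a (\<phi> x)))" for x y
  proof -
    have "2 * pi * (\<bar>\<phi> x * y\<bar>) \<le> 2 * pi * (a (\<phi> x) + b y)"
      using young by (intro mult_left_mono) auto
    then have "exp (2 * pi * \<bar>\<phi> x\<bar> * \<bar>y\<bar>) \<le> exp (2 * pi * b y) * exp (2 * pi * a (\<phi> x))"
      by (simp add: mult_exp_exp abs_mult algebra_simps)
    then have "norm (K x) * exp (2 * pi * \<bar>\<phi> x\<bar> * \<bar>y\<bar>) \<le> norm (K x) * (exp (2 * pi * b y) * exp (2 * pi * a (\<phi> x)))"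
      by (intro mult_left_mono) auto
    then show ?thesis by (simp add: mult_ac)
  qed
  have int: "integrable M (\<lambda>x. norm (K x) * exp (2 * pi * \<bar>\<phi> x\<bar> * y))" for y
  proof (rule Bochner_Integration.integrable_bound)
    show "integrable M (\<lambda>x. exp (2 * pi * b y) * (norm (K x) * exp (2 * pi * a (\<phi> x))))"
      using I by simp
    have "norm (K x) * exp (2 * pi * \<bar>\<phi> x\<bar> * y) \<le> norm (K x) * exp (2 * pi * \<bar>\<phi> x\<bar> * \<bar>y\<bar>)" for x
      by (intro mult_left_mono) (auto intro!: mult_left_mono)
    then show "AE x in M. norm (norm (K x) * exp (2 * pi * \<bar>\<phi> x\<bar> * y)) \<le> norm (exp (2 * pi * b y) * (norm (K x) * exp (2 * pi * a (\<phi> x))))"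
      using exp_le[of _ y] by (auto intro!: AE_I2 intro: order_trans)
  qed simp
  define B where "B = (LINT x|M. norm (K x) * exp (2 * pi * a (\<phi> x)))"
  have B: "0 \<le> B" unfolding B_def by simp
  define w where "w r = B * exp (2 * pi * b r)" for r
  have hol: "fourier_laplace M K \<phi> holomorphic_on UNIV"
    by (rule fourier_laplace_holomorphic[OF _ _ int]) auto
  have bound: "norm (fourier_laplace M K \<phi> z) \<le> w \<bar>Im z\<bar>" for z
  proof -
    have norm_exp: "norm (K x * exp (2 * of_real pi * \<i> * of_real (\<phi> x) * z)) = norm (K x) * exp (- 2 * pi * \<phi> x * Im z)" for x
      by (simp add: norm_mult)
    have le: "norm (K x) * exp (- 2 * pi * \<phi> x * Im z) \<le> exp (2 * pi * b (Im z)) * (norm (K x) * exp (2 * pi * a (\<phi> x)))" for x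
    proof -
      have "- (\<phi> x * Im z) \<le> \<bar>\<phi> x\<bar> * \<bar>Im z\<bar>" by (metis abs_ge_minus_self abs_mult)
      then have "2 * pi * - (\<phi> x * Im z) \<le> 2 * pi * (\<bar>\<phi> x\<bar> * \<bar>Im z\<bar>)" by (intro mult_left_mono) auto
      then have "norm (K x) * exp (- 2 * pi * \<phi> x * Im z) \<le> norm (K x) * exp (2 * pi * \<bar>\<phi> x\<bar> * \<bar>Im z\<bar>)"
        by (intro mult_left_mono) (auto simp: algebra_simps)
      with exp_le[of x "Im z"] show ?thesis by linarith
    qed
    have "norm (fourier_laplace M K \<phi> z) \<le> (LINT x|M. norm (K x * exp (2 * of_real pi * \<i> * of_real (\<phi> x) * z)))"
      unfolding fourier_laplace_def by (rule integral_norm_bound)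
    also have "\<dots> \<le> (LINT x|M. exp (2 * pi * b (Im z)) * (norm (K x) * exp (2 * pi * a (\<phi> x))))"
      unfolding norm_exp using le I by (intro integral_mono_AE') (auto intro!: AE_I2)
    also have "\<dots> = w \<bar>Im z\<bar>" by (simp add: w_def B_def b_abs mult.commute)
    finally show ?thesis .
  qed
  define A where "A = enn2real (\<integral>\<^sup>+ x. ennreal (norm (fourier_laplace M K \<phi> (of_real x)) * w \<bar>x\<bar>) \<partial>lborel)"
  have [measurable]: "fourier_laplace M K \<phi> \<in> borel_measurable borel"
    using hol by (intro borel_measurable_continuous_onI holomorphic_on_imp_continuous_on)
  have w_nonneg: "0 \<le> w r" for r unfolding w_def using B by simp
  have "(\<integral>\<^sup>+ x. ennreal (norm (fourier_laplace M K \<phi> (of_real x)) * w \<bar>x\<bar>) \<partial>lborel)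
      = (\<integral>\<^sup>+ x. ennreal B * ennreal (norm (fourier_laplace M K \<phi> (of_real x)) * exp (2 * pi * b x)) \<partial>lborel)"
    using B by (intro nn_integral_cong) (simp add: w_def b_abs mult_ac flip: ennreal_mult')
  also have "\<dots> = ennreal B * (\<integral>\<^sup>+ x. ennreal (norm (fourier_laplace M K \<phi> (of_real x)) * exp (2 * pi * b x)) \<partial>lborel)"
    by (intro nn_integral_cmult) auto
  also have "\<dots> < \<infinity>" using intE by (simp add: ennreal_mult_less_top)
  finally have fin: "(\<integral>\<^sup>+ x. ennreal (norm (fourier_laplace M K \<phi> (of_real x)) * w \<bar>x\<bar>) \<partial>lborel) < \<infinity>" .
  have "beurling_decay w A (fourier_laplace M K \<phi>)"
    unfolding beurling_decay_def using hol bound fin by (auto simp: A_def)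
  then show ?thesis
  proof (rule beurling_hoermander_entire[rotated -1, where C = "B * exp (2 * pi * c)" and c = "2 * pi * c"])
    show "w r \<le> w s" if "0 \<le> r" "r \<le> s" for r s
      unfolding w_def using B b_mono[OF that] by (intro mult_left_mono) auto
    show "w r \<le> B * exp (2 * pi * c) * exp (2 * pi * c * r\<^sup>2)" if "0 \<le> r" for r
    proof -
      have "2 * pi * b r \<le> 2 * pi * (c * (1 + r\<^sup>2))" using b_growth by (intro mult_left_mono) auto
      then have "w r \<le> B * exp (2 * pi * (c * (1 + r\<^sup>2)))" unfolding w_def using B by (intro mult_left_mono) auto
      then show ?thesis by (simp add: mult_exp_exp algebra_simps flip: exp_add)
    qed
    show "w \<in> borel_measurable borel" unfolding w_def by measurable
  qed (use B \<open>0 \<le> c\<close> w_nonneg in \<open>auto simp: A_def\<close>)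
qed

section \<open>Gaussians on the line\<close>

lemma borel_measurable_cis [measurable]: "cis \<in> borel_measurable borel"
  by (intro borel_measurable_continuous_onI continuous_intros continuous_on_cis)

lemma borel_measurable_cnj [measurable]: "cnj \<in> borel_measurable borel"
  by (intro borel_measurable_continuous_onI continuous_intros)

lemma (in pair_sigma_finite) integrable_pair_mult:
  fixes f :: "'a \<Rightarrow> 'c::{real_normed_field, banach, second_countable_topology}"
  assumes f: "integrable M1 f" and g: "integrable M2 g"
  shows "integrable (M1 \<Otimes>\<^sub>M M2) (\<lambda>(x, y). f x * g y)"
proof (rule integrableI_bounded)
  have [measurable]: "f \<in> borel_measurable M1" "g \<in> borel_measurable M2" using f g by auto
  show "(\<lambda>(x, y). f x * g y) \<in> borel_measurable (M1 \<Otimes>\<^sub>M M2)" by measurable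
  have "(\<integral>\<^sup>+ z. ennreal (norm (case z of (x, y) \<Rightarrow> f x * g y)) \<partial>(M1 \<Otimes>\<^sub>M M2))
     = (\<integral>\<^sup>+ x. \<integral>\<^sup>+ y. ennreal (norm (f x)) * ennreal (norm (g y)) \<partial>M2 \<partial>M1)"
    by (subst M2.nn_integral_fst[symmetric]) (auto simp: norm_mult ennreal_mult intro!: nn_integral_cong)
  also have "\<dots> = (\<integral>\<^sup>+ x. ennreal (norm (f x)) \<partial>M1) * (\<integral>\<^sup>+ y. ennreal (norm (g y)) \<partial>M2)"
    by (simp add: nn_integral_cmult nn_integral_multc)
  also have "\<dots> < \<infinity>"
    using f g by (simp add: integrable_iff_bounded ennreal_mult_less_top)
  finally show "(\<integral>\<^sup>+ z. ennreal (norm (case z of (x, y) \<Rightarrow> f x * g y)) \<partial>(M1 \<Otimes>\<^sub>M M2)) < \<infinity>" .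
qed

lemma gaussian_fourier_integral:
  assumes \<epsilon>: "0 < \<epsilon>"
  shows "has_bochner_integral lborel (\<lambda>\<omega>. complex_of_real (exp (- 2 * pi\<^sup>2 * \<epsilon>\<^sup>2 * \<omega>\<^sup>2)) * cis (2 * pi * (r * \<omega>)))
           (complex_of_real (normal_density 0 \<epsilon> r))"
proof -
  define t where "t = r / \<epsilon>"
  define c where "c = 2 * pi * \<epsilon>"
  have c: "c > 0" using \<epsilon> by (simp add: c_def)
  have int: "integrable lborel (\<lambda>x. std_normal_density x *\<^sub>R iexp (t * x))"
    by (rule Bochner_Integration.integrable_bound[OF integrable_std_normal_moment[of 0]]) auto
  have "(\<integral>x. std_normal_density x *\<^sub>R iexp (t * x) \<partial>lborel) = char std_normal_distribution t"
    unfolding char_def by (subst integral_density) auto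
  also have "\<dots> = complex_of_real (exp (- (t^2) / 2))" by (simp add: char_std_normal_distribution)
  finally have "has_bochner_integral lborel (\<lambda>x. std_normal_density x *\<^sub>R iexp (t * x)) (complex_of_real (exp (- (t^2) / 2)))"
    using int by (simp add: has_bochner_integral_iff)
  then have "has_bochner_integral lborel (\<lambda>\<omega>. std_normal_density (0 + c * \<omega>) *\<^sub>R iexp (t * (0 + c * \<omega>))) (complex_of_real (exp (- (t^2) / 2)) /\<^sub>R \<bar>c\<bar>)"
    using lborel_has_bochner_integral_real_affine_iff[of c "\<lambda>x. std_normal_density x *\<^sub>R iexp (t * x)" _ 0] c by auto
  then have "has_bochner_integral lborel (\<lambda>\<omega>. sqrt (2 * pi) *\<^sub>R (std_normal_density (0 + c * \<omega>) *\<^sub>R iexp (t * (0 + c * \<omega>)))) (sqrt (2 * pi) *\<^sub>R (complex_of_real (exp (- (t^2) / 2)) /\<^sub>R \<bar>c\<bar>))"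
    by (rule has_bochner_integral_scaleR_right)
  moreover have "sqrt (2 * pi) *\<^sub>R (std_normal_density (0 + c * \<omega>) *\<^sub>R iexp (t * (0 + c * \<omega>))) = complex_of_real (exp (- 2 * pi\<^sup>2 * \<epsilon>\<^sup>2 * \<omega>\<^sup>2)) * cis (2 * pi * (r * \<omega>))" for \<omega>
  proof -
    have "sqrt (2 * pi) * std_normal_density (c * \<omega>) = exp (- 2 * pi\<^sup>2 * \<epsilon>\<^sup>2 * \<omega>\<^sup>2)"
      by (simp add: std_normal_density_def c_def power_mult_distrib)
    moreover have "iexp (t * (c * \<omega>)) = cis (2 * pi * (r * \<omega>))"
    proof -
      have "t * (c * \<omega>) = 2 * pi * (r * \<omega>)" using \<epsilon> by (simp add: t_def c_def)
      then show ?thesis by (simp only: cis_conv_exp)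
    qed
    ultimately show ?thesis by (simp add: scaleR_conv_of_real flip: of_real_mult)
  qed
  moreover have "sqrt (2 * pi) *\<^sub>R (complex_of_real (exp (- (t^2) / 2)) /\<^sub>R \<bar>c\<bar>) = complex_of_real (normal_density 0 \<epsilon> r)"
  proof -
    have s: "sqrt (2 * pi) * sqrt (2 * pi) = 2 * pi" by simp
    have "sqrt (2 * pi) / c = 1 / (sqrt (2 * pi) * \<epsilon>)"
      unfolding c_def using \<epsilon> s by (simp add: field_simps)
    moreover have "sqrt (2 * pi * \<epsilon>\<^sup>2) = sqrt (2 * pi) * \<epsilon>" using \<epsilon> by (simp add: real_sqrt_mult)
    moreover have "- (t\<^sup>2) / 2 = - (r\<^sup>2 / (2 * \<epsilon>\<^sup>2))" by (simp add: t_def power_divide)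
    ultimately have "normal_density 0 \<epsilon> r = sqrt (2 * pi) / c * exp (- (t^2) / 2)"
      by (simp add: normal_density_def)
    moreover have "sqrt (2 * pi) *\<^sub>R (complex_of_real x /\<^sub>R \<bar>c\<bar>) = complex_of_real (sqrt (2 * pi) / c * x)" for x
      using c by (simp add: scaleR_conv_of_real field_simps)
    ultimately show ?thesis by simp
  qed
  ultimately show ?thesis by simp
qed

text \<open>
  The convolution of the indicator of an interval with a centred Gaussian of standard deviation \<open>\<epsilon>\<close>.
\<close>

definition smoothed_indicator :: "real \<Rightarrow> real \<Rightarrow> real \<Rightarrow> real \<Rightarrow> real" where
  "smoothed_indicator a b \<epsilon> s = (LINT t|lborel. indicator {a..b} t * normal_density 0 \<epsilon> (t - s))"

lemma integrable_indicator_normal_density: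
  assumes "0 < \<epsilon>"
  shows "integrable lborel (\<lambda>t. indicator {a..b} t * normal_density 0 \<epsilon> (t - s) :: real)"
proof (rule Bochner_Integration.integrable_bound)
  show "integrable lborel (normal_density s \<epsilon>)" using assms by simp
  have eq: "normal_density 0 \<epsilon> (t - s) = normal_density s \<epsilon> t" for t by (simp add: normal_density_def)
  show "AE t in lborel. norm (indicator {a..b} t * normal_density 0 \<epsilon> (t - s)) \<le> norm (normal_density s \<epsilon> t)"
    by (auto simp: eq indicator_def)
qed measurable

lemma smoothed_indicator_eq:
  assumes "0 < \<epsilon>"
  shows "smoothed_indicator a b \<epsilon> s = (LINT u|lborel. indicator {a..b} (s + \<epsilon> * u) * std_normal_density u)"
proof -
  have "smoothed_indicator a b \<epsilon> s = \<bar>\<epsilon>\<bar> *\<^sub>R (LINT u|lborel. indicator {a..b} (s + \<epsilon> * u) * normal_density 0 \<epsilon> (s + \<epsilon> * u - s))"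
    unfolding smoothed_indicator_def using assms by (subst lborel_integral_real_affine[of \<epsilon> _ s]) auto
  also have "\<dots> = (LINT u|lborel. \<epsilon> * (indicator {a..b} (s + \<epsilon> * u) * normal_density 0 \<epsilon> (\<epsilon> * u)))"
    using assms by simp
  also have "(\<lambda>u. \<epsilon> * (indicator {a..b} (s + \<epsilon> * u) * normal_density 0 \<epsilon> (\<epsilon> * u))) = (\<lambda>u. indicator {a..b} (s + \<epsilon> * u) * std_normal_density u :: real)"
    using assms by (auto simp: normal_density_def fun_eq_iff real_sqrt_mult power_mult_distrib)
  finally show ?thesis .
qed

lemma smoothed_indicator_bounds:
  assumes "0 < \<epsilon>"
  shows "0 \<le> smoothed_indicator a b \<epsilon> s" "smoothed_indicator a b \<epsilon> s \<le> 1"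
proof -
  show "0 \<le> smoothed_indicator a b \<epsilon> s"
    unfolding smoothed_indicator_def by (intro Bochner_Integration.integral_nonneg) simp
  have "smoothed_indicator a b \<epsilon> s \<le> (LINT u|lborel. std_normal_density u)"
    unfolding smoothed_indicator_eq[OF assms]
    by (rule integral_mono_AE') (auto simp: indicator_def)
  then show "smoothed_indicator a b \<epsilon> s \<le> 1" by simp
qed

lemma smoothed_indicator_tendsto:
  assumes \<epsilon>: "\<And>n. 0 < \<epsilon> n" "\<epsilon> \<longlonglongrightarrow> 0" and s: "s \<noteq> a" "s \<noteq> b"
  shows "(\<lambda>n. smoothed_indicator a b (\<epsilon> n) s) \<longlonglongrightarrow> indicator {a..b} s"
proof -
  have "(\<lambda>n. LINT u|lborel. indicator {a..b} (s + \<epsilon> n * u) * std_normal_density u) \<longlonglongrightarrow> (LINT u|lborel. indicator {a..b} s * std_normal_density u)"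
  proof (rule integral_dominated_convergence[where w = std_normal_density])
    have "(\<lambda>n. indicator {a..b} (s + \<epsilon> n * u) * std_normal_density u) \<longlonglongrightarrow> indicator {a..b} s * std_normal_density u" for u
    proof (rule tendsto_mult_right, rule tendsto_eventually)
      have lim: "(\<lambda>n. s + \<epsilon> n * u) \<longlonglongrightarrow> s" using tendsto_add[OF tendsto_const tendsto_mult_left_zero[OF \<epsilon>(2)]] by simp
      consider "s < a" | "b < s" | "a < s" "s < b" using s by linarith
      then show "\<forall>\<^sub>F n in sequentially. indicator {a..b} (s + \<epsilon> n * u) = (indicator {a..b} s :: real)"
      proof cases
        case 1 from order_tendstoD(2)[OF lim 1] show ?thesis by eventually_elim (use 1 in \<open>auto simp: indicator_def\<close>)
      next
        case 2 from order_tendstoD(1)[OF lim 2] show ?thesis by eventually_elim (use 2 in \<open>auto simp: indicator_def\<close>)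
      next
        case 3 from order_tendstoD(1)[OF lim 3(1)] order_tendstoD(2)[OF lim 3(2)] show ?thesis by eventually_elim (use 3 in \<open>auto simp: indicator_def\<close>)
      qed
    qed
    then show "AE u in lborel. (\<lambda>n. indicator {a..b} (s + \<epsilon> n * u) * std_normal_density u) \<longlonglongrightarrow> indicator {a..b} s * std_normal_density u"
      by simp
  qed (auto simp: indicator_def)
  then show ?thesis by (simp add: smoothed_indicator_eq[OF \<epsilon>(1)])
qed

lemma borel_measurable_smoothed_indicator [measurable]: "smoothed_indicator a b \<epsilon> \<in> borel_measurable borel"
  unfolding smoothed_indicator_def[abs_def] by measurable

section \<open>Coordinate spaces and boxes\<close>

text \<open>
  The spaces \<open>\<real>\<^sup>I\<close> for finite \<open>I\<close>, with product Lebesgue measure. Their points are functions that are undefined outside \<open>I\<close>,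
  so that the dimension may be a variable and a coordinate may be split off.
\<close>

locale coordinate_space =
  fixes I :: "'i set"
  assumes finite_I [simp]: "finite I"
begin

abbreviation L :: "('i \<Rightarrow> real) measure" where "L \<equiv> PiM I (\<lambda>_. lborel)"

sublocale P: finite_product_sigma_finite "\<lambda>_::'i. lborel :: real measure" I
  by standard simp

sublocale PP: pair_sigma_finite L L ..

definition dot :: "('i \<Rightarrow> real) \<Rightarrow> ('i \<Rightarrow> real) \<Rightarrow> real" where
  "dot x y = (\<Sum>i\<in>I. x i * y i)"

definition fourier :: "(('i \<Rightarrow> real) \<Rightarrow> complex) \<Rightarrow> ('i \<Rightarrow> real) \<Rightarrow> complex" where
  "fourier h \<omega> = (LINT t|L. h t * cis (- (2 * pi * dot t \<omega>)))"

definition box :: "('i \<Rightarrow> real) \<Rightarrow> ('i \<Rightarrow> real) \<Rightarrow> ('i \<Rightarrow> real) set" where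
  "box a b = Pi\<^sub>E I (\<lambda>i. {a i..b i})"

lemma borel_measurable_coord [measurable (raw)]:
  assumes "f \<in> M \<rightarrow>\<^sub>M L" "i \<in> I"
  shows "(\<lambda>x. f x i) \<in> borel_measurable M"
  using measurable_compose[OF assms(1) measurable_component_singleton[OF assms(2)]] by simp

lemma measurable_dot [measurable (raw)]:
  assumes [measurable]: "f \<in> M \<rightarrow>\<^sub>M L" "g \<in> M \<rightarrow>\<^sub>M L"
  shows "(\<lambda>x. dot (f x) (g x)) \<in> borel_measurable M"
  unfolding dot_def by measurable

lemma measurable_dot_const_left [measurable (raw)]:
  assumes [measurable]: "f \<in> M \<rightarrow>\<^sub>M L"
  shows "(\<lambda>x. dot v (f x)) \<in> borel_measurable M"
  unfolding dot_def by measurable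

lemma measurable_dot_const_right [measurable (raw)]:
  assumes [measurable]: "f \<in> M \<rightarrow>\<^sub>M L"
  shows "(\<lambda>x. dot (f x) v) \<in> borel_measurable M"
  unfolding dot_def by measurable

lemma box_sets [measurable]: "box a b \<in> sets L"
  unfolding box_def by (intro sets_PiM_I_finite) auto

lemma box_indicator:
  assumes "t \<in> space L"
  shows "indicator (box a b) t = (\<Prod>i\<in>I. indicator {a i..b i} (t i) :: 'b :: {comm_semiring_1, semidom})"
proof (cases "t \<in> box a b")
  case True
  then show ?thesis by (auto simp: box_def PiE_iff)
next
  case False
  then obtain i where "i \<in> I" "t i \<notin> {a i..b i}" using assms by (auto simp: box_def space_PiM PiE_iff)
  then have "(\<Prod>i\<in>I. indicator {a i..b i} (t i) :: 'b) = 0" by (intro prod_zero) (auto intro!: bexI[of _ i])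
  then show ?thesis using False by simp
qed

lemma emeasure_box_finite: "emeasure L (box a b) < \<infinity>"
proof -
  have "emeasure L (box a b) = (\<Prod>i\<in>I. emeasure lborel {a i..b i})"
    unfolding box_def by (rule P.measure_times) simp
  also have "\<dots> < \<infinity>" by (simp add: emeasure_lborel_Icc_eq prod_ennreal)
  finally show ?thesis .
qed

lemma Union_boxes: "(\<Union>n::nat. box (\<lambda>_. - real n) (\<lambda>_. real n)) = space L"
proof (intro equalityI subsetI)
  fix t assume t: "t \<in> space L"
  obtain n :: nat where n: "Max (insert 0 ((\<lambda>i. \<bar>t i\<bar>) ` I)) \<le> real n" using real_arch_simple by blast
  have abs: "\<bar>t i\<bar> \<le> real n" if "i \<in> I" for i
    using that by (intro order_trans[OF Max_ge n]) auto
  have "t i \<in> {- real n..real n}" if "i \<in> I" for i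
    using abs[OF that] by auto
  then have "t \<in> box (\<lambda>_. - real n) (\<lambda>_. real n)"
    using t unfolding box_def space_PiM PiE_iff by simp
  then show "t \<in> (\<Union>n::nat. box (\<lambda>_. - real n) (\<lambda>_. real n))" by blast
next
  fix t assume "t \<in> (\<Union>n::nat. box (\<lambda>_. - real n) (\<lambda>_. real n))"
  then obtain n :: nat where "t \<in> box (\<lambda>_. - real n) (\<lambda>_. real n)" by blast
  then show "t \<in> space L" by (simp add: box_def space_PiM PiE_iff)
qed

text \<open>
  Closed boxes form a generator that is stable under intersection and has finite measure. This makes them test sets
  for equality of measures.
\<close>

lemma sets_L_generated_by_boxes: "sets L = sigma_sets (space L) {box a b | a b. True}" (is "_ = sigma_sets _ ?E")
proof (intro equalityI)
  interpret sigma_algebra "space L" "sigma_sets (space L) ?E"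
    by (rule sigma_algebra_sigma_sets) (auto simp: box_def space_PiM PiE_iff)
  have sub: "{f \<in> space L. f i \<in> A} \<in> sigma_sets (space L) ?E" 
    if i: "i \<in> I" and A: "A \<in> sigma_sets UNIV (range (\<lambda>(a, b). {a..b} :: real set))" for i A
    using A
  proof induction
    case (Basic A)
    then obtain x y where A: "A = {x..y}" by auto
    have UN: "{f \<in> space L. f i \<in> A} = (\<Union>n::nat. box (\<lambda>j. if j = i then x else - real n) (\<lambda>j. if j = i then y else real n))"
    proof (intro equalityI subsetI)
      fix f assume f: "f \<in> {f \<in> space L. f i \<in> A}"
      then obtain n :: nat where "f \<in> box (\<lambda>_. - real n) (\<lambda>_. real n)" using Union_boxes by blast
      then have "f \<in> box (\<lambda>j. if j = i then x else - real n) (\<lambda>j. if j = i then y else real n)"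
        using f A by (auto simp: box_def PiE_iff)
      then show "f \<in> (\<Union>n::nat. box (\<lambda>j. if j = i then x else - real n) (\<lambda>j. if j = i then y else real n))" by blast
    next
      fix f assume "f \<in> (\<Union>n::nat. box (\<lambda>j. if j = i then x else - real n) (\<lambda>j. if j = i then y else real n))"
      then obtain n :: nat where n: "f \<in> box (\<lambda>j. if j = i then x else - real n) (\<lambda>j. if j = i then y else real n)" by blast
      then have "f i \<in> {x..y}" using i unfolding box_def by (auto dest: PiE_mem)
      moreover have "f \<in> space L" using n by (simp add: box_def space_PiM PiE_iff)
      ultimately show "f \<in> {f \<in> space L. f i \<in> A}" using A by simp
    qed
    show ?case unfolding UN by (intro countable_UN) blast
  next
    case (Compl A)
    have "{f \<in> space L. f i \<in> UNIV - A} = space L - {f \<in> space L. f i \<in> A}" by auto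
    then show ?case using compl_sets[OF Compl.IH] by simp
  next
    case (Union A)
    have "{f \<in> space L. f i \<in> (\<Union>n. A n)} = (\<Union>n. {f \<in> space L. f i \<in> A n})" by auto
    then show ?case using countable_UN[of "\<lambda>n. {f \<in> space L. f i \<in> A n}" UNIV] Union.IH by auto
  qed (auto intro: sigma_sets.Empty)
  have gen: "sets (lborel :: real measure) = sigma_sets UNIV (range (\<lambda>(a, b). {a..b} :: real set))"
    by (subst sets_lborel, subst borel_eq_atLeastAtMost) simp
  show "sets L \<subseteq> sigma_sets (space L) ?E"
    unfolding sets_PiM_single
    by (subst space_PiM[symmetric], rule sigma_sets_mono) (use sub gen in \<open>auto simp: space_PiM\<close>)
  show "sigma_sets (space L) ?E \<subseteq> sets L"
    by (rule sets.sigma_sets_subset) auto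
qed

text \<open>
  The positive and the negative part of \<open>u\<close> are densities of two measures that agree on boxes.
\<close>

lemma AE_eq_0_if_box_integrals_0:
  fixes u :: "('i \<Rightarrow> real) \<Rightarrow> real"
  assumes [measurable]: "u \<in> borel_measurable L"
    and int: "\<And>a b. integrable L (\<lambda>t. indicator (box a b) t * u t)"
    and 0: "\<And>a b. (LINT t|L. indicator (box a b) t * u t) = 0"
  shows "AE t in L. u t = 0"
proof -
  define pos where "pos = density L (\<lambda>t. ennreal (u t))"
  define neg where "neg = density L (\<lambda>t. ennreal (- u t))"
  have pos_box: "emeasure pos (box a b) = (\<integral>\<^sup>+ t. ennreal (indicator (box a b) t * u t) \<partial>L)" for a b
    unfolding pos_def by (subst emeasure_density) (auto intro!: nn_integral_cong simp: indicator_def)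
  have neg_box: "emeasure neg (box a b) = (\<integral>\<^sup>+ t. ennreal (- (indicator (box a b) t * u t)) \<partial>L)" for a b
    unfolding neg_def by (subst emeasure_density) (auto intro!: nn_integral_cong simp: indicator_def)
  have fin: "emeasure pos (box a b) \<noteq> \<infinity>" "emeasure neg (box a b) \<noteq> \<infinity>" for a b
    using int[of a b] unfolding pos_box neg_box real_integrable_def by auto
  have eq: "emeasure pos (box a b) = emeasure neg (box a b)" for a b
  proof -
    have "enn2real (emeasure pos (box a b)) - enn2real (emeasure neg (box a b)) = 0"
      using 0[of a b] real_lebesgue_integral_def[OF int[of a b]] unfolding pos_box neg_box by simp
    then have "enn2real (emeasure pos (box a b)) = enn2real (emeasure neg (box a b))" by simp
    then show ?thesis
      using fin[of a b] by (metis ennreal_enn2real less_top infinity_ennreal_def)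
  qed
  have "pos = neg"
  proof (rule measure_eqI_generator_eq[where \<Omega> = "space L" and E = "{box a b | a b. True}" and A = "\<lambda>n. box (\<lambda>_. - real n) (\<lambda>_. real n)"])
    show "Int_stable {box a b | a b. True}"
    proof (rule Int_stableI, clarify)
      fix a b a' b'
      have "box a b \<inter> box a' b' = box (\<lambda>i. max (a i) (a' i)) (\<lambda>i. min (b i) (b' i))"
        unfolding box_def PiE_Int by simp
      then show "\<exists>c d. box a b \<inter> box a' b' = box c d \<and> True" by blast
    qed
    show "{box a b | a b. True} \<subseteq> Pow (space L)" by (auto simp: box_def space_PiM PiE_iff)
    show "emeasure pos X = emeasure neg X" if "X \<in> {box a b | a b. True}" for X using that eq by blast
    show "sets pos = sigma_sets (space L) {box a b | a b. True}" 
      unfolding pos_def sets_density by (rule sets_L_generated_by_boxes)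
    show "sets neg = sigma_sets (space L) {box a b | a b. True}" 
      unfolding neg_def sets_density by (rule sets_L_generated_by_boxes)
    show "range (\<lambda>n. box (\<lambda>_. - real n) (\<lambda>_. real n)) \<subseteq> {box a b | a b. True}" by blast
    show "(\<Union>n::nat. box (\<lambda>_. - real n) (\<lambda>_. real n)) = space L" by (rule Union_boxes)
    show "emeasure pos (box (\<lambda>_. - real n) (\<lambda>_. real n)) \<noteq> \<infinity>" for n by (rule fin)
  qed
  moreover have "sigma_finite_measure pos"
  proof
    show "\<exists>A. countable A \<and> A \<subseteq> sets pos \<and> \<Union> A = space pos \<and> (\<forall>a\<in>A. emeasure pos a \<noteq> \<infinity>)"
      using Union_boxes fin
      by (intro exI[of _ "range (\<lambda>n::nat. box (\<lambda>_. - real n) (\<lambda>_. real n))"]) (auto simp: pos_def)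
  qed
  ultimately have "AE t in L. ennreal (u t) = ennreal (- u t)"
    unfolding pos_def neg_def by (subst (asm) sigma_finite_density_unique) auto
  then show ?thesis
  proof eventually_elim
    case (elim t)
    then show ?case by (cases "0 \<le> u t") (auto simp: ennreal_neg ennreal_eq_0_iff)
  qed
qed

lemma AE_coordinate_neq:
  assumes "i \<in> I"
  shows "AE s in L. s i \<noteq> c"
proof (rule AE_I')
  have "{s \<in> space L. s i = c} = Pi\<^sub>E I (\<lambda>j. if j = i then {c} else UNIV)"
  proof (intro equalityI subsetI)
    fix s assume "s \<in> Pi\<^sub>E I (\<lambda>j. if j = i then {c} else UNIV)"
    then show "s \<in> {s \<in> space L. s i = c}" using assms PiE_mem[of s I _ i] by (auto simp: space_PiM PiE_iff)
  qed (simp add: space_PiM PiE_iff)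
  moreover have "Pi\<^sub>E I (\<lambda>j. if j = i then {c} else UNIV) \<in> sets L"
    by (rule sets_PiM_I_finite) auto
  moreover have "emeasure L (Pi\<^sub>E I (\<lambda>j. if j = i then {c} else UNIV)) = (\<Prod>j\<in>I. emeasure lborel (if j = i then {c} else UNIV))"
    by (rule P.measure_times) auto
  moreover have "(\<Prod>j\<in>I. emeasure lborel (if j = i then {c} else UNIV :: real set)) = 0"
    by (rule prod_zero[OF finite_I], rule bexI[OF _ assms]) simp
  ultimately show "{s \<in> space L. s i = c} \<in> null_sets L"
    by (simp add: null_sets_def)
  show "{s \<in> space L. \<not> s i \<noteq> c} \<subseteq> {s \<in> space L. s i = c}" by simp
qed

section \<open>Fourier inversion for integrable transforms\<close>

lemma borel_measurable_fourier_pair [measurable (raw)]: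
  assumes [measurable]: "(\<lambda>(x, t). h x t) \<in> borel_measurable (M \<Otimes>\<^sub>M L)" "f \<in> M \<rightarrow>\<^sub>M L"
  shows "(\<lambda>x. fourier (h x) (f x)) \<in> borel_measurable M"
  unfolding fourier_def by measurable

lemma dot_diff_left: "dot t \<omega> - dot s \<omega> = dot (\<lambda>i. t i - s i) \<omega>"
  by (simp add: dot_def sum_subtractf algebra_simps)

lemma cis_dot: "cis (2 * pi * dot x \<omega>) = (\<Prod>i\<in>I. cis (2 * pi * (x i * \<omega> i)))"
proof -
  have "cis (sum f A) = (\<Prod>i\<in>A. cis (f i))" if "finite A" for f :: "'i \<Rightarrow> real" and A
    using that by induction (auto simp: cis_mult[symmetric])
  then show ?thesis by (simp add: dot_def sum_distrib_left)
qed

lemma integrable_box_indicator: "integrable L (indicator (box a b) :: _ \<Rightarrow> complex)"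
proof -
  have "integrable L (indicator (box a b) :: _ \<Rightarrow> real)"
    using emeasure_box_finite[of a b] by (intro integrable_real_indicator) auto
  then have "integrable L (\<lambda>t. complex_of_real (indicator (box a b) t))" by (rule integrable_of_real)
  then show ?thesis by (simp add: of_real_indicator)
qed

definition gauss :: "real \<Rightarrow> ('i \<Rightarrow> real) \<Rightarrow> real" where
  "gauss \<epsilon> \<omega> = (\<Prod>i\<in>I. exp (- 2 * pi\<^sup>2 * \<epsilon>\<^sup>2 * (\<omega> i)\<^sup>2))"

lemma gauss_integral:
  assumes "0 < \<epsilon>"
  shows "integrable L (\<lambda>\<omega>. complex_of_real (gauss \<epsilon> \<omega>) * cis (2 * pi * dot x \<omega>))"
    and "(LINT \<omega>|L. complex_of_real (gauss \<epsilon> \<omega>) * cis (2 * pi * dot x \<omega>)) = (\<Prod>i\<in>I. complex_of_real (normal_density 0 \<epsilon> (x i)))"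
proof -
  have eq: "complex_of_real (gauss \<epsilon> \<omega>) * cis (2 * pi * dot x \<omega>) =
     (\<Prod>i\<in>I. complex_of_real (exp (- 2 * pi\<^sup>2 * \<epsilon>\<^sup>2 * (\<omega> i)\<^sup>2)) * cis (2 * pi * (x i * \<omega> i)))" for \<omega>
    by (simp only: gauss_def cis_dot prod.distrib of_real_prod)
  note G = gaussian_fourier_integral[OF assms, unfolded has_bochner_integral_iff]
  show "integrable L (\<lambda>\<omega>. complex_of_real (gauss \<epsilon> \<omega>) * cis (2 * pi * dot x \<omega>))"
    unfolding eq by (rule P.product_integrable_prod) (use G in auto)
  show "(LINT \<omega>|L. complex_of_real (gauss \<epsilon> \<omega>) * cis (2 * pi * dot x \<omega>)) = (\<Prod>i\<in>I. complex_of_real (normal_density 0 \<epsilon> (x i)))"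
    unfolding eq by (subst P.product_integral_prod) (use G in auto)
qed

lemma gauss_bounds: "0 \<le> gauss \<epsilon> \<omega>" "gauss \<epsilon> \<omega> \<le> 1"
  unfolding gauss_def by (auto intro!: prod_nonneg prod_le_1)

lemma borel_measurable_gauss [measurable]: "gauss \<epsilon> \<in> borel_measurable L"
  unfolding gauss_def by measurable

lemma gauss_integrable:
  assumes "0 < \<epsilon>"
  shows "integrable L (\<lambda>\<omega>. complex_of_real (gauss \<epsilon> \<omega>))"
  using gauss_integral(1)[OF assms, of "\<lambda>_. 0"] by (simp add: dot_def)

text \<open>
  Fubini, and the fact that the inverse transform of a Gaussian is a Gaussian density. The right-hand side is \<open>h\<close>
  convolved with the density of standard deviation \<open>\<epsilon>\<close>.
\<close>

lemma gauss_regularised_inversion: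
  assumes h: "integrable L h" and \<epsilon>: "0 < \<epsilon>"
  shows "(LINT \<omega>|L. fourier h \<omega> * (complex_of_real (gauss \<epsilon> \<omega>) * cis (2 * pi * dot t \<omega>)))
       = (LINT s|L. h s * (\<Prod>i\<in>I. complex_of_real (normal_density 0 \<epsilon> (t i - s i))))"
proof -
  have [measurable]: "h \<in> borel_measurable L" using h by auto
  define k where "k s \<omega> = h s * cis (- (2 * pi * dot s \<omega>)) * (complex_of_real (gauss \<epsilon> \<omega>) * cis (2 * pi * dot t \<omega>))" for s \<omega>
  have "integrable (L \<Otimes>\<^sub>M L) (\<lambda>(s, \<omega>). k s \<omega>)"
  proof (rule Bochner_Integration.integrable_bound[OF PP.integrable_pair_mult[OF h gauss_integrable[OF \<epsilon>]]])
    show "(\<lambda>(s, \<omega>). k s \<omega>) \<in> borel_measurable (L \<Otimes>\<^sub>M L)"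
      unfolding k_def by measurable
  qed (auto simp: k_def norm_mult gauss_bounds)
  then have "(LINT \<omega>|L. LINT s|L. k s \<omega>) = (LINT s|L. LINT \<omega>|L. k s \<omega>)"
    by (rule PP.Fubini_integral)
  moreover have "(LINT s|L. k s \<omega>) = fourier h \<omega> * (complex_of_real (gauss \<epsilon> \<omega>) * cis (2 * pi * dot t \<omega>))" for \<omega>
    unfolding k_def fourier_def by (rule integral_mult_left_zero)
  moreover have "(LINT \<omega>|L. k s \<omega>) = h s * (\<Prod>i\<in>I. complex_of_real (normal_density 0 \<epsilon> (t i - s i)))" for s
  proof -
    have "k s \<omega> = h s * (complex_of_real (gauss \<epsilon> \<omega>) * cis (2 * pi * dot (\<lambda>i. t i - s i) \<omega>))" for \<omega>
      by (simp add: k_def cis_mult mult_ac flip: dot_diff_left) (simp add: algebra_simps)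
    then show ?thesis by (simp only: integral_mult_right_zero gauss_integral(2)[OF \<epsilon>])
  qed
  ultimately show ?thesis by simp
qed

text \<open>
  Moving the convolution from \<open>h\<close> to the indicator of the box avoids any approximation theorem in \<open>L\<^sup>1\<close>: smoothed
  indicators converge almost everywhere and stay between 0 and 1.
\<close>

lemma integral_box_convolution:
  assumes h: "integrable L h" and \<epsilon>: "0 < \<epsilon>"
  shows "(LINT t|L. indicator (box a b) t * (LINT s|L. h s * (\<Prod>i\<in>I. complex_of_real (normal_density 0 \<epsilon> (t i - s i)))))
       = (LINT s|L. h s * complex_of_real (\<Prod>i\<in>I. smoothed_indicator (a i) (b i) \<epsilon> (s i)))"
proof -
  have [measurable]: "h \<in> borel_measurable L" using h by auto
  define k where "k s t = h s * (indicator (box a b) t * (\<Prod>i\<in>I. complex_of_real (normal_density 0 \<epsilon> (t i - s i))))" for s t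
  have "integrable (L \<Otimes>\<^sub>M L) (\<lambda>(s, t). k s t)"
  proof (rule Bochner_Integration.integrable_bound)
    \<comment> \<open>a bound for the product of the Gaussian densities\<close>
    define K where "K = (1 / sqrt (2 * pi * \<epsilon>\<^sup>2)) ^ card I"
    have "integrable L (\<lambda>t. complex_of_real K * indicator (box a b) t)"
      by (intro integrable_mult_right integrable_box_indicator)
    from PP.integrable_pair_mult[OF h this]
    show "integrable (L \<Otimes>\<^sub>M L) (\<lambda>(s, t). h s * (complex_of_real K * indicator (box a b) t))" .
    show "(\<lambda>(s, t). k s t) \<in> borel_measurable (L \<Otimes>\<^sub>M L)"
      unfolding k_def by measurable
    have K: "(\<Prod>i\<in>I. normal_density 0 \<epsilon> (t i - s i)) \<le> K" for s t
    proof -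
      have "(\<Prod>i\<in>I. normal_density 0 \<epsilon> (t i - s i)) \<le> (\<Prod>i\<in>I. (1 / sqrt (2 * pi * \<epsilon>\<^sup>2)))"
        using \<epsilon> by (intro prod_mono) (auto simp: normal_density_def mult_le_cancel_left1 field_simps)
      then show ?thesis by (simp add: K_def)
    qed
    have "norm (k s t) \<le> norm (h s * (complex_of_real K * indicator (box a b) t))" for s t
    proof -
      have P: "norm (\<Prod>i\<in>I. complex_of_real (normal_density 0 \<epsilon> (t i - s i))) \<le> norm (complex_of_real K)"
        using order_trans[OF K abs_ge_self] unfolding of_real_prod[symmetric] norm_of_real
        by (simp add: abs_of_nonneg prod_nonneg)
      show ?thesis unfolding k_def norm_mult
        by (subst mult.commute[of "norm (complex_of_real K)"]) (intro mult_left_mono P norm_ge_zero)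
    qed
    then show "AE x in L \<Otimes>\<^sub>M L. norm (case x of (s, t) \<Rightarrow> k s t)
        \<le> norm (case x of (s, t) \<Rightarrow> h s * (complex_of_real K * indicator (box a b) t))"
      by auto
  qed
  then have "(LINT t|L. LINT s|L. k s t) = (LINT s|L. LINT t|L. k s t)"
    by (rule PP.Fubini_integral)
  moreover have "(LINT s|L. k s t) = indicator (box a b) t * (LINT s|L. h s * (\<Prod>i\<in>I. complex_of_real (normal_density 0 \<epsilon> (t i - s i))))" for t
    unfolding k_def by (simp only: mult.left_commute[of _ "indicator (box a b) t"] integral_mult_right_zero)
  moreover have "(LINT t|L. k s t) = h s * complex_of_real (\<Prod>i\<in>I. smoothed_indicator (a i) (b i) \<epsilon> (s i))" for s
  proof -
    have "(LINT t|L. indicator (box a b) t * (\<Prod>i\<in>I. complex_of_real (normal_density 0 \<epsilon> (t i - s i))))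
        = (LINT t|L. (\<Prod>i\<in>I. complex_of_real (indicator {a i..b i} (t i) * normal_density 0 \<epsilon> (t i - s i))))"
      by (rule Bochner_Integration.integral_cong) (auto simp: box_indicator prod.distrib of_real_indicator)
    also have "\<dots> = (\<Prod>i\<in>I. LINT x|lborel. complex_of_real (indicator {a i..b i} x * normal_density 0 \<epsilon> (x - s i)))"
      by (rule P.product_integral_prod) (auto intro!: integrable_of_real integrable_indicator_normal_density[OF \<epsilon>] simp del: of_real_mult)
    also have "\<dots> = complex_of_real (\<Prod>i\<in>I. smoothed_indicator (a i) (b i) \<epsilon> (s i))"
      by (simp add: smoothed_indicator_def del: of_real_mult)
    finally show ?thesis unfolding k_def by simp
  qed
  ultimately show ?thesis by simp
qed

definition inverse_fourier :: "(('i \<Rightarrow> real) \<Rightarrow> complex) \<Rightarrow> ('i \<Rightarrow> real) \<Rightarrow> complex" where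
  "inverse_fourier H t = (LINT \<omega>|L. H \<omega> * cis (2 * pi * dot t \<omega>))"

text \<open>
  As the regularisation tends to 0, dominated convergence applies on both sides; the faces of the box are a null set.
\<close>

lemma box_integral_inversion:
  assumes h: "integrable L h" and hh: "integrable L (fourier h)"
  shows "(LINT t|L. indicator (box a b) t * inverse_fourier (fourier h) t) = (LINT t|L. indicator (box a b) t * h t)"
proof -
  have [measurable]: "h \<in> borel_measurable L" "fourier h \<in> borel_measurable L" using h hh by auto
  define \<epsilon> :: "nat \<Rightarrow> real" where "\<epsilon> n = 1 / real (Suc n)" for n
  have \<epsilon>: "0 < \<epsilon> n" for n by (simp add: \<epsilon>_def)
  have \<epsilon>0: "\<epsilon> \<longlonglongrightarrow> 0" unfolding \<epsilon>_def using LIMSEQ_inverse_real_of_nat by (simp add: inverse_eq_divide)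
  define u where "u n t = (LINT \<omega>|L. fourier h \<omega> * (complex_of_real (gauss (\<epsilon> n) \<omega>) * cis (2 * pi * dot t \<omega>)))" for n t
  have u_lim: "(\<lambda>n. u n t) \<longlonglongrightarrow> inverse_fourier (fourier h) t" for t
    unfolding u_def inverse_fourier_def
  proof (rule integral_dominated_convergence[where w = "\<lambda>\<omega>. norm (fourier h \<omega>)"])
    have "(\<lambda>n. gauss (\<epsilon> n) \<omega>) \<longlonglongrightarrow> (\<Prod>i\<in>I. exp (- 2 * pi\<^sup>2 * 0\<^sup>2 * (\<omega> i)\<^sup>2))" for \<omega>
      unfolding gauss_def by (intro tendsto_intros \<epsilon>0)
    then have "(\<lambda>n. complex_of_real (gauss (\<epsilon> n) \<omega>)) \<longlonglongrightarrow> complex_of_real 1" for \<omega>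
      by (intro tendsto_of_real) simp
    then have "(\<lambda>n. fourier h \<omega> * (complex_of_real (gauss (\<epsilon> n) \<omega>) * cis (2 * pi * dot t \<omega>))) \<longlonglongrightarrow> fourier h \<omega> * (complex_of_real 1 * cis (2 * pi * dot t \<omega>))" for \<omega>
      by (intro tendsto_mult tendsto_const)
    then show "AE \<omega> in L. (\<lambda>n. fourier h \<omega> * (complex_of_real (gauss (\<epsilon> n) \<omega>) * cis (2 * pi * dot t \<omega>))) \<longlonglongrightarrow> fourier h \<omega> * cis (2 * pi * dot t \<omega>)"
      by simp
    show "AE \<omega> in L. norm (fourier h \<omega> * (complex_of_real (gauss (\<epsilon> n) \<omega>) * cis (2 * pi * dot t \<omega>))) \<le> norm (fourier h \<omega>)" for n
      using gauss_bounds by (auto simp: norm_mult intro!: mult_left_le)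
  qed (use hh in auto)
  have u_bound: "norm (u n t) \<le> (LINT \<omega>|L. norm (fourier h \<omega>))" for n t
    unfolding u_def
  proof (rule order_trans[OF integral_norm_bound], rule integral_mono_AE')
    show "AE \<omega> in L. norm (fourier h \<omega> * (complex_of_real (gauss (\<epsilon> n) \<omega>) * cis (2 * pi * dot t \<omega>))) \<le> norm (fourier h \<omega>)"
      using gauss_bounds by (auto simp: norm_mult intro!: mult_left_le)
  qed (use hh in auto)
  have [measurable]: "u n \<in> borel_measurable L" for n unfolding u_def by measurable
  have "(\<lambda>n. LINT t|L. indicator (box a b) t * u n t) \<longlonglongrightarrow> (LINT t|L. indicator (box a b) t * inverse_fourier (fourier h) t)"
  proof (rule integral_dominated_convergence[where w = "\<lambda>t. indicator (box a b) t * (LINT \<omega>|L. norm (fourier h \<omega>))"])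
    show "integrable L (\<lambda>t. indicator (box a b) t * (LINT \<omega>|L. norm (fourier h \<omega>)))"
      using emeasure_box_finite[of a b] by (intro integrable_mult_left integrable_real_indicator) (auto simp: less_top[symmetric])
    show "(\<lambda>t. indicator (box a b) t * inverse_fourier (fourier h) t) \<in> borel_measurable L"
      unfolding inverse_fourier_def by measurable
    show "AE t in L. (\<lambda>n. indicator (box a b) t * u n t) \<longlonglongrightarrow> indicator (box a b) t * inverse_fourier (fourier h) t"
      using u_lim by (auto intro!: tendsto_mult)
    show "AE t in L. norm (indicator (box a b) t * u n t) \<le> indicator (box a b) t * (LINT \<omega>|L. norm (fourier h \<omega>))" for n
      using u_bound by (auto simp: indicator_def)
  qed measurable
  moreover have "(LINT t|L. indicator (box a b) t * u n t) = (LINT s|L. h s * complex_of_real (\<Prod>i\<in>I. smoothed_indicator (a i) (b i) (\<epsilon> n) (s i)))" for n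
    unfolding u_def gauss_regularised_inversion[OF h \<epsilon>] by (rule integral_box_convolution[OF h \<epsilon>])
  moreover have "(\<lambda>n. LINT s|L. h s * complex_of_real (\<Prod>i\<in>I. smoothed_indicator (a i) (b i) (\<epsilon> n) (s i))) \<longlonglongrightarrow> (LINT s|L. h s * indicator (box a b) s)"
  proof (rule integral_dominated_convergence[where w = "\<lambda>s. norm (h s)"])
    have "AE s in L. \<forall>i\<in>I. s i \<noteq> a i \<and> s i \<noteq> b i"
      using AE_coordinate_neq by (intro AE_finite_allI) auto
    then show "AE s in L. (\<lambda>n. h s * complex_of_real (\<Prod>i\<in>I. smoothed_indicator (a i) (b i) (\<epsilon> n) (s i))) \<longlonglongrightarrow> h s * indicator (box a b) s"
    proof (rule AE_mp, intro AE_I2 impI)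
      fix s assume s: "s \<in> space L" "\<forall>i\<in>I. s i \<noteq> a i \<and> s i \<noteq> b i"
      have "(\<lambda>n. \<Prod>i\<in>I. smoothed_indicator (a i) (b i) (\<epsilon> n) (s i)) \<longlonglongrightarrow> (\<Prod>i\<in>I. indicator {a i..b i} (s i))"
        using s by (intro tendsto_prod smoothed_indicator_tendsto \<epsilon> \<epsilon>0) auto
      then have "(\<lambda>n. \<Prod>i\<in>I. smoothed_indicator (a i) (b i) (\<epsilon> n) (s i)) \<longlonglongrightarrow> indicator (box a b) s"
        using s by (simp add: box_indicator)
      then have "(\<lambda>n. h s * complex_of_real (\<Prod>i\<in>I. smoothed_indicator (a i) (b i) (\<epsilon> n) (s i))) \<longlonglongrightarrow> h s * complex_of_real (indicator (box a b) s)"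
        by (intro tendsto_mult tendsto_const tendsto_of_real)
      then show "(\<lambda>n. h s * complex_of_real (\<Prod>i\<in>I. smoothed_indicator (a i) (b i) (\<epsilon> n) (s i))) \<longlonglongrightarrow> h s * indicator (box a b) s"
        by (simp add: of_real_indicator)
    qed
    have "0 \<le> (\<Prod>i\<in>I. smoothed_indicator (a i) (b i) (\<epsilon> n) (s i)) \<and> (\<Prod>i\<in>I. smoothed_indicator (a i) (b i) (\<epsilon> n) (s i)) \<le> 1" for s n
      using smoothed_indicator_bounds[OF \<epsilon>] by (auto intro!: prod_nonneg prod_le_1)
    then show "AE s in L. norm (h s * complex_of_real (\<Prod>i\<in>I. smoothed_indicator (a i) (b i) (\<epsilon> n) (s i))) \<le> norm (h s)" for n
      unfolding norm_mult norm_of_real by (intro AE_I2 mult_left_le) (simp_all only: abs_of_nonneg norm_ge_zero)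
  qed (use h in auto)
  ultimately show ?thesis using LIMSEQ_unique by (fastforce simp: mult.commute)
qed

theorem fourier_inversion:
  assumes h: "integrable L h" and hh: "integrable L (fourier h)"
  shows "AE t in L. h t = inverse_fourier (fourier h) t"
proof -
  have [measurable]: "h \<in> borel_measurable L" "fourier h \<in> borel_measurable L" using h hh by auto
  define D where "D t = h t - inverse_fourier (fourier h) t" for t
  have mD[measurable]: "D \<in> borel_measurable L" unfolding D_def inverse_fourier_def by measurable
  have inv_bound: "norm (inverse_fourier (fourier h) t) \<le> (LINT \<omega>|L. norm (fourier h \<omega>))" for t
    unfolding inverse_fourier_def by (rule order_trans[OF integral_norm_bound]) (simp add: norm_mult)
  have i1: "integrable L (\<lambda>t. indicator (box a b) t * h t)" for a b
    using integrable_mult_indicator[OF box_sets h] by (simp add: scaleR_conv_of_real of_real_indicator)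
  have i2: "integrable L (\<lambda>t. indicator (box a b) t * inverse_fourier (fourier h) t)" for a b
  proof (rule Bochner_Integration.integrable_bound)
    show "integrable L (\<lambda>t. indicator (box a b) t * (LINT \<omega>|L. norm (fourier h \<omega>)))"
      using emeasure_box_finite[of a b] by (intro integrable_mult_left integrable_real_indicator) (auto simp: less_top[symmetric])
    show "(\<lambda>t. indicator (box a b) t * inverse_fourier (fourier h) t) \<in> borel_measurable L"
      unfolding inverse_fourier_def by measurable
  qed (use inv_bound in \<open>auto simp: indicator_def\<close>)
  have iD: "integrable L (\<lambda>t. indicator (box a b) t * D t)" for a b
    using Bochner_Integration.integrable_diff[OF i1 i2] by (simp add: D_def right_diff_distrib)
  have D0: "(LINT t|L. indicator (box a b) t * D t) = 0" for a b
    using Bochner_Integration.integral_diff[OF i1 i2, of a b a b] box_integral_inversion[OF h hh, of a b] by (simp add: D_def right_diff_distrib)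
  have Re: "Re (indicator A t * z) = indicator A t * Re z" and Im: "Im (indicator A t * z) = indicator A t * Im z" for A :: "('i \<Rightarrow> real) set" and t z
    by (auto simp: indicator_def)
  have "AE t in L. Re (D t) = 0"
  proof (rule AE_eq_0_if_box_integrals_0)
    fix a b
    show "integrable L (\<lambda>t. indicator (box a b) t * Re (D t))"
      using integrable_Re[OF iD[of a b]] unfolding Re .
    show "(LINT t|L. indicator (box a b) t * Re (D t)) = 0"
      using integral_Re[OF iD[of a b]] unfolding Re D0 by simp
  qed measurable
  moreover have "AE t in L. Im (D t) = 0"
  proof (rule AE_eq_0_if_box_integrals_0)
    fix a b
    show "integrable L (\<lambda>t. indicator (box a b) t * Im (D t))"
      using integrable_Im[OF iD[of a b]] unfolding Im .
    show "(LINT t|L. indicator (box a b) t * Im (D t)) = 0"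
      using integral_Im[OF iD[of a b]] unfolding Im D0 by simp
  qed measurable
  ultimately show ?thesis by eventually_elim (simp add: D_def complex_eq_iff)
qed

section \<open>Translations and the short-time Fourier transform\<close>

text \<open>
  Coordinatewise difference, restricted to \<open>I\<close> so that the result is again a point of the space.
\<close>

definition sub :: "('i \<Rightarrow> real) \<Rightarrow> ('i \<Rightarrow> real) \<Rightarrow> 'i \<Rightarrow> real" where
  "sub x y = (\<lambda>i\<in>I. x i - y i)"

lemma measurable_sub [measurable (raw)]:
  assumes [measurable]: "f \<in> M \<rightarrow>\<^sub>M L" "g \<in> M \<rightarrow>\<^sub>M L"
  shows "(\<lambda>x. sub (f x) (g x)) \<in> M \<rightarrow>\<^sub>M L"
  unfolding sub_def by (rule measurable_restrict) simp

lemma measurable_sub_const_left [measurable (raw)]: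
  assumes [measurable]: "f \<in> M \<rightarrow>\<^sub>M L"
  shows "(\<lambda>x. sub v (f x)) \<in> M \<rightarrow>\<^sub>M L"
  unfolding sub_def by (rule measurable_restrict) simp

lemma measurable_sub_const_right [measurable (raw)]:
  assumes [measurable]: "f \<in> M \<rightarrow>\<^sub>M L"
  shows "(\<lambda>x. sub (f x) v) \<in> M \<rightarrow>\<^sub>M L"
  unfolding sub_def by (rule measurable_restrict) simp

lemma sub_in_space [simp]: "sub x y \<in> space L"
  by (simp add: sub_def space_PiM)

lemma distr_coordinatewise:
  assumes [measurable]: "\<And>i. \<phi> i \<in> borel_measurable borel" 
    and inv: "\<And>i. distr lborel lborel (\<phi> i) = (lborel :: real measure)"
  shows "distr L L (\<lambda>x. \<lambda>i\<in>I. \<phi> i (x i)) = L"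
proof (rule P.PiM_eqI)
  have meas: "(\<lambda>x. \<lambda>i\<in>I. \<phi> i (x i)) \<in> L \<rightarrow>\<^sub>M L" by (rule measurable_restrict) simp
  fix A :: "'i \<Rightarrow> real set" assume A: "\<And>i. i \<in> I \<Longrightarrow> A i \<in> sets lborel"
  have "(\<lambda>x. \<lambda>i\<in>I. \<phi> i (x i)) -` Pi\<^sub>E I A \<inter> space L = Pi\<^sub>E I (\<lambda>i. \<phi> i -` A i)"
    by (auto simp: space_PiM PiE_iff)
  then have "emeasure (distr L L (\<lambda>x. \<lambda>i\<in>I. \<phi> i (x i))) (Pi\<^sub>E I A) = emeasure L (Pi\<^sub>E I (\<lambda>i. \<phi> i -` A i))"
    using A by (subst emeasure_distr[OF meas]) (auto intro!: sets_PiM_I_finite)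
  also have "\<dots> = (\<Prod>i\<in>I. emeasure lborel (\<phi> i -` A i))"
  proof (rule P.measure_times)
    fix i assume "i \<in> I"
    then have "\<phi> i -` A i \<inter> space borel \<in> sets borel" using A by (intro measurable_sets[OF assms(1)]) auto
    then show "\<phi> i -` A i \<in> sets lborel" by simp
  qed
  also have "\<dots> = (\<Prod>i\<in>I. emeasure lborel (A i))"
  proof (rule prod.cong[OF refl])
    fix i assume "i \<in> I"
    then have "emeasure (distr lborel lborel (\<phi> i)) (A i) = emeasure lborel (\<phi> i -` A i)"
      using A by (subst emeasure_distr) auto
    then show "emeasure lborel (\<phi> i -` A i) = emeasure lborel (A i)" by (simp add: inv)
  qed
  finally show "emeasure (distr L L (\<lambda>x. \<lambda>i\<in>I. \<phi> i (x i))) (Pi\<^sub>E I A) = (\<Prod>i\<in>I. emeasure lborel (A i))" .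
qed auto

lemma distr_lborel_affine:
  fixes c t :: real
  assumes "\<bar>c\<bar> = 1"
  shows "distr lborel lborel (\<lambda>x. t + c * x) = lborel"
proof -
  have "c \<noteq> 0" using assms by auto
  have "(lborel :: real measure) = density (distr lborel borel (\<lambda>x. t + c * x)) (\<lambda>_. ennreal \<bar>c\<bar>)"
    by (rule lborel_real_affine[OF \<open>c \<noteq> 0\<close>])
  also have "\<dots> = distr lborel borel (\<lambda>x. t + c * x)" using assms by (simp add: density_1)
  also have "\<dots> = distr lborel lborel (\<lambda>x. t + c * x)" by (rule distr_cong) auto
  finally show ?thesis by simp
qed

lemma distr_sub_left: "distr L L (\<lambda>x. sub v x) = L"
  using distr_coordinatewise[of "\<lambda>i x. v i + (- 1) * x", OF _ distr_lborel_affine] by (simp add: sub_def)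

lemma distr_sub_right: "distr L L (\<lambda>x. sub x v) = L"
  using distr_coordinatewise[of "\<lambda>i x. - v i + 1 * x", OF _ distr_lborel_affine] by (simp add: sub_def)

lemma nn_integral_sub_left:
  assumes [measurable]: "F \<in> borel_measurable L"
  shows "(\<integral>\<^sup>+ x. F (sub v x) \<partial>L) = (\<integral>\<^sup>+ x. F x \<partial>L)"
  by (subst (2) distr_sub_left[symmetric, of v]) (simp add: nn_integral_distr)

lemma nn_integral_sub_right:
  assumes [measurable]: "F \<in> borel_measurable L"
  shows "(\<integral>\<^sup>+ x. F (sub x v) \<partial>L) = (\<integral>\<^sup>+ x. F x \<partial>L)"
  by (subst (2) distr_sub_right[symmetric, of v]) (simp add: nn_integral_distr)

lemma integral_sub_right:
  fixes F :: "_ \<Rightarrow> complex"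
  assumes [measurable]: "F \<in> borel_measurable L"
  shows "(LINT x|L. F (sub x v)) = (LINT x|L. F x)"
  by (subst (2) distr_sub_right[symmetric, of v]) (simp add: integral_distr)

lemma integrable_sub_right:
  fixes F :: "_ \<Rightarrow> 'b :: {banach, second_countable_topology}"
  assumes "integrable L F"
  shows "integrable L (\<lambda>x. F (sub x v))"
proof -
  have "integrable (distr L L (\<lambda>x. sub x v)) F" using assms unfolding distr_sub_right .
  then show ?thesis by (subst (asm) integrable_distr_eq) (use assms in auto)
qed

lemma AE_sub_left:
  assumes "AE x in L. Q x"
  shows "AE x in L. Q (sub v x)"
proof -
  have "AE x in distr L L (\<lambda>x. sub v x). Q x" using assms unfolding distr_sub_left .
  then show ?thesis by (rule AE_distrD[rotated]) measurable
qed

lemma AE_sub_right: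
  assumes "AE x in L. Q x"
  shows "AE x in L. Q (sub x v)"
proof -
  have "AE x in distr L L (\<lambda>x. sub x v). Q x" using assms unfolding distr_sub_right .
  then show ?thesis by (rule AE_distrD[rotated]) measurable
qed

lemma dot_sub_left: "dot (sub x y) z = dot x z - dot y z"
  by (simp add: dot_def sub_def sum_subtractf algebra_simps)

lemma dot_sub_right: "dot z (sub x y) = dot z x - dot z y"
  by (simp add: dot_def sub_def sum_subtractf algebra_simps)

lemma dot_commute: "dot x y = dot y x"
  by (simp add: dot_def mult.commute)

lemma dot_upd:
  assumes "i \<in> I"
  shows "dot x (y(i := s)) = dot x (y(i := r)) + x i * (s - r)"
proof -
  have "dot x (y(i := s)) = x i * s + (\<Sum>j\<in>I - {i}. x j * y j)" for s
    unfolding dot_def using assms by (subst sum.remove[of I i]) (auto intro!: sum.cong)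
  then show ?thesis by (simp add: algebra_simps)
qed

end

locale stft = coordinate_space I for I :: "'i set" +
  fixes f g :: "('i \<Rightarrow> real) \<Rightarrow> complex"
  assumes f_meas [measurable]: "f \<in> borel_measurable L" and g_meas [measurable]: "g \<in> borel_measurable L"
    and f_int: "integrable L (\<lambda>t. (norm (f t))\<^sup>2)" and g_int: "integrable L (\<lambda>t. (norm (g t))\<^sup>2)"
begin

definition h :: "('i \<Rightarrow> real) \<Rightarrow> ('i \<Rightarrow> real) \<Rightarrow> complex" where
  "h x t = f t * cnj (g (sub t x))"

definition V :: "('i \<Rightarrow> real) \<Rightarrow> ('i \<Rightarrow> real) \<Rightarrow> complex" where
  "V x = fourier (h x)"

lemma measurable_h [measurable (raw)]:
  assumes [measurable]: "a \<in> M \<rightarrow>\<^sub>M L" "b \<in> M \<rightarrow>\<^sub>M L"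
  shows "(\<lambda>z. h (a z) (b z)) \<in> borel_measurable M"
  unfolding h_def by measurable

lemma measurable_h_const [measurable]: "h x \<in> borel_measurable L"
  unfolding h_def[abs_def] by measurable

lemma measurable_V [measurable (raw)]:
  assumes [measurable]: "a \<in> M \<rightarrow>\<^sub>M L" "b \<in> M \<rightarrow>\<^sub>M L"
  shows "(\<lambda>z. V (a z) (b z)) \<in> borel_measurable M"
  unfolding V_def by measurable

lemma measurable_V_const [measurable]: "V x \<in> borel_measurable L"
  unfolding V_def[abs_def] by measurable

lemma h_integrable: "integrable L (h x)"
proof (rule Bochner_Integration.integrable_bound)
  show "integrable L (\<lambda>t. (norm (f t))\<^sup>2 + (norm (g (sub t x)))\<^sup>2)"
    using integrable_sub_right[OF g_int] f_int by (intro Bochner_Integration.integrable_add) auto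
  have "norm (f t) * norm (g (sub t x)) \<le> (norm (f t))\<^sup>2 + (norm (g (sub t x)))\<^sup>2" for t
  proof -
    have "2 * (norm (f t) * norm (g (sub t x))) \<le> (norm (f t))\<^sup>2 + (norm (g (sub t x)))\<^sup>2"
      using sum_squares_bound[of "norm (f t)" "norm (g (sub t x))"] by (simp only: mult.assoc)
    moreover have "0 \<le> norm (f t) * norm (g (sub t x))" by simp
    ultimately show ?thesis by linarith
  qed
  then show "AE t in L. norm (h x t) \<le> norm ((norm (f t))\<^sup>2 + (norm (g (sub t x)))\<^sup>2)"
    by (simp add: h_def norm_mult)
qed measurable

section \<open>A product that is its own Fourier transform\<close>

text \<open>
  Inserting the definition of the second factor and exchanging the integrals leaves an inverse Fourier transform of
  \<open>V x\<close>, which is \<open>h x\<close> again.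
\<close>

lemma V_product_fourier_integral:
  assumes V: "integrable L (V x)"
  shows "(LINT \<omega>|L. V x \<omega> * V y (sub v \<omega>) * cis (- (2 * pi * dot \<omega> c)))
       = (LINT s|L. h y s * h x (sub s c) * cis (- (2 * pi * dot s v)))"
proof -
  define k where "k \<omega> s = V x \<omega> * h y s * cis (2 * pi * dot (sub s c) \<omega>) * cis (- (2 * pi * dot s v))" for \<omega> s
  have "integrable (L \<Otimes>\<^sub>M L) (\<lambda>(\<omega>, s). k \<omega> s)"
  proof (rule Bochner_Integration.integrable_bound[OF PP.integrable_pair_mult[OF V h_integrable[of y]]])
    show "(\<lambda>(\<omega>, s). k \<omega> s) \<in> borel_measurable (L \<Otimes>\<^sub>M L)" unfolding k_def by measurable
  qed (auto simp: k_def norm_mult)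
  then have "(LINT s|L. LINT \<omega>|L. k \<omega> s) = (LINT \<omega>|L. LINT s|L. k \<omega> s)"
    by (rule PP.Fubini_integral)
  moreover have "(LINT s|L. k \<omega> s) = V x \<omega> * V y (sub v \<omega>) * cis (- (2 * pi * dot \<omega> c))" for \<omega>
  proof -
    have "k \<omega> s = V x \<omega> * cis (- (2 * pi * dot \<omega> c)) * (h y s * cis (- (2 * pi * dot s (sub v \<omega>))))" for s
    proof -
      have "cis (2 * pi * dot (sub s c) \<omega>) * cis (- (2 * pi * dot s v)) = cis (- (2 * pi * dot \<omega> c)) * cis (- (2 * pi * dot s (sub v \<omega>)))"
        unfolding cis_mult dot_sub_left dot_sub_right dot_commute[of c \<omega>] by (rule arg_cong[of _ _ cis]) (simp add: algebra_simps)
      then show ?thesis unfolding k_def by (simp add: mult.assoc mult.left_commute)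
    qed
    then have "(LINT s|L. k \<omega> s) = V x \<omega> * cis (- (2 * pi * dot \<omega> c)) * (LINT s|L. h y s * cis (- (2 * pi * dot s (sub v \<omega>))))"
      by (simp only: integral_mult_right_zero)
    also have "(LINT s|L. h y s * cis (- (2 * pi * dot s (sub v \<omega>)))) = V y (sub v \<omega>)"
      unfolding V_def fourier_def ..
    finally show ?thesis by (simp only: mult_ac)
  qed
  moreover have "(LINT s|L. LINT \<omega>|L. k \<omega> s) = (LINT s|L. h y s * h x (sub s c) * cis (- (2 * pi * dot s v)))"
  proof (rule integral_cong_AE)
    have "AE t in L. h x t = inverse_fourier (V x) t"
      using fourier_inversion[OF h_integrable, of x] V unfolding V_def by simp
    then have "AE s in L. h x (sub s c) = inverse_fourier (V x) (sub s c)" by (rule AE_sub_right)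
    then show "AE s in L. (LINT \<omega>|L. k \<omega> s) = h y s * h x (sub s c) * cis (- (2 * pi * dot s v))"
    proof eventually_elim
      case (elim s)
      have "k \<omega> s = (h y s * cis (- (2 * pi * dot s v))) * (V x \<omega> * cis (2 * pi * dot (sub s c) \<omega>))" for \<omega>
        unfolding k_def by (simp only: mult_ac)
      then have "(LINT \<omega>|L. k \<omega> s) = (h y s * cis (- (2 * pi * dot s v))) * inverse_fourier (V x) (sub s c)"
        unfolding inverse_fourier_def by (simp only: integral_mult_right_zero)
      then show ?case unfolding elim by (simp only: mult_ac)
    qed
    show "(\<lambda>s. LINT \<omega>|L. k \<omega> s) \<in> borel_measurable L" unfolding k_def by measurable
  qed measurable
  ultimately show ?thesis by simp
qed

text \<open>
  The four factors \<open>f, f, g, g\<close> of the product occur on both sides, but regrouped: the pairing that belongs to the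
  translations \<open>x\<close> and \<open>v - x\<close> becomes the pairing that belongs to \<open>\<eta>\<close> and \<open>v - \<eta>\<close>. This is the reason for the
  self-duality.
\<close>

lemma h_swap:
  "h (sub v x) s * h x (sub s (sub \<eta> x)) = h \<eta> s * h (sub v \<eta>) (sub (sub s \<eta>) (sub (\<lambda>_. 0) x))"
proof -
  have 1: "sub s (sub \<eta> x) = sub (sub s \<eta>) (sub (\<lambda>_. 0) x)"
    by (auto simp: sub_def)
  have 2: "sub (sub (sub s \<eta>) (sub (\<lambda>_. 0) x)) x = sub s \<eta>" by (auto simp: sub_def)
  have 3: "sub (sub (sub s \<eta>) (sub (\<lambda>_. 0) x)) (sub v \<eta>) = sub s (sub v x)" by (auto simp: sub_def)
  show ?thesis unfolding 1 unfolding h_def 2 3 by (simp only: mult_ac)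
qed

text \<open>
  After the regrouping, the variables \<open>s\<close> and \<open>x + s - \<eta>\<close> separate, and each of the two integrals is a value of \<open>V\<close>.
\<close>

lemma h_double_integral:
  "(LINT x|L. cis (- (2 * pi * dot x \<xi>)) * (LINT s|L. h (sub v x) s * h x (sub s (sub \<eta> x)) * cis (- (2 * pi * dot s w))))
    = cis (- (2 * pi * dot \<eta> \<xi>)) * V \<eta> (sub w \<xi>) * V (sub v \<eta>) \<xi>"
proof -
  define H where "H s x = h (sub v \<eta>) (sub (sub s \<eta>) (sub (\<lambda>_. 0) x))" for s x
  define k where "k s x = h \<eta> s * H s x * cis (- (2 * pi * dot s w)) * cis (- (2 * pi * dot x \<xi>))" for s x
  have H_meas [measurable]: "(\<lambda>z. H (a z) (b z)) \<in> borel_measurable M" 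
    if [measurable]: "a \<in> M \<rightarrow>\<^sub>M L" "b \<in> M \<rightarrow>\<^sub>M L" for a b and M :: "'z measure"
    unfolding H_def by measurable
  have H_meas' [measurable]: "(\<lambda>z. H s (b z)) \<in> borel_measurable M" 
    if [measurable]: "b \<in> M \<rightarrow>\<^sub>M L" for s b and M :: "'z measure"
    unfolding H_def by (rule measurable_compose[OF _ measurable_h_const]) measurable
  have sub_sub: "sub (sub s \<eta>) (sub (\<lambda>_. 0) x) = sub x (sub \<eta> s)" for s x by (auto simp: sub_def)
  have H_alt: "H s x = h (sub v \<eta>) (sub x (sub \<eta> s))" for s x unfolding H_def sub_sub ..
  have k_meas [measurable]: "(\<lambda>(s, x). k s x) \<in> borel_measurable (L \<Otimes>\<^sub>M L)" unfolding k_def by measurable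
  have "integrable (L \<Otimes>\<^sub>M L) (\<lambda>(s, x). k s x)"
  proof (rule integrableI_bounded[OF k_meas])
    have "(\<integral>\<^sup>+ z. ennreal (norm (case z of (s, x) \<Rightarrow> k s x)) \<partial>(L \<Otimes>\<^sub>M L)) = (\<integral>\<^sup>+ s. \<integral>\<^sup>+ x. ennreal (norm (k s x)) \<partial>L \<partial>L)"
      by (subst P.nn_integral_fst[symmetric]) auto
    also have "\<dots> = (\<integral>\<^sup>+ s. \<integral>\<^sup>+ x. ennreal (norm (h \<eta> s)) * ennreal (norm (h (sub v \<eta>) (sub x (sub \<eta> s)))) \<partial>L \<partial>L)"
      by (intro nn_integral_cong) (simp add: k_def norm_mult H_alt ennreal_mult)
    also have "\<dots> = (\<integral>\<^sup>+ s. ennreal (norm (h \<eta> s)) * (\<integral>\<^sup>+ x. ennreal (norm (h (sub v \<eta>) x)) \<partial>L) \<partial>L)"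
    proof (intro nn_integral_cong)
      fix s
      have "(\<integral>\<^sup>+ x. ennreal (norm (h \<eta> s)) * ennreal (norm (h (sub v \<eta>) (sub x (sub \<eta> s)))) \<partial>L) 
         = ennreal (norm (h \<eta> s)) * (\<integral>\<^sup>+ x. ennreal (norm (h (sub v \<eta>) (sub x (sub \<eta> s)))) \<partial>L)"
        by (intro nn_integral_cmult measurable_compose[OF measurable_compose[OF _ measurable_h_const] measurable_compose[OF borel_measurable_norm measurable_ennreal]]) measurable
      also have "(\<integral>\<^sup>+ x. ennreal (norm (h (sub v \<eta>) (sub x (sub \<eta> s)))) \<partial>L) = (\<integral>\<^sup>+ x. ennreal (norm (h (sub v \<eta>) x)) \<partial>L)"
        by (rule nn_integral_sub_right) measurable
      finally show "(\<integral>\<^sup>+ x. ennreal (norm (h \<eta> s)) * ennreal (norm (h (sub v \<eta>) (sub x (sub \<eta> s)))) \<partial>L) 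
         = ennreal (norm (h \<eta> s)) * (\<integral>\<^sup>+ x. ennreal (norm (h (sub v \<eta>) x)) \<partial>L)" .
    qed
    also have "\<dots> = (\<integral>\<^sup>+ s. ennreal (norm (h \<eta> s)) \<partial>L) * (\<integral>\<^sup>+ x. ennreal (norm (h (sub v \<eta>) x)) \<partial>L)"
      by (rule nn_integral_multc) measurable
    also have "\<dots> < \<infinity>"
      using h_integrable[of \<eta>] h_integrable[of "sub v \<eta>"] by (simp add: integrable_iff_bounded ennreal_mult_less_top)
    finally show "(\<integral>\<^sup>+ z. ennreal (norm (case z of (s, x) \<Rightarrow> k s x)) \<partial>(L \<Otimes>\<^sub>M L)) < \<infinity>" .
  qed
  then have "(LINT x|L. LINT s|L. k s x) = (LINT s|L. LINT x|L. k s x)"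
    by (rule PP.Fubini_integral)
  moreover have "(LINT s|L. k s x) = cis (- (2 * pi * dot x \<xi>)) * (LINT s|L. h (sub v x) s * h x (sub s (sub \<eta> x)) * cis (- (2 * pi * dot s w)))" for x
  proof -
    have "(LINT s|L. k s x) = (LINT s|L. cis (- (2 * pi * dot x \<xi>)) * (h (sub v x) s * h x (sub s (sub \<eta> x)) * cis (- (2 * pi * dot s w))))"
      by (rule Bochner_Integration.integral_cong) (simp_all only: k_def H_def h_swap mult_ac)
    then show ?thesis by (simp only: integral_mult_right_zero)
  qed
  moreover have "(LINT x|L. k s x) = (h \<eta> s * cis (- (2 * pi * dot s (sub w \<xi>)))) * (cis (- (2 * pi * dot \<eta> \<xi>)) * V (sub v \<eta>) \<xi>)" for s
  proof -
    have k_eq: "k s x = (h \<eta> s * cis (- (2 * pi * dot s (sub w \<xi>)))) * (cis (- (2 * pi * dot \<eta> \<xi>)) * 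
       (h (sub v \<eta>) (sub x (sub \<eta> s)) * cis (- (2 * pi * dot (sub x (sub \<eta> s)) \<xi>))))" for x
    proof -
      have "cis (- (2 * pi * dot s w)) * cis (- (2 * pi * dot x \<xi>)) 
          = cis (- (2 * pi * dot s (sub w \<xi>))) * (cis (- (2 * pi * dot \<eta> \<xi>)) * cis (- (2 * pi * dot (sub x (sub \<eta> s)) \<xi>)))"
        unfolding cis_mult dot_sub_left dot_sub_right by (rule arg_cong[of _ _ cis]) (simp add: algebra_simps)
      then show ?thesis unfolding k_def H_alt by (simp only: mult.assoc) (simp only: mult_ac)
    qed
    have "(LINT x|L. h (sub v \<eta>) (sub x (sub \<eta> s)) * cis (- (2 * pi * dot (sub x (sub \<eta> s)) \<xi>))) = V (sub v \<eta>) \<xi>"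
      unfolding V_def fourier_def
      by (rule integral_sub_right[where F = "\<lambda>x. h (sub v \<eta>) x * cis (- (2 * pi * dot x \<xi>))"]) measurable
    then show ?thesis unfolding k_eq integral_mult_right_zero by simp
  qed
  moreover have "(LINT s|L. (h \<eta> s * cis (- (2 * pi * dot s (sub w \<xi>)))) * (cis (- (2 * pi * dot \<eta> \<xi>)) * V (sub v \<eta>) \<xi>))
     = cis (- (2 * pi * dot \<eta> \<xi>)) * V \<eta> (sub w \<xi>) * V (sub v \<eta>) \<xi>"
    unfolding integral_mult_left_zero V_def fourier_def by (simp only: mult_ac)
  ultimately show ?thesis by simp
qed

text \<open>The product \<open>K(x, \<omega>)\<close> for \<open>(v, w)\<close> fixed, whose two factors are reflected in each other about \<open>(v/2, w/2)\<close>.\<close>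

definition VV :: "('i \<Rightarrow> real) \<Rightarrow> ('i \<Rightarrow> real) \<Rightarrow> ('i \<Rightarrow> real) \<Rightarrow> ('i \<Rightarrow> real) \<Rightarrow> complex" where
  "VV v w x \<omega> = V x \<omega> * V (sub v x) (sub w \<omega>)"

text \<open>
  The two preceding integrals combined: integration in \<open>\<omega>\<close> produces a product of two functions \<open>h\<close>, which after the
  exchange of arguments splits as a product under integration in \<open>x\<close>. The remaining factor is unimodular.
\<close>

lemma VV_fourier_invariance:
  assumes V: "AE x in L. integrable L (V x)"
    and K: "integrable (L \<Otimes>\<^sub>M L) (\<lambda>(x, \<omega>). VV v w x \<omega>)"
  shows "norm (LINT (x, \<omega>)|(L \<Otimes>\<^sub>M L). VV v w x \<omega> * cis (- (2 * pi * (dot \<omega> (sub \<eta> x) + dot x (sub w \<omega>')))))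
       = norm (VV v w \<eta> \<omega>')"
proof -
  define k where "k x \<omega> = VV v w x \<omega> * cis (- (2 * pi * (dot \<omega> (sub \<eta> x) + dot x (sub w \<omega>'))))" for x \<omega>
  have "integrable (L \<Otimes>\<^sub>M L) (\<lambda>(x, \<omega>). k x \<omega>)"
  proof (rule Bochner_Integration.integrable_bound[OF K])
    show "(\<lambda>(x, \<omega>). k x \<omega>) \<in> borel_measurable (L \<Otimes>\<^sub>M L)" unfolding k_def VV_def by measurable
  qed (auto simp: k_def norm_mult)
  then have "(LINT (x, \<omega>)|(L \<Otimes>\<^sub>M L). k x \<omega>) = (LINT x|L. LINT \<omega>|L. k x \<omega>)"
    using PP.integral_fst'[of "\<lambda>(x, \<omega>). k x \<omega>"] by simp
  also have "\<dots> = (LINT x|L. cis (- (2 * pi * dot x (sub w \<omega>'))) * (LINT s|L. h (sub v x) s * h x (sub s (sub \<eta> x)) * cis (- (2 * pi * dot s w))))"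
  proof (rule integral_cong_AE)
    show "AE x in L. (LINT \<omega>|L. k x \<omega>) = cis (- (2 * pi * dot x (sub w \<omega>'))) * (LINT s|L. h (sub v x) s * h x (sub s (sub \<eta> x)) * cis (- (2 * pi * dot s w)))"
      using V
    proof eventually_elim
      case (elim x)
      have "k x \<omega> = cis (- (2 * pi * dot x (sub w \<omega>'))) * (V x \<omega> * V (sub v x) (sub w \<omega>) * cis (- (2 * pi * dot \<omega> (sub \<eta> x))))" for \<omega>
      proof -
        have "cis (- (2 * pi * (dot \<omega> (sub \<eta> x) + dot x (sub w \<omega>')))) = cis (- (2 * pi * dot x (sub w \<omega>'))) * cis (- (2 * pi * dot \<omega> (sub \<eta> x)))"
          unfolding cis_mult by (rule arg_cong[of _ _ cis]) (simp add: algebra_simps)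
        then show ?thesis unfolding k_def VV_def by (simp only: mult_ac)
      qed
      then have "(LINT \<omega>|L. k x \<omega>) = cis (- (2 * pi * dot x (sub w \<omega>'))) * (LINT \<omega>|L. V x \<omega> * V (sub v x) (sub w \<omega>) * cis (- (2 * pi * dot \<omega> (sub \<eta> x))))"
        by (simp only: integral_mult_right_zero)
      also note V_product_fourier_integral[OF elim]
      finally show ?case .
    qed
    show "(\<lambda>x. LINT \<omega>|L. k x \<omega>) \<in> borel_measurable L" unfolding k_def VV_def by measurable
  qed measurable
  also have "\<dots> = cis (- (2 * pi * dot \<eta> (sub w \<omega>'))) * V \<eta> (sub w (sub w \<omega>')) * V (sub v \<eta>) (sub w \<omega>')"
    by (rule h_double_integral)
  also have "V \<eta> (sub w (sub w \<omega>')) = V \<eta> \<omega>'"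
    unfolding V_def fourier_def dot_sub_right by simp
  finally have "norm (LINT (x, \<omega>)|(L \<Otimes>\<^sub>M L). k x \<omega>) = norm (cis (- (2 * pi * dot \<eta> (sub w \<omega>'))) * V \<eta> \<omega>' * V (sub v \<eta>) (sub w \<omega>'))"
    by (rule arg_cong)
  then show ?thesis unfolding k_def VV_def norm_mult norm_cis by simp
qed
end

section \<open>Averaging the weights\<close>

text \<open>
  The properties of a pair of conjugate convex weights that the argument uses. The last one says that one of the
  weights grows at most quadratically, which gives order at most 2.
\<close>

locale conjugate_weights =
  fixes a b :: "real \<Rightarrow> real"
  assumes a_meas [measurable]: "a \<in> borel_measurable borel" and b_meas [measurable]: "b \<in> borel_measurable borel"
    and young: "\<And>r s. \<bar>r * s\<bar> \<le> a r + b s"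
    and a_nonneg: "\<And>r. 0 \<le> a r" and b_nonneg: "\<And>r. 0 \<le> b r"
    and a_mono: "\<And>r s. 0 \<le> r \<Longrightarrow> r \<le> s \<Longrightarrow> a r \<le> a s" and b_mono: "\<And>r s. 0 \<le> r \<Longrightarrow> r \<le> s \<Longrightarrow> b r \<le> b s"
    and a_abs: "\<And>r. a \<bar>r\<bar> = a r" and b_abs: "\<And>r. b \<bar>r\<bar> = b r"
    and a_midpoint: "\<And>r s. 2 * a (r - s / 2) \<le> a r + a (s - r)"
    and b_midpoint: "\<And>r s. 2 * b (r - s / 2) \<le> b r + b (s - r)"
    and growth: "\<exists>c\<ge>0. (\<forall>r. a r \<le> c * (1 + r\<^sup>2)) \<or> (\<forall>r. b r \<le> c * (1 + r\<^sup>2))"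

context coordinate_space
begin

text \<open>
  Almost every line parallel to a coordinate axis has a finite weighted integral, and a vanishing theorem on such lines implies
  vanishing almost everywhere.
\<close>

lemma coordinate_slices_vanish:
  fixes F :: "('i \<Rightarrow> real) \<Rightarrow> ennreal" and W :: "real \<Rightarrow> ennreal"
  assumes i: "i \<in> I" and [measurable]: "F \<in> borel_measurable L" "W \<in> borel_measurable borel"
    and fin: "(\<integral>\<^sup>+ y. F y * W (y i) \<partial>L) < \<infinity>"
    and vanish: "\<And>y s. y \<in> space L \<Longrightarrow> (\<integral>\<^sup>+ s. F (y(i := s)) * W s \<partial>lborel) < \<infinity> \<Longrightarrow> F (y(i := s)) = 0"
  shows "AE y in L. F y = 0"
proof -
  define J where "J = I - {i}"
  have J: "finite J" "i \<notin> J" "I = insert i J" using i by (auto simp: J_def)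
  let ?LJ = "PiM J (\<lambda>_. lborel :: real measure)"
  interpret J: finite_product_sigma_finite "\<lambda>_::'i. lborel :: real measure" J by standard (rule J)
  have upd [measurable]: "(\<lambda>z. (fst z)(i := snd z)) \<in> ?LJ \<Otimes>\<^sub>M lborel \<rightarrow>\<^sub>M L"
    unfolding J(3) by measurable
  have sp: "y(i := s) \<in> space L" if "y \<in> space ?LJ" for y s
    using that J by (auto simp: space_PiM PiE_iff extensional_def)
  have "(\<integral>\<^sup>+ y. F y * W (y i) \<partial>L) = (\<integral>\<^sup>+ y. \<integral>\<^sup>+ s. F (y(i := s)) * W ((y(i := s)) i) \<partial>lborel \<partial>?LJ)"
    unfolding J(3) by (rule P.product_nn_integral_insert[OF J(1,2)]) (simp add: J(3)[symmetric] i)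
  then have "(\<integral>\<^sup>+ y. \<integral>\<^sup>+ s. F (y(i := s)) * W s \<partial>lborel \<partial>?LJ) < \<infinity>" using fin by simp
  moreover have "(\<lambda>y. \<integral>\<^sup>+ s. F (y(i := s)) * W s \<partial>lborel) \<in> borel_measurable ?LJ"
  proof (rule lborel.borel_measurable_nn_integral)
    have "(\<lambda>z. F ((fst z)(i := snd z))) \<in> borel_measurable (?LJ \<Otimes>\<^sub>M lborel)"
      by (rule measurable_compose[OF upd]) measurable
    then have "(\<lambda>z. F ((fst z)(i := snd z)) * W (snd z)) \<in> borel_measurable (?LJ \<Otimes>\<^sub>M lborel)"
      by measurable
    then show "(\<lambda>(y, s). F (y(i := s)) * W s) \<in> borel_measurable (?LJ \<Otimes>\<^sub>M lborel)"
      by (simp add: case_prod_unfold)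
  qed
  ultimately have "AE y in ?LJ. (\<integral>\<^sup>+ s. F (y(i := s)) * W s \<partial>lborel) \<noteq> \<infinity>"
    by (intro nn_integral_PInf_AE) auto
  then have zero: "AE y in ?LJ. (\<integral>\<^sup>+ s. F (y(i := s)) \<partial>lborel) = 0"
  proof (rule AE_mp, intro AE_I2 impI)
    fix y assume y: "y \<in> space ?LJ" and ne: "(\<integral>\<^sup>+ s. F (y(i := s)) * W s \<partial>lborel) \<noteq> \<infinity>"
    have "F (y(i := s)) = 0" for s
      using vanish[OF sp[OF y, of 0], of s] ne by (simp add: less_top)
    then show "(\<integral>\<^sup>+ s. F (y(i := s)) \<partial>lborel) = 0" by simp
  qed
  have "(\<integral>\<^sup>+ y. F y \<partial>L) = (\<integral>\<^sup>+ y. \<integral>\<^sup>+ s. F (y(i := s)) \<partial>lborel \<partial>?LJ)"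
    unfolding J(3) by (rule P.product_nn_integral_insert[OF J(1,2)]) (simp add: J(3)[symmetric])
  also have "\<dots> = (\<integral>\<^sup>+ y. 0 \<partial>?LJ)" by (rule nn_integral_cong_AE) (use zero in auto)
  finally show ?thesis by (simp add: nn_integral_0_iff_AE)
qed

lemma AE_pair_from_iterated:
  fixes G :: "_ \<Rightarrow> ennreal"
  assumes [measurable]: "G \<in> borel_measurable (L \<Otimes>\<^sub>M L)"
  shows "(AE x in L. AE y in L. G (x, y) = 0) \<Longrightarrow> AE z in L \<Otimes>\<^sub>M L. G z = 0"
    and "(AE y in L. AE x in L. G (x, y) = 0) \<Longrightarrow> AE z in L \<Otimes>\<^sub>M L. G z = 0"
proof -
  show 1: "AE z in L \<Otimes>\<^sub>M L. G z = 0" if "AE x in L. AE y in L. G (x, y) = 0"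
    by (rule PP.AE_pair_measure) (use that in auto)
  assume "AE y in L. AE x in L. G (x, y) = 0"
  then have "AE x in L. AE y in L. G (x, y) = 0"
    by (subst PP.AE_commute) auto
  then show "AE z in L \<Otimes>\<^sub>M L. G z = 0" by (rule 1)
qed

definition sub2 :: "('i \<Rightarrow> real) \<times> ('i \<Rightarrow> real) \<Rightarrow> ('i \<Rightarrow> real) \<times> ('i \<Rightarrow> real) \<Rightarrow> ('i \<Rightarrow> real) \<times> ('i \<Rightarrow> real)" where
  "sub2 v z = (sub (fst v) (fst z), sub (snd v) (snd z))"

lemma measurable_sub2 [measurable (raw)]:
  assumes [measurable]: "a \<in> M \<rightarrow>\<^sub>M L \<Otimes>\<^sub>M L" "b \<in> M \<rightarrow>\<^sub>M L \<Otimes>\<^sub>M L"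
  shows "(\<lambda>x. sub2 (a x) (b x)) \<in> M \<rightarrow>\<^sub>M L \<Otimes>\<^sub>M L"
  unfolding sub2_def by measurable

lemma nn_integral_sub2:
  assumes [measurable]: "G \<in> borel_measurable (L \<Otimes>\<^sub>M L)"
  shows "(\<integral>\<^sup>+ v. G (sub2 v z) \<partial>(L \<Otimes>\<^sub>M L)) = (\<integral>\<^sup>+ v. G v \<partial>(L \<Otimes>\<^sub>M L))"
proof -
  have "(\<integral>\<^sup>+ v. G (sub2 v z) \<partial>(L \<Otimes>\<^sub>M L)) = (\<integral>\<^sup>+ v. \<integral>\<^sup>+ w. G (sub v (fst z), sub w (snd z)) \<partial>L \<partial>L)"
    by (subst P.nn_integral_fst[symmetric]) (auto simp: sub2_def)
  also have "\<dots> = (\<integral>\<^sup>+ v. \<integral>\<^sup>+ w. G (sub v (fst z), w) \<partial>L \<partial>L)"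
    by (intro nn_integral_cong nn_integral_sub_right) measurable
  also have "\<dots> = (\<integral>\<^sup>+ v. \<integral>\<^sup>+ w. G (v, w) \<partial>L \<partial>L)"
    by (rule nn_integral_sub_right[where F = "\<lambda>v. \<integral>\<^sup>+ w. G (v, w) \<partial>L"]) measurable
  also have "\<dots> = (\<integral>\<^sup>+ v. G v \<partial>(L \<Otimes>\<^sub>M L))" by (rule P.nn_integral_fst) measurable
  finally show ?thesis .
qed

text \<open>
  Stated with reflected translates \<open>v - z\<close>, so that only translation invariance is needed and no linear change
  of variables.
\<close>

lemma nn_integral_convolution_square:
  assumes [measurable]: "G \<in> borel_measurable (L \<Otimes>\<^sub>M L)"
  shows "(\<integral>\<^sup>+ v. \<integral>\<^sup>+ z. G z * G (sub2 v z) \<partial>(L \<Otimes>\<^sub>M L) \<partial>(L \<Otimes>\<^sub>M L)) = (\<integral>\<^sup>+ z. G z \<partial>(L \<Otimes>\<^sub>M L))\<^sup>2"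
proof -
  interpret MM: pair_sigma_finite "L \<Otimes>\<^sub>M L" "L \<Otimes>\<^sub>M L" ..
  have "(\<integral>\<^sup>+ v. \<integral>\<^sup>+ z. G z * G (sub2 v z) \<partial>(L \<Otimes>\<^sub>M L) \<partial>(L \<Otimes>\<^sub>M L)) = (\<integral>\<^sup>+ z. \<integral>\<^sup>+ v. G z * G (sub2 v z) \<partial>(L \<Otimes>\<^sub>M L) \<partial>(L \<Otimes>\<^sub>M L))"
    by (rule MM.Fubini') measurable
  also have "\<dots> = (\<integral>\<^sup>+ z. G z * (\<integral>\<^sup>+ v. G v \<partial>(L \<Otimes>\<^sub>M L)) \<partial>(L \<Otimes>\<^sub>M L))"
  proof (rule nn_integral_cong)
    fix z assume "z \<in> space (L \<Otimes>\<^sub>M L)"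
    then have "(\<integral>\<^sup>+ v. G z * G (sub2 v z) \<partial>(L \<Otimes>\<^sub>M L)) = G z * (\<integral>\<^sup>+ v. G (sub2 v z) \<partial>(L \<Otimes>\<^sub>M L))"
      by (intro nn_integral_cmult) measurable
    then show "(\<integral>\<^sup>+ v. G z * G (sub2 v z) \<partial>(L \<Otimes>\<^sub>M L)) = G z * (\<integral>\<^sup>+ v. G v \<partial>(L \<Otimes>\<^sub>M L))"
      by (simp add: nn_integral_sub2)
  qed
  also have "\<dots> = (\<integral>\<^sup>+ z. G z \<partial>(L \<Otimes>\<^sub>M L))\<^sup>2" by (simp add: nn_integral_multc power2_eq_square)
  finally show ?thesis .
qed
end

context stft
begin

text \<open>
  Here the constant in the exponent doubles: by the midpoint inequality the weighted product is at most the product of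
  the two weighted factors, and the average of these products over \<open>v\<close> is finite.
\<close>

lemma VV_weighted_AE_finite:
  fixes a :: "real \<Rightarrow> real" and c :: "('i \<Rightarrow> real) \<times> ('i \<Rightarrow> real) \<Rightarrow> real"
  assumes [measurable]: "a \<in> borel_measurable borel" "c \<in> borel_measurable (L \<Otimes>\<^sub>M L)"
    and c_sub: "\<And>v z. c (sub2 v z) = c v - c z"
    and midpoint: "\<And>r s. 2 * a (r - s / 2) \<le> a r + a (s - r)"
    and fin: "(\<integral>\<^sup>+ z. ennreal (norm (V (fst z) (snd z)) * exp (pi * a (c z))) \<partial>(L \<Otimes>\<^sub>M L)) < \<infinity>"
  shows "AE v in L \<Otimes>\<^sub>M L. (\<integral>\<^sup>+ z. ennreal (norm (VV (fst v) (snd v) (fst z) (snd z)) * exp (2 * pi * a (c z - c v / 2))) \<partial>(L \<Otimes>\<^sub>M L)) < \<infinity>"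
proof -
  define G where "G z = ennreal (norm (V (fst z) (snd z)) * exp (pi * a (c z)))" for z
  have [measurable]: "G \<in> borel_measurable (L \<Otimes>\<^sub>M L)" unfolding G_def by measurable
  interpret M: sigma_finite_measure "L \<Otimes>\<^sub>M L" ..
  have "(\<lambda>v. \<integral>\<^sup>+ z. G z * G (sub2 v z) \<partial>(L \<Otimes>\<^sub>M L)) \<in> borel_measurable (L \<Otimes>\<^sub>M L)"
    by measurable
  moreover have "(\<integral>\<^sup>+ v. \<integral>\<^sup>+ z. G z * G (sub2 v z) \<partial>(L \<Otimes>\<^sub>M L) \<partial>(L \<Otimes>\<^sub>M L)) < \<infinity>"
    using fin unfolding nn_integral_convolution_square[OF \<open>G \<in> _\<close>] by (simp add: G_def[abs_def] power2_eq_square ennreal_mult_less_top)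
  ultimately have "AE v in L \<Otimes>\<^sub>M L. (\<integral>\<^sup>+ z. G z * G (sub2 v z) \<partial>(L \<Otimes>\<^sub>M L)) \<noteq> \<infinity>"
    by (intro nn_integral_PInf_AE) auto
  then show ?thesis
  proof eventually_elim
    case (elim v)
    have "ennreal (norm (VV (fst v) (snd v) (fst z) (snd z)) * exp (2 * pi * a (c z - c v / 2))) \<le> G z * G (sub2 v z)" for z
    proof -
      have "pi * (2 * a (c z - c v / 2)) \<le> pi * (a (c z) + a (c (sub2 v z)))"
        using midpoint by (intro mult_left_mono) (auto simp: c_sub)
      then have "exp (2 * pi * a (c z - c v / 2)) \<le> exp (pi * a (c z)) * exp (pi * a (c (sub2 v z)))"
        by (simp add: mult_exp_exp algebra_simps)
      then have "norm (VV (fst v) (snd v) (fst z) (snd z)) * exp (2 * pi * a (c z - c v / 2))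
         \<le> norm (VV (fst v) (snd v) (fst z) (snd z)) * (exp (pi * a (c z)) * exp (pi * a (c (sub2 v z))))"
        by (intro mult_left_mono) auto
      also have "\<dots> = (norm (V (fst z) (snd z)) * exp (pi * a (c z))) * (norm (V (fst (sub2 v z)) (snd (sub2 v z))) * exp (pi * a (c (sub2 v z))))"
        by (simp add: VV_def sub2_def norm_mult)
      finally show ?thesis unfolding G_def by (subst ennreal_mult[symmetric]) (auto intro!: ennreal_leI)
    qed
    then have "(\<integral>\<^sup>+ z. ennreal (norm (VV (fst v) (snd v) (fst z) (snd z)) * exp (2 * pi * a (c z - c v / 2))) \<partial>(L \<Otimes>\<^sub>M L)) \<le> (\<integral>\<^sup>+ z. G z * G (sub2 v z) \<partial>(L \<Otimes>\<^sub>M L))"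
      by (intro nn_integral_mono)
    then show ?case using elim by (simp add: less_top order_le_less_trans)
  qed
qed

end

section \<open>The uncertainty principle for the full transform\<close>

lemma fourier_laplace_shifted_eq_0:
  fixes K :: "'a \<Rightarrow> complex" and a b G :: "real \<Rightarrow> real"
  assumes "K \<in> borel_measurable M" "\<phi> \<in> borel_measurable M" 
      "a \<in> borel_measurable borel" "b \<in> borel_measurable borel" 
    and "\<And>r s. \<bar>r * s\<bar> \<le> a r + b s"
    and "\<And>r s. 0 \<le> r \<Longrightarrow> r \<le> s \<Longrightarrow> b r \<le> b s" and "\<And>r. b \<bar>r\<bar> = b r" 
    and "\<And>r. b r \<le> c * (1 + r\<^sup>2)" and "0 \<le> c"
    and "(\<integral>\<^sup>+ x. ennreal (norm (K x) * exp (2 * pi * a (\<phi> x))) \<partial>M) < \<infinity>"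
    and G: "\<And>r. norm (fourier_laplace M K \<phi> (of_real r)) = G (center + r)"
    and [measurable]: "G \<in> borel_measurable borel"
    and fin: "(\<integral>\<^sup>+ s. ennreal (G s * exp (2 * pi * b (s - center))) \<partial>lborel) < \<infinity>"
  shows "G s = 0"
proof -
  note [measurable] = assms(4)
  have "(\<integral>\<^sup>+ s. ennreal (G s * exp (2 * pi * b (s - center))) \<partial>lborel) = (\<integral>\<^sup>+ r. ennreal (G (center + r) * exp (2 * pi * b r)) \<partial>lborel)"
    by (subst nn_integral_real_affine[of _ 1 center]) auto
  then have "(\<integral>\<^sup>+ r. ennreal (norm (fourier_laplace M K \<phi> (of_real r)) * exp (2 * pi * b r)) \<partial>lborel) < \<infinity>"
    using fin by (simp add: G)
  from fourier_laplace_eq_0[OF assms(1-10) this] have "fourier_laplace M K \<phi> (of_real (s - center)) = 0" .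
  then show ?thesis using G[of "s - center"] by simp
qed

context stft
begin

lemma measurable_VV [measurable (raw)]:
  assumes [measurable]: "a \<in> M \<rightarrow>\<^sub>M L" "b \<in> M \<rightarrow>\<^sub>M L"
  shows "(\<lambda>z. VV v w (a z) (b z)) \<in> borel_measurable M"
  unfolding VV_def by measurable

lemma measurable_VV_const [measurable]: "VV v w x \<in> borel_measurable L"
proof -
  have "(\<lambda>\<omega>. V (sub v x) (sub w \<omega>)) \<in> borel_measurable L"
    by (rule measurable_compose[OF _ measurable_V_const]) measurable
  then show ?thesis unfolding VV_def[abs_def] by measurable
qed

text \<open>
  Replacing coordinate \<open>i\<close> of the frequency \<open>\<omega>'\<close> by \<open>w\<^sub>i/2 + r\<close> multiplies the exponential by a unimodular constant
  and by \<open>exp(2\<pi>i (x\<^sub>i - v\<^sub>i/2) r)\<close>. The shifts by half of \<open>v\<close> and \<open>w\<close> are those at which the doubled weights are centred.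
\<close>

lemma VV_laplace_frequency:
  assumes i: "i \<in> I" and V: "AE x in L. integrable L (V x)"
    and K: "integrable (L \<Otimes>\<^sub>M L) (\<lambda>(x, \<omega>). VV v w x \<omega>)"
  shows "norm (fourier_laplace (L \<Otimes>\<^sub>M L) 
      (\<lambda>z. VV v w (fst z) (snd z) * cis (- (2 * pi * (dot (snd z) (sub \<eta> (fst z)) + dot (fst z) (sub w (y(i := w i / 2)))))))
      (\<lambda>z. fst z i - v i / 2) (of_real r)) = norm (VV v w \<eta> (y(i := w i / 2 + r)))"
    (is "norm (fourier_laplace _ ?K ?\<phi> _) = _")
proof -
  have D: "dot x (sub w (y(i := w i / 2 + r))) = dot x (sub w (y(i := w i / 2))) - x i * r" for x
    unfolding dot_sub_right using dot_upd[OF i, of x y "w i / 2 + r" "w i / 2"] by simp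
  have "cis (- (2 * pi * (dot \<omega> (sub \<eta> x) + dot x (sub w (y(i := w i / 2 + r))))))
     = cis (2 * pi * (v i / 2) * r) * (cis (- (2 * pi * (dot \<omega> (sub \<eta> x) + dot x (sub w (y(i := w i / 2)))))) * cis (2 * pi * (x i - v i / 2) * r))" for x \<omega>
    unfolding cis_mult D by (intro arg_cong[of _ _ cis]) (simp add: algebra_simps)
  moreover have "cis (2 * pi * t * r) = exp (2 * of_real pi * \<i> * of_real t * of_real r)" for t
    by (simp add: cis_conv_exp mult_ac)
  ultimately have "(\<lambda>(x, \<omega>). VV v w x \<omega> * cis (- (2 * pi * (dot \<omega> (sub \<eta> x) + dot x (sub w (y(i := w i / 2 + r)))))))
    = (\<lambda>z. cis (2 * pi * (v i / 2) * r) * (?K z * exp (2 * of_real pi * \<i> * of_real (?\<phi> z) * of_real r)))"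
    by (auto simp: fun_eq_iff) 
  then have "(LINT (x, \<omega>)|(L \<Otimes>\<^sub>M L). VV v w x \<omega> * cis (- (2 * pi * (dot \<omega> (sub \<eta> x) + dot x (sub w (y(i := w i / 2 + r)))))))
    = cis (2 * pi * (v i / 2) * r) * fourier_laplace (L \<Otimes>\<^sub>M L) ?K ?\<phi> (of_real r)"
    unfolding fourier_laplace_def by simp
  with VV_fourier_invariance[OF V K, of \<eta> "y(i := w i / 2 + r)"] show ?thesis
    by (simp only: norm_mult norm_cis mult_1)
qed

text \<open>
  The same with the roles of time and frequency exchanged.
\<close>

lemma VV_laplace_time:
  assumes i: "i \<in> I" and V: "AE x in L. integrable L (V x)"
    and K: "integrable (L \<Otimes>\<^sub>M L) (\<lambda>(x, \<omega>). VV v w x \<omega>)"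
  shows "norm (fourier_laplace (L \<Otimes>\<^sub>M L) 
      (\<lambda>z. VV v w (fst z) (snd z) * cis (- (2 * pi * (dot (snd z) (sub (y(i := v i / 2)) (fst z)) + dot (fst z) (sub w \<omega>')))))
      (\<lambda>z. - (snd z i - w i / 2)) (of_real r)) = norm (VV v w (y(i := v i / 2 + r)) \<omega>')"
    (is "norm (fourier_laplace _ ?K ?\<phi> _) = _")
proof -
  have D: "dot \<omega> (sub (y(i := v i / 2 + r)) x) = dot \<omega> (sub (y(i := v i / 2)) x) + \<omega> i * r" for \<omega> x
    unfolding dot_sub_right using dot_upd[OF i, of \<omega> y "v i / 2 + r" "v i / 2"] by simp
  have "cis (- (2 * pi * (dot \<omega> (sub (y(i := v i / 2 + r)) x) + dot x (sub w \<omega>'))))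
     = cis (2 * pi * (- (w i / 2)) * r) * (cis (- (2 * pi * (dot \<omega> (sub (y(i := v i / 2)) x) + dot x (sub w \<omega>')))) * cis (2 * pi * (- (\<omega> i - w i / 2)) * r))" for x \<omega>
    unfolding cis_mult D by (intro arg_cong[of _ _ cis]) (simp add: algebra_simps)
  moreover have "cis (2 * pi * t * r) = exp (2 * of_real pi * \<i> * of_real t * of_real r)" for t
    by (simp add: cis_conv_exp mult_ac)
  ultimately have "(\<lambda>(x, \<omega>). VV v w x \<omega> * cis (- (2 * pi * (dot \<omega> (sub (y(i := v i / 2 + r)) x) + dot x (sub w \<omega>')))))
    = (\<lambda>z. cis (2 * pi * (- (w i / 2)) * r) * (?K z * exp (2 * of_real pi * \<i> * of_real (?\<phi> z) * of_real r)))"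
    by (auto simp: fun_eq_iff) 
  then have "(LINT (x, \<omega>)|(L \<Otimes>\<^sub>M L). VV v w x \<omega> * cis (- (2 * pi * (dot \<omega> (sub (y(i := v i / 2 + r)) x) + dot x (sub w \<omega>')))))
    = cis (2 * pi * (- (w i / 2)) * r) * fourier_laplace (L \<Otimes>\<^sub>M L) ?K ?\<phi> (of_real r)"
    unfolding fourier_laplace_def by simp
  with VV_fourier_invariance[OF V K, of "y(i := v i / 2 + r)" \<omega>'] show ?thesis
    by (simp only: norm_mult norm_cis mult_1)
qed

text \<open>
  Depending on which weight grows at most quadratically, the frequency or the time coordinate is varied along lines, the
  corresponding values of \<open>K\<close> being those of an entire function on the real axis.
\<close>

lemma VV_eq_0_AE:
  assumes w: "conjugate_weights a b" and i: "i \<in> I" and V: "AE x in L. integrable L (V x)"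
    and K: "integrable (L \<Otimes>\<^sub>M L) (\<lambda>(x, \<omega>). VV v w x \<omega>)"
    and fin_a: "(\<integral>\<^sup>+ z. ennreal (norm (VV v w (fst z) (snd z)) * exp (2 * pi * a (fst z i - v i / 2))) \<partial>(L \<Otimes>\<^sub>M L)) < \<infinity>"
    and fin_b: "(\<integral>\<^sup>+ z. ennreal (norm (VV v w (fst z) (snd z)) * exp (2 * pi * b (snd z i - w i / 2))) \<partial>(L \<Otimes>\<^sub>M L)) < \<infinity>"
  shows "AE z in L \<Otimes>\<^sub>M L. ennreal (norm (VV v w (fst z) (snd z))) = 0"
proof -
  interpret W: conjugate_weights a b by fact
  have upd: "y(i := s) \<in> space L" if "y \<in> space L" for y s
    using that i by (auto simp: space_PiM PiE_iff extensional_def)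
  have upd_meas: "(\<lambda>s. y(i := s)) \<in> borel \<rightarrow>\<^sub>M L" if "y \<in> space L" for y
  proof -
    have "(\<lambda>s. \<lambda>j\<in>I. if j = i then s else y j) \<in> borel \<rightarrow>\<^sub>M L"
      by (rule measurable_restrict) auto
    moreover have "(\<lambda>j\<in>I. if j = i then s else y j) = y(i := s)" for s
      using that i by (auto simp: space_PiM PiE_iff extensional_def)
    ultimately show ?thesis by simp
  qed
  \<comment> \<open>the bound by \<open>c\<close> decides which variable is made complex: it has to apply to the weight that bounds the growth\<close>
  obtain c where c: "0 \<le> c" "(\<forall>r. a r \<le> c * (1 + r\<^sup>2)) \<or> (\<forall>r. b r \<le> c * (1 + r\<^sup>2))" using W.growth by blast
  from c(2) show ?thesis
  proof
    assume gr: "\<forall>r. b r \<le> c * (1 + r\<^sup>2)"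
    show ?thesis
    proof (rule AE_pair_from_iterated(1))
      have "(\<integral>\<^sup>+ \<eta>. \<integral>\<^sup>+ \<omega>. ennreal (norm (VV v w \<eta> \<omega>) * exp (2 * pi * b (\<omega> i - w i / 2))) \<partial>L \<partial>L) < \<infinity>"
        using fin_b i by (subst (asm) P.nn_integral_fst[symmetric]) auto
      moreover have "(\<lambda>\<eta>. \<integral>\<^sup>+ \<omega>. ennreal (norm (VV v w \<eta> \<omega>) * exp (2 * pi * b (\<omega> i - w i / 2))) \<partial>L) \<in> borel_measurable L"
        using i by measurable
      ultimately have "AE \<eta> in L. (\<integral>\<^sup>+ \<omega>. ennreal (norm (VV v w \<eta> \<omega>) * exp (2 * pi * b (\<omega> i - w i / 2))) \<partial>L) \<noteq> \<infinity>"
        by (intro nn_integral_PInf_AE) auto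
      then show "AE \<eta> in L. AE \<omega> in L. ennreal (norm (VV v w (fst (\<eta>, \<omega>)) (snd (\<eta>, \<omega>)))) = 0"
      proof eventually_elim
        case (elim \<eta>)
        have "AE \<omega> in L. ennreal (norm (VV v w \<eta> \<omega>)) = 0"
        proof (rule coordinate_slices_vanish[OF i, where W = "\<lambda>s. ennreal (exp (2 * pi * b (s - w i / 2)))"])
          show "(\<integral>\<^sup>+ \<omega>. ennreal (norm (VV v w \<eta> \<omega>)) * ennreal (exp (2 * pi * b (\<omega> i - w i / 2))) \<partial>L) < \<infinity>"
            using elim by (simp add: ennreal_mult less_top)
          fix y s assume y: "y \<in> space L" 
            and fin: "(\<integral>\<^sup>+ s. ennreal (norm (VV v w \<eta> (y(i := s)))) * ennreal (exp (2 * pi * b (s - w i / 2))) \<partial>lborel) < \<infinity>"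
          have "norm (VV v w \<eta> (y(i := s))) = 0"
          proof (rule fourier_laplace_shifted_eq_0[where G = "\<lambda>s. norm (VV v w \<eta> (y(i := s)))" and center = "w i / 2", OF _ _ W.a_meas W.b_meas W.young W.b_mono W.b_abs _ \<open>0 \<le> c\<close> _ VV_laplace_frequency[OF i V K, of \<eta> y]])
            show "(\<lambda>s. norm (VV v w \<eta> (y(i := s)))) \<in> borel_measurable borel"
              by (rule measurable_compose[OF upd_meas[OF y]]) measurable
            show "(\<integral>\<^sup>+ s. ennreal (norm (VV v w \<eta> (y(i := s))) * exp (2 * pi * b (s - w i / 2))) \<partial>lborel) < \<infinity>"
              using fin by (simp add: ennreal_mult)
          qed (use gr fin_a i in \<open>auto simp: norm_mult\<close>)
          then show "ennreal (norm (VV v w \<eta> (y(i := s)))) = 0" by simp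
        qed measurable
        then show ?case by simp
      qed
    qed measurable
  next
    assume gr: "\<forall>r. a r \<le> c * (1 + r\<^sup>2)"
    show ?thesis
    proof (rule AE_pair_from_iterated(2))
      have "(\<integral>\<^sup>+ \<omega>. \<integral>\<^sup>+ x. ennreal (norm (VV v w x \<omega>) * exp (2 * pi * a (x i - v i / 2))) \<partial>L \<partial>L) < \<infinity>"
        using fin_a i by (subst (asm) PP.nn_integral_snd[symmetric]) auto
      moreover have "(\<lambda>\<omega>. \<integral>\<^sup>+ x. ennreal (norm (VV v w x \<omega>) * exp (2 * pi * a (x i - v i / 2))) \<partial>L) \<in> borel_measurable L"
        using i by measurable
      ultimately have "AE \<omega> in L. (\<integral>\<^sup>+ x. ennreal (norm (VV v w x \<omega>) * exp (2 * pi * a (x i - v i / 2))) \<partial>L) \<noteq> \<infinity>"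
        by (intro nn_integral_PInf_AE) auto
      from this AE_space show "AE \<omega> in L. AE x in L. ennreal (norm (VV v w (fst (x, \<omega>)) (snd (x, \<omega>)))) = 0"
      proof eventually_elim
        case (elim \<omega>')
        note ne = elim(1) and \<omega>' = elim(2)
        have [measurable]: "(\<lambda>x. VV v w x \<omega>') \<in> borel_measurable L" using \<omega>' by measurable
        have "AE x in L. ennreal (norm (VV v w x \<omega>')) = 0"
        proof (rule coordinate_slices_vanish[OF i, where W = "\<lambda>s. ennreal (exp (2 * pi * a (s - v i / 2)))"])
          show "(\<integral>\<^sup>+ x. ennreal (norm (VV v w x \<omega>')) * ennreal (exp (2 * pi * a (x i - v i / 2))) \<partial>L) < \<infinity>"
            using ne by (simp add: ennreal_mult less_top)
          fix y s assume y: "y \<in> space L" 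
            and fin: "(\<integral>\<^sup>+ s. ennreal (norm (VV v w (y(i := s)) \<omega>')) * ennreal (exp (2 * pi * a (s - v i / 2))) \<partial>lborel) < \<infinity>"
          have young': "\<bar>r * s\<bar> \<le> b r + a s" for r s using W.young[of s r] by (simp add: mult.commute add.commute)
          have b_minus: "b (- r) = b r" for r using W.b_abs[of r] W.b_abs[of "- r"] by simp
          have "norm (VV v w (y(i := s)) \<omega>') = 0"
          proof (rule fourier_laplace_shifted_eq_0[where G = "\<lambda>s. norm (VV v w (y(i := s)) \<omega>')" and center = "v i / 2", OF _ _ W.b_meas W.a_meas young' W.a_mono W.a_abs _ \<open>0 \<le> c\<close> _ VV_laplace_time[OF i V K, of y \<omega>']])
            show "(\<lambda>s. norm (VV v w (y(i := s)) \<omega>')) \<in> borel_measurable borel"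
              by (rule measurable_compose[OF upd_meas[OF y]]) measurable
            show "(\<integral>\<^sup>+ s. ennreal (norm (VV v w (y(i := s)) \<omega>') * exp (2 * pi * a (s - v i / 2))) \<partial>lborel) < \<infinity>"
              using fin by (simp add: ennreal_mult)
          qed (use gr fin_b i b_minus in \<open>auto simp: norm_mult simp del: minus_diff_eq\<close>)
          then show "ennreal (norm (VV v w (y(i := s)) \<omega>')) = 0" by simp
        qed measurable
        then show ?case by simp
      qed
    qed measurable
  qed
qed

text \<open>
  Vanishing of \<open>K\<close> for almost all \<open>(v, w)\<close> makes the square of the \<open>L\<^sup>1\<close> norm of \<open>V\<close> zero. Inversion then gives
  \<open>h x = 0\<close> for almost all \<open>x\<close>, and the double integral of \<open>|h x t|\<close> factors. The conclusion is a product of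
  integrals so that it can be integrated over further parameters.
\<close>

theorem stft_uncertainty:
  assumes w: "conjugate_weights a b" and i: "i \<in> I"
    and fin_a: "(\<integral>\<^sup>+ \<omega>. \<integral>\<^sup>+ x. ennreal (norm (V x \<omega>) * exp (pi * a (x i))) \<partial>L \<partial>L) < \<infinity>"
    and fin_b: "(\<integral>\<^sup>+ \<omega>. \<integral>\<^sup>+ x. ennreal (norm (V x \<omega>) * exp (pi * b (\<omega> i))) \<partial>L \<partial>L) < \<infinity>"
  shows "(\<integral>\<^sup>+ t. ennreal (norm (f t)) \<partial>L) * (\<integral>\<^sup>+ t. ennreal (norm (g t)) \<partial>L) = 0"
proof -
  interpret W: conjugate_weights a b by fact
  let ?M = "L \<Otimes>\<^sub>M L"
  interpret M: sigma_finite_measure ?M ..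
  have fin_a': "(\<integral>\<^sup>+ z. ennreal (norm (V (fst z) (snd z)) * exp (pi * a (fst z i))) \<partial>?M) < \<infinity>"
    using fin_a i by (subst PP.nn_integral_snd[symmetric]) auto
  have fin_b': "(\<integral>\<^sup>+ z. ennreal (norm (V (fst z) (snd z)) * exp (pi * b (snd z i))) \<partial>?M) < \<infinity>"
    using fin_b i by (subst PP.nn_integral_snd[symmetric]) auto
  have fin: "(\<integral>\<^sup>+ z. ennreal (norm (V (fst z) (snd z))) \<partial>?M) < \<infinity>"
  proof (rule order_le_less_trans[OF _ fin_a'], rule nn_integral_mono, rule ennreal_leI)
    fix z :: "('i \<Rightarrow> real) \<times> ('i \<Rightarrow> real)"
    have "1 \<le> exp (pi * a (fst z i))" using W.a_nonneg by simp
    then show "norm (V (fst z) (snd z)) \<le> norm (V (fst z) (snd z)) * exp (pi * a (fst z i))"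
      using mult_left_mono[of 1 "exp (pi * a (fst z i))" "norm (V (fst z) (snd z))"] by simp
  qed
  have V: "AE x in L. integrable L (V x)"
  proof -
    have "(\<integral>\<^sup>+ x. \<integral>\<^sup>+ \<omega>. ennreal (norm (V x \<omega>)) \<partial>L \<partial>L) < \<infinity>"
      using fin by (subst (asm) P.nn_integral_fst[symmetric]) auto
    moreover have "(\<lambda>x. \<integral>\<^sup>+ \<omega>. ennreal (norm (V x \<omega>)) \<partial>L) \<in> borel_measurable L" by measurable
    ultimately have "AE x in L. (\<integral>\<^sup>+ \<omega>. ennreal (norm (V x \<omega>)) \<partial>L) \<noteq> \<infinity>"
      by (intro nn_integral_PInf_AE) auto
    then show ?thesis by eventually_elim (auto intro!: integrableI_bounded simp: less_top)
  qed
  have "AE v in ?M. (\<integral>\<^sup>+ z. ennreal (norm (VV (fst v) (snd v) (fst z) (snd z)) * exp (2 * pi * a (fst z i - fst v i / 2))) \<partial>?M) < \<infinity>"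
    by (rule VV_weighted_AE_finite[where c = "\<lambda>z. fst z i"]) (use i W.a_midpoint fin_a' in \<open>auto simp: sub2_def sub_def\<close>)
  moreover have "AE v in ?M. (\<integral>\<^sup>+ z. ennreal (norm (VV (fst v) (snd v) (fst z) (snd z)) * exp (2 * pi * b (snd z i - snd v i / 2))) \<partial>?M) < \<infinity>"
    by (rule VV_weighted_AE_finite[where c = "\<lambda>z. snd z i"]) (use i W.b_midpoint fin_b' in \<open>auto simp: sub2_def sub_def\<close>)
  ultimately have zero: "AE v in ?M. (\<integral>\<^sup>+ z. ennreal (norm (VV (fst v) (snd v) (fst z) (snd z))) \<partial>?M) = 0"
  proof eventually_elim
    case (elim v)
    have meas: "(\<lambda>z. VV (fst v) (snd v) (fst z) (snd z)) \<in> borel_measurable ?M" by measurable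
    have "(\<integral>\<^sup>+ z. ennreal (norm (VV (fst v) (snd v) (fst z) (snd z))) \<partial>?M) < \<infinity>"
    proof (rule order_le_less_trans[OF _ elim(1)], rule nn_integral_mono, rule ennreal_leI)
      fix z :: "('i \<Rightarrow> real) \<times> ('i \<Rightarrow> real)"
      have "1 \<le> exp (2 * pi * a (fst z i - fst v i / 2))" using W.a_nonneg by simp
      then show "norm (VV (fst v) (snd v) (fst z) (snd z)) \<le> norm (VV (fst v) (snd v) (fst z) (snd z)) * exp (2 * pi * a (fst z i - fst v i / 2))"
        using mult_left_mono[of 1 "exp (2 * pi * a (fst z i - fst v i / 2))" "norm (VV (fst v) (snd v) (fst z) (snd z))"] by simp
    qed
    then have "integrable ?M (\<lambda>(x, \<omega>). VV (fst v) (snd v) x \<omega>)"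
      using meas by (intro integrableI_bounded) (auto simp: case_prod_unfold)
    from VV_eq_0_AE[OF w i V this elim] show ?case
      using meas by (subst nn_integral_0_iff_AE) auto
  qed
  \<comment> \<open>the average over \<open>(v, w)\<close> of the \<open>L\<^sup>1\<close> norm of \<open>K\<close> is the square of the \<open>L\<^sup>1\<close> norm of \<open>V\<close>\<close>
  define G where "G z = ennreal (norm (V (fst z) (snd z)))" for z
  have [measurable]: "G \<in> borel_measurable ?M" unfolding G_def by measurable
  have "(\<integral>\<^sup>+ z. G z \<partial>?M)\<^sup>2 = (\<integral>\<^sup>+ v. \<integral>\<^sup>+ z. G z * G (sub2 v z) \<partial>?M \<partial>?M)"
    by (rule nn_integral_convolution_square[symmetric]) measurable
  also have "\<dots> = (\<integral>\<^sup>+ v. 0 \<partial>?M)"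
    by (rule nn_integral_cong_AE) (use zero in \<open>auto simp: G_def VV_def sub2_def norm_mult ennreal_mult\<close>)
  finally have "(\<integral>\<^sup>+ z. G z \<partial>?M) = 0" by simp
  then have "AE z in ?M. G z = 0" by (simp add: nn_integral_0_iff_AE)
  then have "AE x in L. AE \<omega> in L. V x \<omega> = 0"
    using PP.AE_pair[of "\<lambda>z. G z = 0"] by (simp add: G_def)
  with V have h0: "AE x in L. AE t in L. h x t = 0"
  proof eventually_elim
    case (elim x)
    have "inverse_fourier (V x) t = 0" for t
    proof -
      have "inverse_fourier (V x) t = (LINT \<omega>|L. 0)"
        unfolding inverse_fourier_def by (rule integral_cong_AE) (use elim(2) in auto)
      then show ?thesis by simp
    qed
    with fourier_inversion[OF h_integrable[of x]] elim(1) show ?case by (simp add: V_def)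
  qed
  have "(\<integral>\<^sup>+ x. \<integral>\<^sup>+ t. ennreal (norm (h x t)) \<partial>L \<partial>L) = (\<integral>\<^sup>+ x. 0 \<partial>L)"
    by (rule nn_integral_cong_AE) (use h0 in \<open>auto simp: nn_integral_0_iff_AE elim!: AE_mp\<close>)
  then have "(\<integral>\<^sup>+ t. \<integral>\<^sup>+ x. ennreal (norm (h x t)) \<partial>L \<partial>L) = 0"
    by (subst PP.Fubini') auto
  moreover have "(\<integral>\<^sup>+ t. \<integral>\<^sup>+ x. ennreal (norm (h x t)) \<partial>L \<partial>L) = (\<integral>\<^sup>+ t. ennreal (norm (f t)) * (\<integral>\<^sup>+ x. ennreal (norm (g x)) \<partial>L) \<partial>L)"
  proof (rule nn_integral_cong)
    fix t
    have "(\<integral>\<^sup>+ x. ennreal (norm (h x t)) \<partial>L) = (\<integral>\<^sup>+ x. ennreal (norm (f t)) * ennreal (norm (g (sub t x))) \<partial>L)"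
      by (simp add: h_def norm_mult ennreal_mult)
    also have "\<dots> = ennreal (norm (f t)) * (\<integral>\<^sup>+ x. ennreal (norm (g (sub t x))) \<partial>L)"
      by (rule nn_integral_cmult) measurable
    also have "(\<integral>\<^sup>+ x. ennreal (norm (g (sub t x))) \<partial>L) = (\<integral>\<^sup>+ x. ennreal (norm (g x)) \<partial>L)"
      by (rule nn_integral_sub_left[where F = "\<lambda>x. ennreal (norm (g x))"]) measurable
    finally show "(\<integral>\<^sup>+ x. ennreal (norm (h x t)) \<partial>L) = ennreal (norm (f t)) * (\<integral>\<^sup>+ x. ennreal (norm (g x)) \<partial>L)" .
  qed
  ultimately show ?thesis by (simp add: nn_integral_multc)
qed
end

section \<open>Power weights, and splitting the coordinates\<close>

lemma powr_midpoint_le: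
  fixes x y p :: real
  assumes "1 < p" "0 \<le> x" "0 \<le> y"
  shows "2 * ((x + y) / 2) powr p \<le> x powr p + y powr p"
proof (cases "x = 0 \<or> y = 0")
  case True
  have "2 * (z / 2) powr p \<le> z powr p" if "0 \<le> z" for z :: real
  proof -
    have "2 * (1 / 2) powr p \<le> 2 * (1 / 2 :: real) powr 1"
      using assms(1) by (intro mult_left_mono powr_mono') auto
    then have "2 * (1 / 2) powr p \<le> (1 :: real)" by simp
    then have "2 * (1 / 2) powr p * z powr p \<le> 1 * z powr p" by (intro mult_right_mono) auto
    moreover have "(z / 2) powr p = (1 / 2) powr p * z powr p" using that powr_mult[of "1 / 2" z p] by simp
    ultimately show ?thesis by simp
  qed
  from this[of x] this[of y] True assms show ?thesis by auto
next
  case False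
  then have "x \<in> {0<..}" "y \<in> {0<..}" using assms by auto
  from convex_onD[OF powr_convex, of p "1 / 2" x y] this assms
  show ?thesis by (simp add: field_simps)
qed

text \<open>
  Of two conjugate exponents one is at most 2, and that one provides the quadratic growth.
\<close>

lemma conjugate_weights_powr:
  fixes p q \<alpha> \<beta> :: real
  assumes p: "1 < p" and pq: "1 / p + 1 / q = 1" and "\<alpha> > 0" and "\<beta> > 0" and \<alpha>\<beta>: "\<alpha> * \<beta> \<ge> 1"
  shows "conjugate_weights (\<lambda>r. \<alpha> powr p * \<bar>r\<bar> powr p / p) (\<lambda>r. \<beta> powr q * \<bar>r\<bar> powr q / q)"
proof -
  have "0 < 1 / p" "1 / p < 1" using p by auto
  then have "0 < 1 / q" "1 / q < 1" using pq by linarith+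
  then have q: "1 < q" by (simp add: field_simps split: if_splits) 
  have mono: "\<gamma> powr e * \<bar>r\<bar> powr e / e \<le> \<gamma> powr e * \<bar>s\<bar> powr e / e" if "0 \<le> r" "r \<le> s" "1 < e" for \<gamma> e r s :: real
    using that by (intro divide_right_mono mult_left_mono powr_mono2) auto
  have midpoint: "2 * (\<gamma> powr e * \<bar>r - s / 2\<bar> powr e / e) \<le> \<gamma> powr e * \<bar>r\<bar> powr e / e + \<gamma> powr e * \<bar>s - r\<bar> powr e / e" 
    if "1 < e" for \<gamma> e r s :: real
  proof -
    have "\<bar>r - s / 2\<bar> \<le> (\<bar>r\<bar> + \<bar>s - r\<bar>) / 2" by (simp add: abs_if split: if_splits)
    then have "\<bar>r - s / 2\<bar> powr e \<le> ((\<bar>r\<bar> + \<bar>s - r\<bar>) / 2) powr e" using that by (intro powr_mono2) auto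
    with powr_midpoint_le[OF that, of "\<bar>r\<bar>" "\<bar>s - r\<bar>"]
    have "2 * \<bar>r - s / 2\<bar> powr e \<le> \<bar>r\<bar> powr e + \<bar>s - r\<bar> powr e" by simp
    then have "\<gamma> powr e / e * (2 * \<bar>r - s / 2\<bar> powr e) \<le> \<gamma> powr e / e * (\<bar>r\<bar> powr e + \<bar>s - r\<bar> powr e)"
      using that by (intro mult_left_mono) auto
    then show ?thesis by (simp add: algebra_simps add_divide_distrib)
  qed
  have growth: "\<exists>c\<ge>0. \<forall>r. \<gamma> powr e * \<bar>r\<bar> powr e / e \<le> c * (1 + r\<^sup>2)" if "1 < e" "e \<le> 2" for \<gamma> e :: real
  proof (intro exI conjI allI)
    show "0 \<le> \<gamma> powr e / e" using that by simp
    fix r :: real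
    have "\<bar>r\<bar> powr e \<le> 1 + r\<^sup>2"
    proof (cases "\<bar>r\<bar> \<le> 1")
      case True
      then have "\<bar>r\<bar> powr e \<le> 1" using that by (intro powr_le1) auto
      then show ?thesis by (simp add: add_increasing2)
    next
      case False
      then have "\<bar>r\<bar> powr e \<le> \<bar>r\<bar> powr 2" using that by (intro powr_mono) auto
      then show ?thesis using False by simp
    qed
    then have "\<gamma> powr e / e * \<bar>r\<bar> powr e \<le> \<gamma> powr e / e * (1 + r\<^sup>2)" using that by (intro mult_left_mono) auto
    then show "\<gamma> powr e * \<bar>r\<bar> powr e / e \<le> \<gamma> powr e / e * (1 + r\<^sup>2)" by simp
  qed
  have pq2: "p \<le> 2 \<or> q \<le> 2"
  proof (rule ccontr)
    assume "\<not> ?thesis"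
    then have "1 / p < 1 / 2" "1 / q < 1 / 2" by (auto intro!: divide_strict_left_mono)
    then show False using pq by linarith
  qed
  show ?thesis
  proof
    fix r s :: real
    have "\<bar>r * s\<bar> \<le> (\<alpha> * \<beta>) * \<bar>r * s\<bar>" using \<alpha>\<beta> mult_right_mono[of 1 "\<alpha> * \<beta>" "\<bar>r * s\<bar>"] by simp
    also have "\<dots> = (\<alpha> * \<bar>r\<bar>) * (\<beta> * \<bar>s\<bar>)" by (simp add: abs_mult)
    also have "\<dots> \<le> (\<alpha> * \<bar>r\<bar>) powr p / p + (\<beta> * \<bar>s\<bar>) powr q / q"
      using assms q by (intro Youngs_inequality) auto
    finally show "\<bar>r * s\<bar> \<le> \<alpha> powr p * \<bar>r\<bar> powr p / p + \<beta> powr q * \<bar>s\<bar> powr q / q"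
      using assms by (simp add: powr_mult)
  next
    show "\<exists>c\<ge>0. (\<forall>r. \<alpha> powr p * \<bar>r\<bar> powr p / p \<le> c * (1 + r\<^sup>2)) \<or> (\<forall>r. \<beta> powr q * \<bar>r\<bar> powr q / q \<le> c * (1 + r\<^sup>2))"
      using pq2 growth[OF p, of \<alpha>] growth[OF q, of \<beta>] by blast
  qed (use p q mono midpoint in auto)
qed

text \<open>
  The decomposition of \<open>\<real>\<^sup>d\<close> into \<open>\<real>\<^sup>k\<close> and \<open>\<real>\<^sup>d\<^sup>-\<^sup>k\<close>, for arbitrary disjoint sets of coordinates.
\<close>

locale coordinate_split =
  CI: coordinate_space I + CJ: coordinate_space J for I J :: "'i set" +
  assumes disjoint: "I \<inter> J = {}"
begin

sublocale T: coordinate_space "I \<union> J" by standard simp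
sublocale IJ: pair_sigma_finite CI.L CJ.L ..
sublocale JI: pair_sigma_finite CJ.L CI.L ..

lemma measurable_merge_split [measurable (raw)]:
  assumes [measurable]: "a \<in> M \<rightarrow>\<^sub>M CI.L" "b \<in> M \<rightarrow>\<^sub>M CJ.L"
  shows "(\<lambda>x. merge I J (a x, b x)) \<in> M \<rightarrow>\<^sub>M T.L"
  by (rule measurable_compose[OF measurable_Pair[OF assms] measurable_merge])

lemma nn_integral_split:
  assumes [measurable]: "F \<in> borel_measurable T.L"
  shows "(\<integral>\<^sup>+ z. F z \<partial>T.L) = (\<integral>\<^sup>+ y. \<integral>\<^sup>+ t. F (merge I J (t, y)) \<partial>CI.L \<partial>CJ.L)"
proof -
  have "(\<integral>\<^sup>+ z. F z \<partial>T.L) = (\<integral>\<^sup>+ t. \<integral>\<^sup>+ y. F (merge I J (t, y)) \<partial>CJ.L \<partial>CI.L)"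
    by (rule CI.P.product_nn_integral_fold[OF disjoint]) auto
  also have "\<dots> = (\<integral>\<^sup>+ y. \<integral>\<^sup>+ t. F (merge I J (t, y)) \<partial>CI.L \<partial>CJ.L)"
    by (rule JI.Fubini') measurable
  finally show ?thesis .
qed

lemma AE_split:
  assumes "AE z in T.L. Q z"
  shows "AE y in CJ.L. AE t in CI.L. Q (merge I J (t, y))"
proof -
  obtain N where N: "N \<in> sets T.L" "{z \<in> space T.L. \<not> Q z} \<subseteq> N" "emeasure T.L N = 0"
    using AE_E[OF assms] by blast
  note [measurable] = N(1)
  have "(\<integral>\<^sup>+ y. \<integral>\<^sup>+ t. indicator N (merge I J (t, y)) \<partial>CI.L \<partial>CJ.L) = 0"
    using nn_integral_split[of "indicator N"] N by simp
  moreover have "(\<lambda>y. \<integral>\<^sup>+ t. indicator N (merge I J (t, y)) \<partial>CI.L) \<in> borel_measurable CJ.L" by measurable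
  ultimately have "AE y in CJ.L. (\<integral>\<^sup>+ t. indicator N (merge I J (t, y)) \<partial>CI.L) = 0"
    by (subst (asm) nn_integral_0_iff_AE) auto
  from this AE_space show ?thesis
  proof eventually_elim
    case (elim y)
    note [measurable] = elim(2)
    have "(\<lambda>t. indicator N (merge I J (t, y)) :: ennreal) \<in> borel_measurable CI.L" by measurable
    with elim(1) have "AE t in CI.L. (indicator N (merge I J (t, y)) :: ennreal) = 0"
      by (subst (asm) nn_integral_0_iff_AE) auto
    from this AE_space show ?case
    proof eventually_elim
      case (elim t)
      have "merge I J (t, y) \<in> space T.L"
        using measurable_space[OF measurable_merge, of "(t, y)" I "\<lambda>_. lborel" J] elim(2) \<open>y \<in> space CJ.L\<close>
        by (simp add: space_pair_measure)
      with elim(1) N(2) show ?case by (auto simp: indicator_eq_0_iff)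
    qed
  qed
qed

lemma AE_restrict_snd:
  assumes "AE y in CJ.L. Q y"
  shows "AE z in T.L. Q (restrict z J)"
proof -
  obtain N where N: "N \<in> sets CJ.L" "{y \<in> space CJ.L. \<not> Q y} \<subseteq> N" "emeasure CJ.L N = 0"
    using AE_E[OF assms] by blast
  note [measurable] = N(1)
  have restr [measurable]: "(\<lambda>z. restrict z J) \<in> T.L \<rightarrow>\<^sub>M CJ.L" by (rule measurable_restrict_subset) auto
  have "(\<integral>\<^sup>+ z. indicator N (restrict z J) \<partial>T.L) = (\<integral>\<^sup>+ y. \<integral>\<^sup>+ t. indicator N (restrict (merge I J (t, y)) J) \<partial>CI.L \<partial>CJ.L)"
    by (rule nn_integral_split) measurable
  also have "\<dots> = (\<integral>\<^sup>+ y. \<integral>\<^sup>+ t. indicator N y \<partial>CI.L \<partial>CJ.L)"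
    using disjoint by (intro nn_integral_cong) (simp add: space_PiM PiE_iff extensional_restrict)
  also have "\<dots> = (\<integral>\<^sup>+ y. 0 \<partial>CJ.L)"
  proof (rule nn_integral_cong_AE)
    have "AE y in CJ.L. y \<notin> N" using N by (intro AE_not_in) (auto simp: null_sets_def)
    then show "AE y in CJ.L. (\<integral>\<^sup>+ t. indicator N y \<partial>CI.L) = 0" by eventually_elim simp
  qed
  finally have "(\<integral>\<^sup>+ z. indicator N (restrict z J) \<partial>T.L) = 0" by simp
  then have "AE z in T.L. (indicator N (restrict z J) :: ennreal) = 0"
    by (subst (asm) nn_integral_0_iff_AE) auto
  from this AE_space show ?thesis
  proof eventually_elim
    case (elim z)
    have "restrict z J \<in> space CJ.L" by (rule measurable_space[OF restr elim(2)])
    with elim(1) N(2) show ?case by (auto simp: indicator_eq_0_iff)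
  qed
qed

section \<open>The partial transform for Borel functions\<close>

lemma restrict_merge_space:
  assumes "t \<in> space CI.L" "y \<in> space CJ.L"
  shows "restrict (merge I J (t, y)) I = t" "restrict (merge I J (t, y)) J = y"
  using assms disjoint by (simp_all add: space_PiM PiE_iff extensional_restrict)

lemma measurable_restrict_split [measurable]:
  "(\<lambda>z. restrict z I) \<in> T.L \<rightarrow>\<^sub>M CI.L" "(\<lambda>z. restrict z J) \<in> T.L \<rightarrow>\<^sub>M CJ.L"
  by (rule measurable_restrict_subset, auto)+

lemma nn_integral_split_pair:
  fixes R :: "_ \<Rightarrow> ennreal"
  assumes [measurable]: "R \<in> borel_measurable ((CI.L \<Otimes>\<^sub>M CI.L) \<Otimes>\<^sub>M (CJ.L \<Otimes>\<^sub>M CJ.L))"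
  shows "(\<integral>\<^sup>+ \<omega>. \<integral>\<^sup>+ x. R ((restrict x I, restrict \<omega> I), (restrict x J, restrict \<omega> J)) \<partial>T.L \<partial>T.L)
       = (\<integral>\<^sup>+ y'. \<integral>\<^sup>+ y. \<integral>\<^sup>+ \<omega>. \<integral>\<^sup>+ x. R ((x, \<omega>), (y, y')) \<partial>CI.L \<partial>CI.L \<partial>CJ.L \<partial>CJ.L)"
proof -
  have "(\<integral>\<^sup>+ \<omega>. \<integral>\<^sup>+ x. R ((restrict x I, restrict \<omega> I), (restrict x J, restrict \<omega> J)) \<partial>T.L \<partial>T.L)
     = (\<integral>\<^sup>+ y'. \<integral>\<^sup>+ \<omega>. \<integral>\<^sup>+ x. R ((restrict x I, restrict (merge I J (\<omega>, y')) I), (restrict x J, restrict (merge I J (\<omega>, y')) J)) \<partial>T.L \<partial>CI.L \<partial>CJ.L)"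
    by (rule nn_integral_split) measurable
  also have "\<dots> = (\<integral>\<^sup>+ y'. \<integral>\<^sup>+ \<omega>. \<integral>\<^sup>+ y. \<integral>\<^sup>+ x. R ((x, \<omega>), (y, y')) \<partial>CI.L \<partial>CJ.L \<partial>CI.L \<partial>CJ.L)"
  proof (intro nn_integral_cong)
    fix y' \<omega> assume sp [measurable]: "y' \<in> space CJ.L" "\<omega> \<in> space CI.L"
    have "(\<integral>\<^sup>+ x. R ((restrict x I, restrict (merge I J (\<omega>, y')) I), (restrict x J, restrict (merge I J (\<omega>, y')) J)) \<partial>T.L)
       = (\<integral>\<^sup>+ x. R ((restrict x I, \<omega>), (restrict x J, y')) \<partial>T.L)"
      by (simp add: restrict_merge_space[OF sp(2,1)])
    also have "\<dots> = (\<integral>\<^sup>+ y. \<integral>\<^sup>+ x. R ((restrict (merge I J (x, y)) I, \<omega>), (restrict (merge I J (x, y)) J, y')) \<partial>CI.L \<partial>CJ.L)"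
      by (rule nn_integral_split) measurable
    also have "\<dots> = (\<integral>\<^sup>+ y. \<integral>\<^sup>+ x. R ((x, \<omega>), (y, y')) \<partial>CI.L \<partial>CJ.L)"
      by (intro nn_integral_cong) (simp add: restrict_merge_space)
    finally show "(\<integral>\<^sup>+ x. R ((restrict x I, restrict (merge I J (\<omega>, y')) I), (restrict x J, restrict (merge I J (\<omega>, y')) J)) \<partial>T.L)
       = (\<integral>\<^sup>+ y. \<integral>\<^sup>+ x. R ((x, \<omega>), (y, y')) \<partial>CI.L \<partial>CJ.L)" .
  qed
  also have "\<dots> = (\<integral>\<^sup>+ y'. \<integral>\<^sup>+ y. \<integral>\<^sup>+ \<omega>. \<integral>\<^sup>+ x. R ((x, \<omega>), (y, y')) \<partial>CI.L \<partial>CI.L \<partial>CJ.L \<partial>CJ.L)"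
  proof (intro nn_integral_cong)
    fix y' assume [measurable]: "y' \<in> space CJ.L"
    show "(\<integral>\<^sup>+ \<omega>. \<integral>\<^sup>+ y. \<integral>\<^sup>+ x. R ((x, \<omega>), (y, y')) \<partial>CI.L \<partial>CJ.L \<partial>CI.L) = (\<integral>\<^sup>+ y. \<integral>\<^sup>+ \<omega>. \<integral>\<^sup>+ x. R ((x, \<omega>), (y, y')) \<partial>CI.L \<partial>CI.L \<partial>CJ.L)"
      by (rule JI.Fubini') measurable
  qed
  finally show ?thesis .
qed

lemma AE_split_pair_finite:
  fixes R :: "_ \<Rightarrow> ennreal"
  assumes [measurable]: "R \<in> borel_measurable ((CI.L \<Otimes>\<^sub>M CI.L) \<Otimes>\<^sub>M (CJ.L \<Otimes>\<^sub>M CJ.L))"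
    and fin: "(\<integral>\<^sup>+ \<omega>. \<integral>\<^sup>+ x. R ((restrict x I, restrict \<omega> I), (restrict x J, restrict \<omega> J)) \<partial>T.L \<partial>T.L) < \<infinity>"
  shows "AE y' in CJ.L. AE y in CJ.L. (\<integral>\<^sup>+ \<omega>. \<integral>\<^sup>+ x. R ((x, \<omega>), (y, y')) \<partial>CI.L \<partial>CI.L) < \<infinity>"
proof -
  have "(\<lambda>y'. \<integral>\<^sup>+ y. \<integral>\<^sup>+ \<omega>. \<integral>\<^sup>+ x. R ((x, \<omega>), (y, y')) \<partial>CI.L \<partial>CI.L \<partial>CJ.L) \<in> borel_measurable CJ.L" by measurable
  with fin have "AE y' in CJ.L. (\<integral>\<^sup>+ y. \<integral>\<^sup>+ \<omega>. \<integral>\<^sup>+ x. R ((x, \<omega>), (y, y')) \<partial>CI.L \<partial>CI.L \<partial>CJ.L) \<noteq> \<infinity>"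
    unfolding nn_integral_split_pair[OF assms(1)] by (intro nn_integral_PInf_AE) auto
  from this AE_space show ?thesis
  proof eventually_elim
    case (elim y')
    note [measurable] = elim(2)
    have "(\<lambda>y. \<integral>\<^sup>+ \<omega>. \<integral>\<^sup>+ x. R ((x, \<omega>), (y, y')) \<partial>CI.L \<partial>CI.L) \<in> borel_measurable CJ.L" by measurable
    from nn_integral_PInf_AE[OF this elim(1)] show ?case by eventually_elim (simp add: less_top)
  qed
qed

end

locale split_stft = coordinate_split I J for I J :: "'i set" +
  fixes f g :: "('i \<Rightarrow> real) \<Rightarrow> complex"
  assumes f_meas [measurable]: "f \<in> borel_measurable T.L" and g_meas [measurable]: "g \<in> borel_measurable T.L"
    and f_int: "(\<integral>\<^sup>+ z. ennreal ((norm (f z))\<^sup>2) \<partial>T.L) < \<infinity>" and g_int: "(\<integral>\<^sup>+ z. ennreal ((norm (g z))\<^sup>2) \<partial>T.L) < \<infinity>"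
begin

definition F :: "('i \<Rightarrow> real) \<Rightarrow> ('i \<Rightarrow> real) \<Rightarrow> complex" where
  "F y t = f (merge I J (t, y))"

definition G :: "('i \<Rightarrow> real) \<Rightarrow> ('i \<Rightarrow> real) \<Rightarrow> complex" where
  "G y t = g (merge I J (t, CJ.sub (\<lambda>_. 0) y))"

text \<open>
  The partial transform as a function of \<open>((x\<^sub>1, \<omega>\<^sub>1), (x\<^sub>2, \<omega>\<^sub>2))\<close>.
\<close>

definition PV :: "(('i \<Rightarrow> real) \<times> ('i \<Rightarrow> real)) \<times> (('i \<Rightarrow> real) \<times> ('i \<Rightarrow> real)) \<Rightarrow> complex" where
  "PV r = (LINT t|CI.L. F (fst (snd r)) t * cnj (G (snd (snd r)) (CI.sub t (fst (fst r)))) * cis (- (2 * pi * CI.dot t (snd (fst r)))))"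

lemma measurable_F [measurable (raw)]:
  assumes [measurable]: "a \<in> M \<rightarrow>\<^sub>M CJ.L" "b \<in> M \<rightarrow>\<^sub>M CI.L"
  shows "(\<lambda>x. F (a x) (b x)) \<in> borel_measurable M"
  unfolding F_def by measurable

lemma measurable_G [measurable (raw)]:
  assumes [measurable]: "a \<in> M \<rightarrow>\<^sub>M CJ.L" "b \<in> M \<rightarrow>\<^sub>M CI.L"
  shows "(\<lambda>x. G (a x) (b x)) \<in> borel_measurable M"
  unfolding G_def by measurable

lemma measurable_PV [measurable]: "PV \<in> borel_measurable ((CI.L \<Otimes>\<^sub>M CI.L) \<Otimes>\<^sub>M (CJ.L \<Otimes>\<^sub>M CJ.L))"
  unfolding PV_def by measurable

lemma AE_slice_square_integrable:
  assumes [measurable]: "u \<in> borel_measurable T.L" and "(\<integral>\<^sup>+ z. ennreal ((norm (u z))\<^sup>2) \<partial>T.L) < \<infinity>"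
  shows "AE y in CJ.L. integrable CI.L (\<lambda>t. (norm (u (merge I J (t, y)) :: complex))\<^sup>2)"
proof -
  have "(\<integral>\<^sup>+ y. \<integral>\<^sup>+ t. ennreal ((norm (u (merge I J (t, y))))\<^sup>2) \<partial>CI.L \<partial>CJ.L) < \<infinity>"
    using assms(2) by (subst (asm) nn_integral_split) auto
  moreover have "(\<lambda>y. \<integral>\<^sup>+ t. ennreal ((norm (u (merge I J (t, y))))\<^sup>2) \<partial>CI.L) \<in> borel_measurable CJ.L" by measurable
  ultimately have "AE y in CJ.L. (\<integral>\<^sup>+ t. ennreal ((norm (u (merge I J (t, y))))\<^sup>2) \<partial>CI.L) \<noteq> \<infinity>"
    by (intro nn_integral_PInf_AE) auto
  from this AE_space show ?thesis
  proof eventually_elim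
    case (elim y)
    note [measurable] = elim(2)
    show ?case using elim(1) by (intro integrableI_nonneg) (auto simp: less_top)
  qed
qed

text \<open>
  For almost every \<open>(x\<^sub>2, \<omega>\<^sub>2)\<close> the partial transform is the full transform of two square integrable slices and inherits the
  weighted bounds. The reflection in \<open>\<omega>\<^sub>2\<close> disappears when the \<open>L\<^sup>1\<close> norms of the slices of \<open>g\<close> are integrated.
\<close>

theorem split_stft_uncertainty:
  assumes w: "conjugate_weights a b" and i: "i \<in> I"
    and fin_a: "(\<integral>\<^sup>+ \<omega>. \<integral>\<^sup>+ x. ennreal (norm (PV ((restrict x I, restrict \<omega> I), (restrict x J, restrict \<omega> J))) * exp (pi * a (x i))) \<partial>T.L \<partial>T.L) < \<infinity>"
    and fin_b: "(\<integral>\<^sup>+ \<omega>. \<integral>\<^sup>+ x. ennreal (norm (PV ((restrict x I, restrict \<omega> I), (restrict x J, restrict \<omega> J))) * exp (pi * b (\<omega> i))) \<partial>T.L \<partial>T.L) < \<infinity>"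
  shows "(\<integral>\<^sup>+ z. ennreal (norm (f z)) \<partial>T.L) * (\<integral>\<^sup>+ z. ennreal (norm (g z)) \<partial>T.L) = 0"
proof -
  interpret W: conjugate_weights a b by fact
  note [simp] = i
  have "AE y' in CJ.L. AE y in CJ.L. (\<integral>\<^sup>+ \<omega>. \<integral>\<^sup>+ x. ennreal (norm (PV ((x, \<omega>), (y, y'))) * exp (pi * a (x i))) \<partial>CI.L \<partial>CI.L) < \<infinity>"
    using AE_split_pair_finite[of "\<lambda>r. ennreal (norm (PV r) * exp (pi * a (fst (fst r) i)))"] fin_a by simp
  moreover have "AE y' in CJ.L. AE y in CJ.L. (\<integral>\<^sup>+ \<omega>. \<integral>\<^sup>+ x. ennreal (norm (PV ((x, \<omega>), (y, y'))) * exp (pi * b (\<omega> i))) \<partial>CI.L \<partial>CI.L) < \<infinity>"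
    using AE_split_pair_finite[of "\<lambda>r. ennreal (norm (PV r) * exp (pi * b (snd (fst r) i)))"] fin_b by simp
  moreover have "AE y' in CJ.L. integrable CI.L (\<lambda>t. (norm (G y' t))\<^sup>2)"
    unfolding G_def by (rule CJ.AE_sub_left[OF AE_slice_square_integrable[OF g_meas g_int]])
  ultimately have "AE y' in CJ.L. AE y in CJ.L. (\<integral>\<^sup>+ t. ennreal (norm (F y t)) \<partial>CI.L) * (\<integral>\<^sup>+ t. ennreal (norm (G y' t)) \<partial>CI.L) = 0"
    using AE_space
  proof eventually_elim
    case (elim y')
    note G_sq = elim(3) and y' [measurable] = elim(4)
    from elim(1,2) AE_slice_square_integrable[OF f_meas f_int] AE_space
    show ?case
    proof eventually_elim
      case (elim y)
      note [measurable] = elim(4)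
      interpret S: stft I "F y" "G y'"
      proof
        show "F y \<in> borel_measurable CI.L" "G y' \<in> borel_measurable CI.L" by measurable
        show "integrable CI.L (\<lambda>t. (norm (F y t))\<^sup>2)" using elim(3) by (simp add: F_def)
      qed (rule G_sq)
      have V: "S.V x \<omega> = PV ((x, \<omega>), (y, y'))" for x \<omega>
        by (simp add: S.V_def CI.fourier_def S.h_def PV_def)
      show ?case
        by (rule S.stft_uncertainty[OF w i]) (use elim(1,2) in \<open>simp_all add: V\<close>)
    qed
  qed
  then have "(\<integral>\<^sup>+ y'. \<integral>\<^sup>+ y. (\<integral>\<^sup>+ t. ennreal (norm (F y t)) \<partial>CI.L) * (\<integral>\<^sup>+ t. ennreal (norm (G y' t)) \<partial>CI.L) \<partial>CJ.L \<partial>CJ.L) = (\<integral>\<^sup>+ y'. 0 \<partial>CJ.L)"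
  proof (intro nn_integral_cong_AE, eventually_elim)
    case (elim y')
    then have "(\<integral>\<^sup>+ y. (\<integral>\<^sup>+ t. ennreal (norm (F y t)) \<partial>CI.L) * (\<integral>\<^sup>+ t. ennreal (norm (G y' t)) \<partial>CI.L) \<partial>CJ.L) = (\<integral>\<^sup>+ y. 0 \<partial>CJ.L)"
      by (intro nn_integral_cong_AE) auto
    then show ?case by simp
  qed
  moreover have "(\<integral>\<^sup>+ y'. \<integral>\<^sup>+ y. (\<integral>\<^sup>+ t. ennreal (norm (F y t)) \<partial>CI.L) * (\<integral>\<^sup>+ t. ennreal (norm (G y' t)) \<partial>CI.L) \<partial>CJ.L \<partial>CJ.L)
    = (\<integral>\<^sup>+ y. \<integral>\<^sup>+ t. ennreal (norm (F y t)) \<partial>CI.L \<partial>CJ.L) * (\<integral>\<^sup>+ y'. \<integral>\<^sup>+ t. ennreal (norm (G y' t)) \<partial>CI.L \<partial>CJ.L)"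
    by (simp add: nn_integral_multc nn_integral_cmult)
  moreover have "(\<integral>\<^sup>+ y. \<integral>\<^sup>+ t. ennreal (norm (F y t)) \<partial>CI.L \<partial>CJ.L) = (\<integral>\<^sup>+ z. ennreal (norm (f z)) \<partial>T.L)"
    unfolding F_def by (rule nn_integral_split[symmetric]) measurable
  moreover have "(\<integral>\<^sup>+ y'. \<integral>\<^sup>+ t. ennreal (norm (G y' t)) \<partial>CI.L \<partial>CJ.L) = (\<integral>\<^sup>+ z. ennreal (norm (g z)) \<partial>T.L)"
  proof -
    have "(\<integral>\<^sup>+ y'. \<integral>\<^sup>+ t. ennreal (norm (G y' t)) \<partial>CI.L \<partial>CJ.L) = (\<integral>\<^sup>+ y. \<integral>\<^sup>+ t. ennreal (norm (g (merge I J (t, y)))) \<partial>CI.L \<partial>CJ.L)"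
      unfolding G_def by (rule CJ.nn_integral_sub_left[where F = "\<lambda>y. \<integral>\<^sup>+ t. ennreal (norm (g (merge I J (t, y)))) \<partial>CI.L"]) measurable
    also have "\<dots> = (\<integral>\<^sup>+ z. ennreal (norm (g z)) \<partial>T.L)"
      by (rule nn_integral_split[symmetric]) measurable
    finally show ?thesis .
  qed
  ultimately show ?thesis by simp
qed
end

section \<open>Representatives up to null sets, and the theorem\<close>

lemma complex_borel_version:
  fixes f :: "'a \<Rightarrow> complex"
  assumes [measurable]: "f \<in> borel_measurable (completion M)"
  obtains f' where "f' \<in> borel_measurable M" "AE x in M. f x = f' x"
proof -
  obtain r where r: "r \<in> borel_measurable M" "AE x in M. Re (f x) = r x"
    using completion_ex_borel_measurable_real[of "\<lambda>x. Re (f x)" M] by auto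
  obtain s where s: "s \<in> borel_measurable M" "AE x in M. Im (f x) = s x"
    using completion_ex_borel_measurable_real[of "\<lambda>x. Im (f x)" M] by auto
  note [measurable] = r(1) s(1)
  show ?thesis
  proof (rule that)
    show "(\<lambda>x. complex_of_real (r x) + \<i> * complex_of_real (s x)) \<in> borel_measurable M" by measurable
    show "AE x in M. f x = complex_of_real (r x) + \<i> * complex_of_real (s x)"
      using r(2) s(2) by eventually_elim (simp add: complex_eq_iff)
  qed
qed

text \<open>
  A function that agrees almost everywhere with a Borel function is measurable for the completion.
\<close>

lemma integral_completion_cong_AE:
  fixes f f' :: "'a \<Rightarrow> complex"
  assumes f': "f' \<in> borel_measurable M" and eq: "AE x in M. f x = f' x"
  shows "integral\<^sup>L (completion M) f = integral\<^sup>L M f'"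
proof -
  have f'c [measurable]: "f' \<in> borel_measurable (completion M)" using f' by (rule measurable_completion)
  have "f \<in> borel_measurable (completion M)"
  proof (rule measurableI)
    fix B :: "complex set" assume B [measurable]: "B \<in> sets borel"
    have 1 [measurable]: "Measurable.pred (completion M) (\<lambda>x. f x \<noteq> f' x)"
      by (rule sets_completion_AE) (use eq in auto)
    have 2 [measurable]: "Measurable.pred (completion M) (\<lambda>x. f x \<noteq> f' x \<and> f x \<in> B)"
      by (rule sets_completion_AE) (use eq in eventually_elim, auto)
    have "Measurable.pred (completion M) (\<lambda>x. (\<not> f x \<noteq> f' x \<and> f' x \<in> B) \<or> (f x \<noteq> f' x \<and> f x \<in> B))" by measurable
    moreover have "f -` B \<inter> space (completion M) = {x \<in> space (completion M). (\<not> f x \<noteq> f' x \<and> f' x \<in> B) \<or> (f x \<noteq> f' x \<and> f x \<in> B)}"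
      by auto
    ultimately show "f -` B \<inter> space (completion M) \<in> sets (completion M)" by (simp add: pred_def)
  qed auto
  then have "integral\<^sup>L (completion M) f = integral\<^sup>L (completion M) f'"
    using eq f'c by (intro integral_cong_AE AE_completion)
  also have "\<dots> = integral\<^sup>L M f'" by (rule integral_completion[OF f'])
  finally show ?thesis .
qed

lemma lp_norm_powr:
  assumes "p \<noteq> 0"
  shows "lp_norm d p x powr p = (\<Sum>j<d. \<bar>x j\<bar> powr p)"
  using assms by (simp add: lp_norm_def powr_powr sum_nonneg)

lemma lp_weight_ge:
  assumes "1 < p" "j < d"
  shows "exp (pi * (c powr p * \<bar>x j\<bar> powr p / p)) \<le> exp (pi / p * c powr p * lp_norm d p x powr p)"
proof -
  have "\<bar>x j\<bar> powr p \<le> (\<Sum>j<d. \<bar>x j\<bar> powr p)"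
    using assms by (intro member_le_sum) auto
  then have "pi / p * c powr p * \<bar>x j\<bar> powr p \<le> pi / p * c powr p * lp_norm d p x powr p"
    using assms by (intro mult_left_mono) (auto simp: lp_norm_powr)
  then show ?thesis by simp
qed

theorem theorem3p6:
  fixes d k :: nat and p q \<alpha> \<beta> :: real
    and f g :: "(nat \<Rightarrow> real) \<Rightarrow> complex"
  assumes "1 \<le> k" and "k \<le> d"
    and "1 < p" and "1 / p + 1 / q = 1"
    and "\<alpha> > 0" and "\<beta> > 0" and "\<alpha> * \<beta> \<ge> 1"
    and "square_integrable d f" and "square_integrable d g"
    and "(\<integral>\<^sup>+ \<omega>. (\<integral>\<^sup>+ x. ennreal (norm (partial_stft d k g f x \<omega>) *
            exp (pi / p * \<alpha> powr p * lp_norm d p x powr p)) \<partial>lebesgue_dim d) \<partial>lebesgue_dim d) < \<infinity>"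
    and "(\<integral>\<^sup>+ \<omega>. (\<integral>\<^sup>+ x. ennreal (norm (partial_stft d k g f x \<omega>) *
            exp (pi / q * \<beta> powr q * lp_norm d q \<omega> powr q)) \<partial>lebesgue_dim d) \<partial>lebesgue_dim d) < \<infinity>"
  shows "(AE x in lebesgue_dim d. f x = 0) \<or> (AE x in lebesgue_dim d. g x = 0)"
proof -
  define I where "I = {..<k}"
  define J where "J = {k..<d}"
  have IJ: "I \<union> J = {..<d}" using \<open>k \<le> d\<close> by (auto simp: I_def J_def)
  interpret C: coordinate_split I J by standard (auto simp: I_def J_def)
  have dim: "lebesgue_dim d = completion C.T.L" "lebesgue_dim k = completion C.CI.L"
    unfolding lebesgue_coords_def IJ by (rule refl) (simp add: I_def)
  have fm: "f \<in> borel_measurable (completion C.T.L)" "g \<in> borel_measurable (completion C.T.L)"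
    and fi: "integrable (completion C.T.L) (\<lambda>x. (norm (f x))\<^sup>2)" "integrable (completion C.T.L) (\<lambda>x. (norm (g x))\<^sup>2)"
    using assms(8,9) by (auto simp: square_integrable_def dim)
  obtain f' where f' [measurable]: "f' \<in> borel_measurable C.T.L" and ff': "AE x in C.T.L. f x = f' x"
    using complex_borel_version[OF fm(1)] .
  obtain g' where g' [measurable]: "g' \<in> borel_measurable C.T.L" and gg': "AE x in C.T.L. g x = g' x"
    using complex_borel_version[OF fm(2)] .
  have sq: "(\<integral>\<^sup>+ z. ennreal ((norm (u' z))\<^sup>2) \<partial>C.T.L) < \<infinity>"
    if "integrable (completion C.T.L) (\<lambda>x. (norm (u x))\<^sup>2)" "AE x in C.T.L. u x = u' x" for u u' :: "(nat \<Rightarrow> real) \<Rightarrow> complex"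
  proof -
    have "(\<integral>\<^sup>+ z. ennreal ((norm (u' z))\<^sup>2) \<partial>C.T.L) = (\<integral>\<^sup>+ z. ennreal ((norm (u z))\<^sup>2) \<partial>C.T.L)"
      by (rule nn_integral_cong_AE) (use that(2) in eventually_elim, simp)
    also have "\<dots> = (\<integral>\<^sup>+ z. ennreal (norm ((norm (u z))\<^sup>2)) \<partial>completion C.T.L)"
      by (simp add: nn_integral_completion)
    also have "\<dots> < \<infinity>" using that(1) unfolding integrable_iff_bounded by blast
    finally show ?thesis .
  qed
  interpret S: split_stft I J f' g'
    by standard (use f' g' sq[OF fi(1) ff'] sq[OF fi(2) gg'] in auto)
  define stft where "stft x \<omega> = S.PV ((restrict x I, restrict \<omega> I), (restrict x J, restrict \<omega> J))" for x \<omega>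
  \<comment> \<open>the exceptional null sets of \<open>f\<close> and \<open>g\<close> meet almost every slice in a null set\<close>
  have fF: "AE x in C.T.L. AE t in C.CI.L. f (merge I J (t, restrict x J)) = f' (merge I J (t, restrict x J))"
    by (rule C.AE_restrict_snd[OF C.AE_split[OF ff']])
  have gG: "AE \<omega> in C.T.L. AE t in C.CI.L. g (merge I J (t, C.CJ.sub (\<lambda>_. 0) (restrict \<omega> J))) = g' (merge I J (t, C.CJ.sub (\<lambda>_. 0) (restrict \<omega> J)))"
    by (rule C.AE_restrict_snd[OF C.CJ.AE_sub_left[OF C.AE_split[OF gg']]])
  have stft: "AE \<omega> in C.T.L. AE x in C.T.L. partial_stft d k g f x \<omega> = stft x \<omega>"
    using gG AE_space
  proof eventually_elim
    case (elim \<omega>)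
    note g\<omega> = elim(1) and \<omega> = elim(2)
    have [measurable]: "restrict \<omega> I \<in> space C.CI.L" "restrict \<omega> J \<in> space C.CJ.L" by (auto simp: space_PiM)
    from fF AE_space show ?case
    proof eventually_elim
      case (elim x)
      have [measurable]: "restrict x I \<in> space C.CI.L" "restrict x J \<in> space C.CJ.L" by (auto simp: space_PiM)
      have 1: "merge I J (t, x) = merge I J (t, restrict x J)" for t
        by (auto simp: merge_def)
      have 2: "merge I J (\<lambda>i. t i - x i, \<lambda>i. - \<omega> i) = merge I J (C.CI.sub t (restrict x I), C.CJ.sub (\<lambda>_. 0) (restrict \<omega> J))" for t
        by (auto simp: merge_def C.CI.sub_def C.CJ.sub_def)
      have 3: "exp (- (2 * of_real pi * \<i> * of_real (\<Sum>i<k. t i * \<omega> i))) = cis (- (2 * pi * C.CI.dot t (restrict \<omega> I)))" for t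
      proof -
        have "(\<Sum>i<k. t i * \<omega> i) = C.CI.dot t (restrict \<omega> I)" 
          unfolding C.CI.dot_def by (rule sum.cong) (auto simp: I_def)
        then show ?thesis by (simp only: cis_conv_exp) (simp add: mult_ac)
      qed
      have "partial_stft d k g f x \<omega> = (LINT t|completion C.CI.L. f (merge I J (t, restrict x J)) *
          cnj (g (merge I J (C.CI.sub t (restrict x I), C.CJ.sub (\<lambda>_. 0) (restrict \<omega> J)))) * cis (- (2 * pi * C.CI.dot t (restrict \<omega> I))))"
        unfolding partial_stft_def dim(2) 3 unfolding I_def[symmetric] J_def[symmetric] 2 unfolding 1 ..
      also have "\<dots> = (LINT t|C.CI.L. S.F (restrict x J) t * cnj (S.G (restrict \<omega> J) (C.CI.sub t (restrict x I))) * cis (- (2 * pi * C.CI.dot t (restrict \<omega> I))))"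
      proof (rule integral_completion_cong_AE)
        show "(\<lambda>t. S.F (restrict x J) t * cnj (S.G (restrict \<omega> J) (C.CI.sub t (restrict x I))) * cis (- (2 * pi * C.CI.dot t (restrict \<omega> I)))) \<in> borel_measurable C.CI.L"
          by measurable
        show "AE t in C.CI.L. f (merge I J (t, restrict x J)) *
          cnj (g (merge I J (C.CI.sub t (restrict x I), C.CJ.sub (\<lambda>_. 0) (restrict \<omega> J)))) * cis (- (2 * pi * C.CI.dot t (restrict \<omega> I)))
          = S.F (restrict x J) t * cnj (S.G (restrict \<omega> J) (C.CI.sub t (restrict x I))) * cis (- (2 * pi * C.CI.dot t (restrict \<omega> I)))"
          using elim(1) C.CI.AE_sub_right[OF g\<omega>, of "restrict x I"]
          by eventually_elim (simp add: S.F_def S.G_def)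
      qed
      finally show ?case by (simp add: stft_def S.PV_def)
    qed
  qed
  have q: "1 < q"
  proof -
    have "0 < 1 / p" "1 / p < 1" using \<open>1 < p\<close> by auto
    then have "0 < 1 / q" "1 / q < 1" using \<open>1 / p + 1 / q = 1\<close> by linarith+
    then show ?thesis by (simp add: field_simps split: if_splits) 
  qed
  \<comment> \<open>a smaller weight may be taken: below, only coordinate 0 of \<open>x\<close> and of \<open>\<omega>\<close> is kept\<close>
  have transfer: "(\<integral>\<^sup>+ \<omega>. \<integral>\<^sup>+ x. ennreal (norm (stft x \<omega>) * w x \<omega>) \<partial>C.T.L \<partial>C.T.L) < \<infinity>"
    if fin: "(\<integral>\<^sup>+ \<omega>. (\<integral>\<^sup>+ x. ennreal (norm (partial_stft d k g f x \<omega>) * W x \<omega>) \<partial>lebesgue_dim d) \<partial>lebesgue_dim d) < \<infinity>"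
      and le: "\<And>x \<omega>. w x \<omega> \<le> W x \<omega>" for w W :: "(nat \<Rightarrow> real) \<Rightarrow> (nat \<Rightarrow> real) \<Rightarrow> real"
  proof -
    have "(\<integral>\<^sup>+ \<omega>. \<integral>\<^sup>+ x. ennreal (norm (stft x \<omega>) * w x \<omega>) \<partial>C.T.L \<partial>C.T.L)
        \<le> (\<integral>\<^sup>+ \<omega>. \<integral>\<^sup>+ x. ennreal (norm (partial_stft d k g f x \<omega>) * W x \<omega>) \<partial>C.T.L \<partial>C.T.L)"
    proof (rule nn_integral_mono_AE, use stft in eventually_elim)
      case (elim \<omega>)
      show ?case
        by (rule nn_integral_mono_AE, use elim in eventually_elim) (auto intro!: ennreal_leI mult_left_mono le)
    qed
    then show ?thesis using fin by (simp add: dim nn_integral_completion)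
  qed
  have 0: "0 \<in> I" "0 < d" using \<open>1 \<le> k\<close> \<open>k \<le> d\<close> by (auto simp: I_def)
  have "(\<integral>\<^sup>+ z. ennreal (norm (f' z)) \<partial>C.T.L) * (\<integral>\<^sup>+ z. ennreal (norm (g' z)) \<partial>C.T.L) = 0"
  proof (rule S.split_stft_uncertainty[OF conjugate_weights_powr[OF assms(3-7)] 0(1), folded stft_def])
    show "(\<integral>\<^sup>+ \<omega>. \<integral>\<^sup>+ x. ennreal (norm (stft x \<omega>) * exp (pi * (\<alpha> powr p * \<bar>x 0\<bar> powr p / p))) \<partial>C.T.L \<partial>C.T.L) < \<infinity>"
      by (rule transfer[OF assms(10)]) (rule lp_weight_ge[OF \<open>1 < p\<close> 0(2)])
    show "(\<integral>\<^sup>+ \<omega>. \<integral>\<^sup>+ x. ennreal (norm (stft x \<omega>) * exp (pi * (\<beta> powr q * \<bar>\<omega> 0\<bar> powr q / q))) \<partial>C.T.L \<partial>C.T.L) < \<infinity>"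
      by (rule transfer[OF assms(11)]) (rule lp_weight_ge[OF q 0(2)])
  qed
  then have "(AE x in C.T.L. f' x = 0) \<or> (AE x in C.T.L. g' x = 0)"
    by (simp add: nn_integral_0_iff_AE)
  then show ?thesis
  proof
    assume "AE x in C.T.L. f' x = 0"
    with ff' have "AE x in C.T.L. f x = 0" by eventually_elim simp
    then show ?thesis unfolding dim by (auto intro: AE_completion)
  next
    assume "AE x in C.T.L. g' x = 0"
    with gg' have "AE x in C.T.L. g x = 0" by eventually_elim simp
    then show ?thesis unfolding dim by (auto intro: AE_completion)
  qed
qed

end
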